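(* For every integer $\beta\ge 0$ there exist integers $a_{j,i}$ and $b_{j,i}$ such that $$L_{4\beta+1}=5^{2\beta}a_{4\beta+1,0}(3u+ut+u^2t)+5^{2\beta+2}a_{4\beta+1,1}u+5^{2\beta+2}a_{4\beta+1,2}u^2+5^{2\beta+1}\sum_{i=3}^{(5^{4\beta+2}-1)/3}5^{\lfloor 5i/6\rfloor}a_{4\beta+1,i}u^i$$ $$\quad+5^{2\beta+2}b_{4\beta+1,1}ut+5^{2\beta+2}b_{4\beta+1,2}u^2t+5^{2\beta+1}\sum_{i=3}^{(5^{4\beta+2}-1)/3}5^{\lfloor 5i/6\rfloor}b_{4\beta+1,i}u^it,$$ $$L_{4\beta+2}=5^{2\beta+1}a_{4\beta+2,0}(ut-u^2t)+5^{2\beta+2}a_{4\beta+2,1}u+5^{2\beta+2}a_{4\beta+2,2}u^2+5^{2\beta+1}\sum_{i=3}^{(5^{4\beta+3}-5)/3}5^{\lfloor 5i/6\rfloor}a_{4\beta+2,i}u^i$$ $$\quad+5^{2\beta+2}b_{4\beta+2,1}ut+5^{2\beta+2}b_{4\beta+2,2}u^2t+5^{2\beta+1}\sum_{i=3}^{(5^{4\beta+3}-5)/3}5^{\lfloor 5i/6\rfloor}b_{4\beta+2,i}u^it,$$ $$L_{4\beta+3}=5^{2\beta+1}a_{4\beta+3,0}(7u-ut+4u^2t-15u^2)+5^{2\beta+3}a_{4\beta+3,1}u+5^{2\beta+3}a_{4\beta+3,2}u^2+5^{2\beta+2}\sum_{i=3}^{(5^{4\beta+4}-1)/3}5^{\lfloor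 5i/6\rfloor}a_{4\beta+3,i}u^i$$ $$\quad+5^{2\beta+3}b_{4\beta+3,1}ut+5^{2\beta+3}b_{4\beta+3,2}u^2t+5^{2\beta+3}b_{4\beta+3,3}u^3t+5^{2\beta+2}\sum_{i=4}^{(5^{4\beta+4}-1)/3}5^{\lfloor 5i/6\rfloor}b_{4\beta+3,i}u^it,$$ $$L_{4\beta+4}=5^{2\beta+2}a_{4\beta+4,0}(u-u^2t)+5^{2\beta+3}a_{4\beta+4,1}u+5^{2\beta+3}a_{4\beta+4,2}u^2+5^{2\beta+2}\sum_{i=3}^{(5^{4\beta+5}-5)/3}5^{\lfloor 5i/6\rfloor}a_{4\beta+4,i}u^i$$ $$\quad+5^{2\beta+3}b_{4\beta+4,1}ut+5^{2\beta+3}b_{4\beta+4,2}u^2t+5^{2\beta+2}\sum_{i=3}^{(5^{4\beta+5}-5)/3}5^{\lfloor 5i/6\rfloor}b_{4\beta+4,i}u^it.$$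
   Context: Notation: - $\mathbb{H}$ is the upper half-plane, $\tau\in\mathbb{H}$ and $q=e^{2\pi i\tau}$. - $\eta(\tau)=q^{1/24}\prod_{n\ge1}(1-q^n)$ is the Dedekind eta function. - $t=\dfrac{\eta^3(\tau)\eta(5\tau)}{\eta(2\tau)\eta^3(10\tau)}$, $u=\dfrac{\eta^7(10\tau)}{\eta(\tau)\eta^3(2\tau)\eta^3(5\tau)}$ and $A=\dfrac{\eta^2(2\tau)\eta^5(25\tau)}{\eta^5(\tau)\eta^2(50\tau)}$. - For $f:\mathbb{H}\to\mathbb{C}$, the Atkin operator is $U_5(f)(\tau)=\frac15\sum_{\lambda=0}^{4}f\big(\frac{\tau+\lambda}{5}\big)$. On $q$-expansions, $U_5(\sum a(n)q^n)=\sum a(5n)q^n$. - Set $L_0=1$, and for $\alpha\ge1$ set $L_{2\alpha-1}=U_5(AL_{2\alpha-2})$ and $L_{2\alpha}=U_5(L_{2\alpha-1})$. All equalities are identities of functions on $\mathbb{H}$. *)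

theory Defs
  imports "HOL-Analysis.Analysis"
begin

(* Functions on the upper half-plane are represented by total functions on the
   complex numbers; only their values at arguments with positive imaginary part
   are meaningful. *)

definition upper_half_plane :: "complex set" where
  "upper_half_plane = {\<tau>. Im \<tau> > 0}"

(* q^(1/24) means exp (2 pi i tau / 24); the factors are shifted by one since
   library infinite products start at index 0. *)
definition dedekind_eta :: "complex \<Rightarrow> complex" where
  "dedekind_eta \<tau> =
     exp (2 * of_real pi * \<i> * \<tau> / 24) *
     (\<Prod>n. 1 - exp (2 * of_real pi * \<i> * \<tau>) ^ Suc n)"

definition t_fun :: "complex \<Rightarrow> complex" where
  "t_fun \<tau> = dedekind_eta \<tau> ^ 3 * dedekind_eta (5 * \<tau>) /
             (dedekind_eta (2 * \<tau>) * dedekind_eta (10 * \<tau>) ^ 3)"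

definition u_fun :: "complex \<Rightarrow> complex" where
  "u_fun \<tau> = dedekind_eta (10 * \<tau>) ^ 7 /
             (dedekind_eta \<tau> * dedekind_eta (2 * \<tau>) ^ 3 * dedekind_eta (5 * \<tau>) ^ 3)"

definition A_fun :: "complex \<Rightarrow> complex" where
  "A_fun \<tau> = dedekind_eta (2 * \<tau>) ^ 2 * dedekind_eta (25 * \<tau>) ^ 5 /
             (dedekind_eta \<tau> ^ 5 * dedekind_eta (50 * \<tau>) ^ 2)"

definition U5 :: "(complex \<Rightarrow> complex) \<Rightarrow> complex \<Rightarrow> complex" where
  "U5 f \<tau> = 1 / 5 * (\<Sum>l = 0..4. f ((\<tau> + of_nat l) / 5))"

primrec L_fun :: "nat \<Rightarrow> complex \<Rightarrow> complex" where
  "L_fun 0 = (\<lambda>\<tau>. 1)"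
| "L_fun (Suc n) = (if even n then U5 (\<lambda>\<tau>. A_fun \<tau> * L_fun n \<tau>) else U5 (L_fun n))"

lemma L_fun_odd: "\<alpha> \<ge> 1 \<Longrightarrow> L_fun (2 * \<alpha> - 1) = U5 (\<lambda>\<tau>. A_fun \<tau> * L_fun (2 * \<alpha> - 2) \<tau>)"
  by (cases \<alpha>) simp_all

lemma L_fun_even: "\<alpha> \<ge> 1 \<Longrightarrow> L_fun (2 * \<alpha>) = U5 (L_fun (2 * \<alpha> - 1))"
  by (cases \<alpha>) simp_all

end

theory Submission
  imports Defs "HOL-Complex_Analysis.Complex_Analysis"
begin

text \<open>
  With the nome \<open>q\<close> as variable, the Jacobi triple product and the splitting of \<open>\<int>[\<i>]\<close> into residue classes
  modulo \<open>2 + \<i>\<close> yield two theta identities that exhibit \<open>t + 4\<close> and \<open>t + 5\<close> as eta quotients; moreover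
  \<open>t (t + 5) = 1 / u\<close>. Together these give a modular equation of degree \<open>5\<close> between
  \<open>w = \<eta>(2\<tau>) \<eta>(25\<tau>) / (\<eta>(\<tau>) \<eta>(50\<tau>))\<close> and \<open>t(5\<tau>)\<close>. Its five roots are the conjugates of \<open>w\<close> under \<open>\<tau> \<mapsto> \<tau> + \<lambda> / 5\<close>,
  so Newton's identities evaluate \<open>U\<^sub>5\<close> on a few functions. The resulting equation for \<open>u\<close> gives a linear
  recurrence of order \<open>5\<close> for \<open>U\<^sub>5(u\<^sup>i)\<close>, \<open>U\<^sub>5(u\<^sup>i t)\<close>, \<open>U\<^sub>5(A u\<^sup>i)\<close> and \<open>U\<^sub>5(A u\<^sup>i t)\<close>, whose coefficients are polynomials in
  \<open>u\<close> and \<open>u t\<close>; the coefficient of \<open>u\<^sup>j\<close> and \<open>u\<^sup>j t\<close> in each of these functions is divisible by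
  \<open>5\<close> to the power \<open>j - \<lfloor>i / 5\<rfloor> - 2\<close>. This takes care of all terms with \<open>i \<ge> 3\<close> in the
  induction, and the finitely many remaining ones are explicit.
\<close>

section \<open>The Jacobi triple product\<close>

text \<open>Relations between eta quotients often carry a surplus factor, such as
  \<open>w + 1\<close> or the cubic \<open>D\<close> in \<open>P_q_relation\<close>, which may
  vanish somewhere in the disc. Near 0 the leading Laurent terms show that it does not, so it is
  cancelled there and the identity theorem extends the result; signs and the distinctness of
  conjugates are settled in the same way. The power sums of \<open>w\<close> have denominators in
  \<open>T = t(5 tau)\<close>; multiplied by \<open>d = T / (T + 5)\<close>, \<open>w\<close>
  becomes \<open>t + 4\<close>, whose powers have averages in \<open>Z[u] + Z[u] t\<close>. The
  function \<open>A\<close> enters through \<open>A t^2 = (1 - z)^2 P\<close> with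
  \<open>z = 1 / (T + 5)\<close> and \<open>P = eta(tau) / eta(25 tau)\<close>. Bounds on single
  coefficients do not propagate through the induction: those of \<open>u\<close>,
  \<open>u t\<close>, \<open>u^2\<close>, \<open>u^2 t\<close> are divisible enough only after
  subtracting a multiple of a fixed combination. Four combinations, \<open>form1\<close> to
  \<open>form4\<close>, succeed one another. An application of \<open>U5\<close> alone brings a
  factor 5 into the combination, an application to \<open>A L\<close> brings one into the remaining
  terms, and after four steps \<open>form1\<close> returns with the factor 25.\<close>

definition q_poch_inf :: "complex \<Rightarrow> complex \<Rightarrow> complex" where
  "q_poch_inf c p = (\<Prod>n. 1 - c * p ^ n)"

lemma convergent_prod_q_poch_inf:
  assumes "norm (p::complex) < 1"
  shows "convergent_prod (\<lambda>n. 1 - c * p ^ n)"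
proof -
  have "summable (\<lambda>n. norm c * norm p ^ n)"
    using assms by (intro summable_mult summable_geometric) simp
  hence "summable (\<lambda>n. norm (1 - c * p ^ n - 1))"
    by (simp add: norm_mult norm_power)
  thus ?thesis
    using abs_convergent_prod_conv_summable abs_convergent_prod_imp_convergent_prod by blast
qed

lemma q_poch_inf_LIMSEQ:
  assumes "norm p < 1"
  shows "(\<lambda>n. \<Prod>i<n. 1 - c * p ^ i) \<longlonglongrightarrow> q_poch_inf c p"
  using convergent_prod_LIMSEQ[OF convergent_prod_q_poch_inf[OF assms, of c]]
  unfolding LIMSEQ_lessThan_iff_atMost[symmetric] q_poch_inf_def .

lemma q_poch_inf_nonzero:
  assumes "norm p < 1" "\<And>n. c * p ^ n \<noteq> 1"
  shows "q_poch_inf c p \<noteq> 0"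
  unfolding q_poch_inf_def
  using convergent_prod_q_poch_inf[OF assms(1)] assms(2) by (intro prodinf_nonzero) auto

text \<open>The index is split by its residue modulo \<open>m\<close>: the first
  \<open>n * m\<close> factors fall into \<open>m\<close> progressions of ratio
  \<open>p ^ m\<close>, and both sides are limits of these same finite products.\<close>

lemma q_poch_inf_dissect:
  assumes "norm p < 1" "m > 0"
  shows "q_poch_inf c p = (\<Prod>r<m. q_poch_inf (c * p ^ r) (p ^ m))"
proof -
  have pm: "norm (p ^ m) < 1"
    using assms by (simp add: norm_power power_less_one_iff)
  have eq: "(\<Prod>r<m. \<Prod>i<n. 1 - c * p ^ r * (p ^ m) ^ i) = (\<Prod>j<n * m. 1 - c * p ^ j)" for n
  proof -
    have "(\<Prod>j<n * m. 1 - c * p ^ j) = (\<Prod>i<n. \<Prod>j\<in>{i * m..<i * m + m}. 1 - c * p ^ j)"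
      by (rule prod.nat_group[symmetric])
    also have "\<dots> = (\<Prod>i<n. \<Prod>r<m. 1 - c * p ^ (i * m + r))"
    proof (rule prod.cong[OF refl])
      fix i
      show "(\<Prod>j\<in>{i * m..<i * m + m}. 1 - c * p ^ j) = (\<Prod>r<m. 1 - c * p ^ (i * m + r))"
        by (rule prod.reindex_bij_witness[of _ "\<lambda>r. i * m + r" "\<lambda>j. j - i * m"]) auto
    qed
    also have "\<dots> = (\<Prod>r<m. \<Prod>i<n. 1 - c * p ^ (i * m + r))"
      by (rule prod.swap)
    finally show ?thesis
      by (simp add: power_add mult_ac flip: power_mult)
  qed
  have "(\<lambda>n. \<Prod>r<m. \<Prod>i<n. 1 - c * p ^ r * (p ^ m) ^ i) \<longlonglongrightarrow> (\<Prod>r<m. q_poch_inf (c * p ^ r) (p ^ m))"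
    by (intro tendsto_prod q_poch_inf_LIMSEQ pm)
  moreover have "(\<lambda>n. \<Prod>j<n * m. 1 - c * p ^ j) \<longlonglongrightarrow> q_poch_inf c p"
    using filterlim_compose[OF q_poch_inf_LIMSEQ[OF assms(1), of c] mult_nat_right_at_top[OF assms(2)]] .
  ultimately show ?thesis
    using LIMSEQ_unique unfolding eq by blast
qed

lemma q_poch_inf_mult_minus:
  assumes "norm p < 1"
  shows "q_poch_inf c p * q_poch_inf (-c) p = q_poch_inf (c ^ 2) (p ^ 2)"
proof -
  have "(\<lambda>n. (\<Prod>i<n. 1 - c * p ^ i) * (\<Prod>i<n. 1 - (-c) * p ^ i)) \<longlonglongrightarrow> q_poch_inf c p * q_poch_inf (-c) p"
    by (intro tendsto_mult q_poch_inf_LIMSEQ assms)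
  moreover have "(\<Prod>i<n. 1 - c * p ^ i) * (\<Prod>i<n. 1 - (-c) * p ^ i) = (\<Prod>i<n. 1 - c ^ 2 * (p ^ 2) ^ i)" for n
    by (simp add: prod.distrib[symmetric] algebra_simps power2_eq_square power_mult_distrib)
  moreover have "(\<lambda>n. \<Prod>i<n. 1 - c ^ 2 * (p ^ 2) ^ i) \<longlonglongrightarrow> q_poch_inf (c ^ 2) (p ^ 2)"
    using assms by (intro q_poch_inf_LIMSEQ) (simp add: norm_power power_less_one_iff)
  ultimately show ?thesis
    using LIMSEQ_unique by fastforce
qed

section \<open>Absolutely convergent theta series over the integers\<close>

definition theta_term :: "complex \<Rightarrow> complex \<Rightarrow> int \<Rightarrow> complex" where
  "theta_term z p n = z powi n * p ^ nat (n * (n - 1) div 2)"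

text \<open>Ratio test: consecutive terms have quotient \<open>r * s ^ n\<close>, which tends to 0
  however large \<open>r\<close> is.\<close>

lemma summable_theta_nat:
  fixes r s :: real
  assumes "0 \<le> r" "0 \<le> s" "s < 1"
  shows "summable (\<lambda>n. r ^ n * s ^ (n * (n - 1) div 2))"
proof -
  have "(\<lambda>n. r * s ^ n) \<longlonglongrightarrow> r * 0"
    by (intro tendsto_intros) (use assms in auto)
  hence "eventually (\<lambda>n. r * s ^ n < 1 / 2) sequentially"
    by (rule order_tendstoD) auto
  then obtain N where N: "\<And>n. n \<ge> N \<Longrightarrow> r * s ^ n < 1 / 2"
    by (auto simp: eventually_at_top_linorder)
  show ?thesis
  proof (rule summable_ratio_test[of "1/2" N])
    fix n assume n: "n \<ge> N"
    have e: "Suc n * (Suc n - 1) div 2 = n * (n - 1) div 2 + n"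
      by (induction n) auto
    have "norm (r ^ Suc n * s ^ (Suc n * (Suc n - 1) div 2)) = (r * s ^ n) * (r ^ n * s ^ (n * (n - 1) div 2))"
      unfolding e using assms by (simp add: power_add norm_mult norm_power)
    also have "\<dots> \<le> 1 / 2 * (r ^ n * s ^ (n * (n - 1) div 2))"
      using N[OF n] assms by (intro mult_right_mono) auto
    finally show "norm (r ^ Suc n * s ^ (Suc n * (Suc n - 1) div 2)) \<le> 1 / 2 * norm (r ^ n * s ^ (n * (n - 1) div 2))"
      using assms by simp
  qed auto
qed

lemma theta_term_of_nat: "theta_term z p (int n) = z ^ n * p ^ (n * (n - 1) div 2)"
proof -
  have "nat (int n * (int n - 1) div 2) = n * (n - 1) div 2"
    by (cases n) (auto simp: nat_div_distrib nat_mult_distrib nat_add_distrib)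
  thus ?thesis by (simp add: theta_term_def)
qed

text \<open>The exponent n (n - 1) / 2 is invariant under n -> 1 - n. This carries the negative half
  of the series to a half over natural numbers with 1 / z in place of z.\<close>

lemma theta_term_reflect:
  assumes "z \<noteq> 0" "p \<noteq> 0"
  shows "theta_term z p (1 - n) = z * theta_term (1 / z) p n"
proof -
  have "(1 - n) * (1 - n - 1) = n * (n - 1)" by (simp add: algebra_simps)
  thus ?thesis
    using assms unfolding theta_term_def by (simp add: power_int_diff power_int_one_over field_simps)
qed

lemma theta_term_abs_summable:
  assumes "norm p < 1" "p \<noteq> 0" "z \<noteq> 0"
  shows "(\<lambda>n. norm (theta_term z p n)) summable_on UNIV"
proof -
  have nat: "(\<lambda>n. norm (theta_term z p (int n))) summable_on UNIV" if "z \<noteq> 0" for z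
    unfolding theta_term_of_nat norm_mult norm_power
    using assms(1) by (intro norm_summable_imp_summable_on)
      (simp add: norm_mult norm_power summable_theta_nat[of "norm z" "norm p", simplified])
  have pos: "(\<lambda>n. norm (theta_term z p n)) summable_on range int"
    by (subst summable_on_reindex) (use nat[OF assms(3)] in \<open>auto simp: o_def\<close>)
  have "(\<lambda>n. norm z * norm (theta_term (1 / z) p (int n))) summable_on UNIV"
    by (intro summable_on_cmult_right nat) (use assms in auto)
  hence "(\<lambda>n. norm (theta_term z p (1 - int n))) summable_on UNIV"
    using assms by (simp add: theta_term_reflect norm_mult)
  hence neg: "(\<lambda>n. norm (theta_term z p n)) summable_on range (\<lambda>n. 1 - int n)"
    by (subst summable_on_reindex) (auto simp: o_def inj_on_def)
  have U: "UNIV = range int \<union> range (\<lambda>n. 1 - int n)"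
  proof -
    have "x \<in> range int \<union> range (\<lambda>n. 1 - int n)" for x :: int
    proof (cases "x \<ge> 0")
      case True thus ?thesis by (metis UnI1 nonneg_int_cases rangeI)
    next
      case False
      hence "x = 1 - int (nat (1 - x))" by simp
      thus ?thesis by blast
    qed
    thus ?thesis by blast
  qed
  show ?thesis unfolding U
    by (rule summable_on_union[OF pos neg])
qed

lemma theta_term_Suc:
  assumes "z \<noteq> 0" "p \<noteq> 0"
  shows "theta_term z p (n + 1) = z * p powi n * theta_term z p n"
proof -
  have p: "p ^ nat (m * (m - 1) div 2) = p powi (m * (m - 1) div 2)" for m
  proof -
    have "m * (m - 1) \<ge> 0" by (cases "m \<ge> 1") (auto intro: mult_nonneg_nonneg mult_nonpos_nonpos)
    thus ?thesis by (simp add: power_int_def)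
  qed
  have "(n + 1) * (n + 1 - 1) = n * (n - 1) + n * 2" by (simp add: algebra_simps)
  hence "(n + 1) * (n + 1 - 1) div 2 = n * (n - 1) div 2 + n"
    by (simp only: div_mult_self1 add.commute[of n])
  thus ?thesis
    unfolding theta_term_def p using assms by (simp add: power_int_add)
qed

section \<open>Gaussian binomials and the finite triple product\<close>

definition q_poch :: "complex \<Rightarrow> nat \<Rightarrow> complex" where
  "q_poch p n = (\<Prod>i<n. 1 - p ^ Suc i)"

text \<open>The value 0 at negative indices is the usual convention for reciprocal factorials. It
  makes \<open>inv_q_poch_rec\<close> valid for every integer, in particular at k = 0, where the
  factor 1 - p^0 vanishes.\<close>

definition inv_q_poch :: "complex \<Rightarrow> int \<Rightarrow> complex" where
  "inv_q_poch p k = (if k < 0 then 0 else 1 / q_poch p (nat k))"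

lemma q_poch_nonzero: "norm p < 1 \<Longrightarrow> q_poch p n \<noteq> 0"
proof -
  assume p: "norm p < 1"
  have "p ^ Suc i \<noteq> 1" for i
  proof
    assume "p ^ Suc i = 1"
    hence "norm p ^ Suc i = 1" by (metis norm_one norm_power)
    moreover have "norm p ^ Suc i < 1" using p by (simp only: power_less_one_iff norm_ge_zero) simp
    ultimately show False by simp
  qed
  hence "1 - p ^ Suc i \<noteq> 0" for i by (metis eq_iff_diff_eq_0)
  thus ?thesis unfolding q_poch_def by (auto simp del: power_Suc)
qed

lemma inv_q_poch_rec:
  assumes "norm p < 1" "p \<noteq> 0"
  shows "inv_q_poch p (k - 1) = (1 - p powi k) * inv_q_poch p k"
proof -
  consider "k < 0" | "k = 0" | "k > 0" by linarith
  thus ?thesis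
  proof cases
    case 3
    then obtain m where m: "k = int (Suc m)" by (metis gr0_implies_Suc pos_int_cases)
    have k: "k - 1 = int m" "nat (k - 1) = m" "nat k = Suc m" "p powi k = p ^ Suc m"
      by (auto simp: m power_int_def nat_add_distrib)
    have "q_poch p (Suc m) = q_poch p m * (1 - p ^ Suc m)" by (simp add: q_poch_def)
    moreover have "q_poch p (Suc m) \<noteq> 0" using q_poch_nonzero assms by blast
    ultimately show ?thesis
      unfolding inv_q_poch_def using 3 k q_poch_nonzero[OF assms(1), of m] by (auto simp: field_simps)
  qed (auto simp: inv_q_poch_def)
qed

text \<open>This is the Gaussian binomial coefficient of 2 N over N + n; by the convention in
  \<open>inv_q_poch\<close> it is zero once |n| > N.\<close>

definition jacobi_coeff :: "complex \<Rightarrow> nat \<Rightarrow> int \<Rightarrow> complex" where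
  "jacobi_coeff p N n = q_poch p (2 * N) * inv_q_poch p (int N - n) * inv_q_poch p (int N + n)"

text \<open>Going from N to N + 1 multiplies the finite product by (1 + z p^N) (1 + p^(N+1) / z) =
  (1 + p^(2N+1)) + z p^N + p^(N+1) / z, and the three summands are the resulting contributions to
  one theta term. With X = p^(N-n) and Y = p^(N+n) all coefficients become polynomial multiples of a
  common factor, so that only a polynomial identity in X, Y, p remains.\<close>

lemma jacobi_coeff_Suc:
  assumes p: "norm p < 1" "p \<noteq> 0"
  shows "jacobi_coeff p (Suc N) n = (1 + p ^ (2 * N + 1)) * jacobi_coeff p N n
     + p powi (int N - n + 1) * jacobi_coeff p N (n - 1)
     + p powi (int N + n + 1) * jacobi_coeff p N (n + 1)"
proof -
  define X where "X = p powi (int N - n)"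
  define Y where "Y = p powi (int N + n)"
  define a where "a = inv_q_poch p (int N - n + 1)"
  define b where "b = inv_q_poch p (int N + n + 1)"
  have XY: "X * Y = p ^ (2 * N)"
  proof -
    have "X * Y = p powi (int N - n + (int N + n))"
      unfolding X_def Y_def by (rule power_int_add[symmetric]) (use p in auto)
    also have "int N - n + (int N + n) = int (2 * N)" by simp
    finally show ?thesis by (simp only: power_int_of_nat)
  qed
  have X1: "p powi (int N - n + 1) = X * p" "p powi (int N + n + 1) = Y * p"
    using p by (simp_all add: X_def Y_def power_int_add)
  have a1: "inv_q_poch p (int N - n) = (1 - X * p) * a"
    using inv_q_poch_rec[OF p, of "int N - n + 1"] by (simp add: a_def X1)
  have b1: "inv_q_poch p (int N + n) = (1 - Y * p) * b"
    using inv_q_poch_rec[OF p, of "int N + n + 1"] by (simp add: b_def X1)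
  have a2: "inv_q_poch p (int N - (n + 1)) = (1 - X) * ((1 - X * p) * a)"
    using inv_q_poch_rec[OF p, of "int N - n"] by (simp only: a1 X_def[symmetric] diff_diff_eq)
  have b2: "inv_q_poch p (int N + (n - 1)) = (1 - Y) * ((1 - Y * p) * b)"
    using inv_q_poch_rec[OF p, of "int N + n"] by (simp only: b1 Y_def[symmetric] add_diff_eq)
  have a3: "inv_q_poch p (int N - (n - 1)) = a" "inv_q_poch p (int (Suc N) - n) = a"
    unfolding a_def by (rule arg_cong[where f = "inv_q_poch p"], linarith)+
  have b3: "inv_q_poch p (int N + (n + 1)) = b" "inv_q_poch p (int (Suc N) + n) = b"
    unfolding b_def by (rule arg_cong[where f = "inv_q_poch p"], linarith)+
  have q: "q_poch p (2 * Suc N) = q_poch p (2 * N) * (1 - X * Y * p) * (1 - X * Y * p * p)"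
  proof -
    have "2 * Suc N = Suc (Suc (2 * N))" by simp
    thus ?thesis unfolding q_poch_def XY by (simp only: prod.lessThan_Suc power_Suc2)
  qed
  have r: "p ^ (2 * N + 1) = X * Y * p" by (simp add: XY)
  have "(1 - X * Y * p) * (1 - X * Y * p * p) =
      (1 + X * Y * p) * ((1 - X * p) * (1 - Y * p)) + X * p * ((1 - Y) * (1 - Y * p)) + Y * p * ((1 - X) * (1 - X * p))"
    by (simp add: algebra_simps)
  hence "C * ((1 - X * Y * p) * (1 - X * Y * p * p)) = C * ((1 + X * Y * p) * ((1 - X * p) * (1 - Y * p)) +
      X * p * ((1 - Y) * (1 - Y * p)) + Y * p * ((1 - X) * (1 - X * p)))" for C
    by (rule arg_cong)
  from this[of "q_poch p (2 * N) * a * b"] show ?thesis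
    unfolding jacobi_coeff_def q a1 b1 a2 b2 a3 b3 r X1 distrib_left
    by (simp only: mult_ac)
qed

lemma jacobi_finite:
  assumes p: "norm p < 1" "p \<noteq> 0" and z: "z \<noteq> 0"
  shows "((\<lambda>n. jacobi_coeff p N n * theta_term z p n) has_sum
          (\<Prod>j<N. (1 + z * p ^ j) * (1 + p ^ Suc j / z))) UNIV"
proof (induction N)
  case 0
  have "((\<lambda>n. jacobi_coeff p 0 n * theta_term z p n) has_sum 1) {0}"
    by (rule has_sum_finiteI) (auto simp: jacobi_coeff_def q_poch_def inv_q_poch_def theta_term_def)
  hence "((\<lambda>n. jacobi_coeff p 0 n * theta_term z p n) has_sum 1) UNIV"
    by (rule has_sum_cong_neutral[THEN iffD1, rotated -1]) (auto simp: jacobi_coeff_def inv_q_poch_def)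
  thus ?case by simp
next
  case (Suc N)
  let ?f = "\<lambda>n. jacobi_coeff p N n * theta_term z p n"
  let ?G = "\<Prod>j<N. (1 + z * p ^ j) * (1 + p ^ Suc j / z)"
  have m: "((\<lambda>n. ?f (n - 1)) has_sum ?G) UNIV"
    by (rule has_sum_reindex_bij_witness[of _ "\<lambda>n. n + 1" "\<lambda>n. n - 1", THEN iffD2, OF _ _ _ _ _ _ Suc.IH]) auto
  have q: "((\<lambda>n. ?f (n + 1)) has_sum ?G) UNIV"
    by (rule has_sum_reindex_bij_witness[of _ "\<lambda>n. n - 1" "\<lambda>n. n + 1", THEN iffD2, OF _ _ _ _ _ _ Suc.IH]) auto
  have "((\<lambda>n. (1 + p ^ (2 * N + 1)) * ?f n + z * p ^ N * ?f (n - 1) + p ^ Suc N / z * ?f (n + 1)) has_sum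
        ((1 + p ^ (2 * N + 1)) * ?G + z * p ^ N * ?G + p ^ Suc N / z * ?G)) UNIV"
    by (intro has_sum_add has_sum_cmult_right Suc.IH m q)
  also have "(1 + p ^ (2 * N + 1)) * ?G + z * p ^ N * ?G + p ^ Suc N / z * ?G =
             (\<Prod>j<Suc N. (1 + z * p ^ j) * (1 + p ^ Suc j / z))"
  proof -
    have e: "p ^ (2 * N + 1) = p ^ N * p ^ N * p" "p ^ Suc N = p ^ N * p" by (simp_all add: mult_2 power_add)
    have "(1 + X * X * p) * G + z * X * G + X * p / z * G = G * ((1 + z * X) * (1 + X * p / z))" for X G
      using z by (simp add: field_simps)
    thus ?thesis by (simp only: prod.lessThan_Suc e)
  qed
  also have "(\<lambda>n. (1 + p ^ (2 * N + 1)) * ?f n + z * p ^ N * ?f (n - 1) + p ^ Suc N / z * ?f (n + 1)) =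
             (\<lambda>n. jacobi_coeff p (Suc N) n * theta_term z p n)"
  proof
    fix n
    have 1: "theta_term z p n = z * p powi (n - 1) * theta_term z p (n - 1)"
      using theta_term_Suc[OF z p(2), of "n - 1"] by simp
    have 2: "p powi (int N - n + 1) * p powi (n - 1) = p ^ N"
      using p by (simp flip: power_int_add)
    have 3: "p powi (int N + n + 1) = p ^ Suc N * p powi n"
      using p by (simp add: power_int_add)
    have A: "p powi (int N - n + 1) * jacobi_coeff p N (n - 1) * theta_term z p n = z * p ^ N * ?f (n - 1)"
      unfolding 1 2[symmetric] by (simp add: mult_ac)
    have B: "p powi (int N + n + 1) * jacobi_coeff p N (n + 1) * theta_term z p n = p ^ Suc N / z * ?f (n + 1)"
      unfolding 3 theta_term_Suc[OF z p(2), of n] using z by simp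
    show "(1 + p ^ (2 * N + 1)) * ?f n + z * p ^ N * ?f (n - 1) + p ^ Suc N / z * ?f (n + 1) =
          jacobi_coeff p (Suc N) n * theta_term z p n"
      unfolding jacobi_coeff_Suc[OF p] distrib_right A B by (simp only: mult.assoc)
  qed
  finally show ?case .
qed

text \<open>Limit of \<open>jacobi_finite\<close> for N to infinity. The coefficients converge to
  the reciprocal of \<open>q_poch_inf p p\<close> and are bounded uniformly in N and n, so Tannery's
  theorem applies with a multiple of the absolute theta series as majorant.\<close>

theorem jacobi_triple_product:
  assumes p: "norm p < 1" "p \<noteq> 0" and z: "z \<noteq> 0"
  shows "(theta_term z p has_sum (q_poch_inf p p * q_poch_inf (-z) p * q_poch_inf (-p / z) p)) UNIV"
proof -
  have lim1: "q_poch p \<longlonglongrightarrow> q_poch_inf p p"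
    using q_poch_inf_LIMSEQ[OF p(1), of p] by (simp add: q_poch_def[abs_def])
  have nz: "q_poch_inf p p \<noteq> 0"
  proof (rule q_poch_inf_nonzero[OF p(1)])
    fix n show "p * p ^ n \<noteq> 1"
      using q_poch_nonzero[OF p(1), of "Suc n"] by (auto simp: q_poch_def)
  qed
  have lim2: "(\<lambda>n. 1 / q_poch p n) \<longlonglongrightarrow> 1 / q_poch_inf p p"
    by (intro tendsto_intros lim1 nz)
  obtain K1 where K1: "\<And>n. norm (q_poch p n) \<le> K1"
    using convergent_imp_Bseq[OF convergentI[OF lim1]] by (auto simp: Bseq_def)
  obtain K2 where K2: "\<And>n. norm (1 / q_poch p n) \<le> K2"
    using convergent_imp_Bseq[OF convergentI[OF lim2]] unfolding Bseq_def by blast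
  have K: "K1 \<ge> 0" "K2 \<ge> 0" using K1[of 0] K2[of 0] norm_ge_zero order_trans by blast+
  have K3: "norm (inv_q_poch p k) \<le> K2" for k
    using K2 K by (auto simp: inv_q_poch_def)
  have bound: "norm (jacobi_coeff p N n) \<le> K1 * K2 * K2" for N n
    unfolding jacobi_coeff_def norm_mult using K K1 K3 by (intro mult_mono) auto
  have lim3: "(\<lambda>N. inv_q_poch p (int N + n)) \<longlonglongrightarrow> 1 / q_poch_inf p p" for n
  proof (rule Lim_transform_eventually)
    have "filterlim (\<lambda>N. nat (int N + n)) at_top sequentially"
      unfolding filterlim_at_top
    proof
      fix Z show "eventually (\<lambda>N. nat (int N + n) \<ge> Z) sequentially"
        using eventually_ge_at_top[of "nat (int Z - n)"] by eventually_elim auto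
    qed
    thus "(\<lambda>N. 1 / q_poch p (nat (int N + n))) \<longlonglongrightarrow> 1 / q_poch_inf p p"
      by (rule filterlim_compose[OF lim2])
    show "eventually (\<lambda>N. 1 / q_poch p (nat (int N + n)) = inv_q_poch p (int N + n)) sequentially"
      using eventually_ge_at_top[of "nat (- n)"] by eventually_elim (auto simp: inv_q_poch_def)
  qed
  have lim4: "(\<lambda>N. jacobi_coeff p N n) \<longlonglongrightarrow> 1 / q_poch_inf p p" for n
  proof -
    have "filterlim (\<lambda>N. 2 * N) at_top (sequentially :: nat filter)"
      by (rule mult_nat_left_at_top) auto
    from filterlim_compose[OF lim1 this]
    have "(\<lambda>N. jacobi_coeff p N n) \<longlonglongrightarrow> q_poch_inf p p * (1 / q_poch_inf p p) * (1 / q_poch_inf p p)"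
      unfolding jacobi_coeff_def using lim3[of n] lim3[of "-n"] by (intro tendsto_mult) auto
    thus ?thesis using nz by simp
  qed
  \<comment> \<open>\<open>int_decode\<close> enumerates the integers and turns sums over them into
    series indexed by natural numbers, the setting of Tannery's theorem.\<close>
  define a where "a k N = jacobi_coeff p N (int_decode k) * theta_term z p (int_decode k)" for k N
  define b where "b k = 1 / q_poch_inf p p * theta_term z p (int_decode k)" for k
  define M where "M k = K1 * K2 * K2 * norm (theta_term z p (int_decode k))" for k
  have bij: "bij_betw int_decode UNIV UNIV" by (rule bij_int_decode)
  have sumM: "summable M"
  proof -
    have "(\<lambda>k. norm (theta_term z p (int_decode k))) summable_on UNIV"
      using theta_term_abs_summable[OF p z] summable_on_reindex_bij_betw[OF bij] by fastforce
    thus ?thesis unfolding M_def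
      by (intro summable_mult) (rule summable_on_imp_summable)
  qed
  have tan: "summable (\<lambda>n. norm (b n)) \<and> (\<lambda>N. \<Sum>k. a k N) \<longlonglongrightarrow> (\<Sum>k. b k)"
  proof -
    have "eventually (\<lambda>(k, N). norm (a k N) \<le> M k) (at_top \<times>\<^sub>F sequentially)"
      unfolding a_def M_def norm_mult by (intro always_eventually) (auto intro!: mult_right_mono bound)
    moreover have "(\<lambda>N. a k N) \<longlonglongrightarrow> b k" for k
      unfolding a_def b_def by (intro tendsto_mult lim4 tendsto_const)
    ultimately show ?thesis using tannerys_theorem[of a b sequentially M] sumM by auto
  qed
  have sumb: "(\<Sum>k. b k) = 1 / q_poch_inf p p * infsum (theta_term z p) UNIV"
  proof -
    have "(theta_term z p) summable_on UNIV"
      using theta_term_abs_summable[OF p z] by (rule abs_summable_summable)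
    hence "((\<lambda>n. 1 / q_poch_inf p p * theta_term z p n) has_sum (1 / q_poch_inf p p * infsum (theta_term z p) UNIV)) UNIV"
      by (intro has_sum_cmult_right) simp
    hence "(b has_sum (1 / q_poch_inf p p * infsum (theta_term z p) UNIV)) UNIV"
      unfolding b_def by (subst has_sum_reindex_bij_betw[OF bij, of "\<lambda>n. 1 / q_poch_inf p p * theta_term z p n"])
    thus ?thesis by (metis has_sum_imp_sums sums_unique)
  qed
  have suma: "(\<Sum>k. a k N) = (\<Prod>j<N. 1 - (-z) * p ^ j) * (\<Prod>j<N. 1 - (-p / z) * p ^ j)" for N
  proof -
    have "((\<lambda>k. a k N) has_sum (\<Prod>j<N. (1 + z * p ^ j) * (1 + p ^ Suc j / z))) UNIV"
      unfolding a_def using has_sum_reindex_bij_betw[OF bij, of "\<lambda>n. jacobi_coeff p N n * theta_term z p n"]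
        jacobi_finite[OF p z, of N] by simp
    hence "(\<Sum>k. a k N) = (\<Prod>j<N. (1 + z * p ^ j) * (1 + p ^ Suc j / z))"
      by (metis has_sum_imp_sums sums_unique)
    thus ?thesis by (simp add: prod.distrib)
  qed
  have "(\<lambda>N. \<Sum>k. a k N) \<longlonglongrightarrow> q_poch_inf (-z) p * q_poch_inf (-p / z) p"
    unfolding suma by (intro tendsto_mult q_poch_inf_LIMSEQ p)
  with tan sumb have "1 / q_poch_inf p p * infsum (theta_term z p) UNIV = q_poch_inf (-z) p * q_poch_inf (-p / z) p"
    using LIMSEQ_unique by metis
  hence "infsum (theta_term z p) UNIV = q_poch_inf p p * q_poch_inf (-z) p * q_poch_inf (-p / z) p"
    using nz by (simp add: field_simps)
  thus ?thesis
    using theta_term_abs_summable[OF p z] abs_summable_summable has_sum_infsum by metis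
qed

section \<open>Two theta identities\<close>

lemma has_sum_times_complex:
  fixes f :: "'a \<Rightarrow> complex" and g :: "'b \<Rightarrow> complex"
  assumes f: "(f has_sum a) A" and g: "(g has_sum b) B"
  shows "((\<lambda>(x, y). f x * g y) has_sum (a * b)) (A \<times> B)"
proof -
  have fs: "(\<lambda>x. norm (f x)) summable_on A" and gs: "(\<lambda>y. norm (g y)) summable_on B"
    using f g has_sum_imp_summable summable_on_iff_abs_summable_on_complex by blast+
  have "(\<lambda>z. norm ((\<lambda>(x, y). f x * g y) z)) summable_on (A \<times> B)"
    unfolding Infinite_Sum.abs_summable_on_Sigma_iff
    using fs gs by (auto simp: norm_mult infsum_cmult_right' abs_mult infsum_nonneg
        intro!: summable_on_cmult_right summable_on_cmult_left)
  hence "(\<lambda>(x, y). f x * g y) summable_on (A \<times> B)"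
    by (rule abs_summable_summable)
  then obtain S where S: "((\<lambda>(x, y). f x * g y) has_sum S) (A \<times> B)"
    by (auto simp: summable_on_def)
  have "((\<lambda>x. f x * b) has_sum S) A"
    by (rule has_sum_Sigma'[OF S]) (auto intro!: has_sum_cmult_right g)
  moreover have "((\<lambda>x. f x * b) has_sum (a * b)) A"
    by (intro has_sum_cmult_left f)
  ultimately have "S = a * b" by (rule has_sum_unique)
  with S show ?thesis by simp
qed

text \<open>
  In terms of Gaussian integers, \<open>(x, y) \<mapsto> (2 * x - y, x + 2 * y)\<close> is multiplication by \<open>2 + \<i>\<close>,
  and \<open>\<i>\<close> permutes the four non-zero residue classes modulo \<open>2 + \<i>\<close> cyclically.
\<close>

lemma has_sum_gauss_residues:
  fixes G :: "int \<times> int \<Rightarrow> complex"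
  assumes rot: "\<And>m n. G (- n, m) = G (m, n)"
  assumes S0: "((\<lambda>(x, y). G (2 * x - y, x + 2 * y)) has_sum S0) UNIV"
  assumes S1: "((\<lambda>(x, y). G (1 + 2 * x - y, x + 2 * y)) has_sum S1) UNIV"
  shows "(G has_sum (S0 + 4 * S1)) UNIV"
proof -
  \<comment> \<open>Modulo 2 + i one has i = -2, so m + n i is congruent to m - 2 n, and
    \<open>A c\<close> is the residue class of c.\<close>
  define A where "A c = {(m, n). 5 dvd m - 2 * n - (c :: int)}" for c
  have A_class: "(G has_sum S) (A c)" if "((\<lambda>(x, y). G (c + 2 * x - y, x + 2 * y)) has_sum S) UNIV" for c S
  proof -
    have inv: "c + 2 * (n + 2 * ((m - 2 * n - c) div 5)) - - ((m - 2 * n - c) div 5) = m" if "5 dvd m - 2 * n - c" for m n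
    proof -
      obtain k where k: "m - 2 * n - c = 5 * k" using \<open>5 dvd m - 2 * n - c\<close> by (elim dvdE)
      show ?thesis unfolding k using k by simp
    qed
    have neg: "- (b * 5) div 5 = - b" for b :: int
      using nonzero_mult_div_cancel_right[of 5 "- b"] by simp
    show ?thesis
      by (rule has_sum_reindex_bij_witness[of _ "\<lambda>(x, y). (c + 2 * x - y, x + 2 * y)"
            "\<lambda>(m, n). (n + 2 * ((m - 2 * n - c) div 5), - ((m - 2 * n - c) div 5))", THEN iffD2, OF _ _ _ _ _ _ that])
         (use inv in \<open>auto simp: A_def algebra_simps neg\<close>)
  qed
  have A0: "(G has_sum S0) (A 0)" using A_class[of 0] S0 by simp
  have A1: "(G has_sum S1) (A 1)" using A_class[of 1] S1 by simp
  have rot': "G (n, - m) = G (m, n)" for m n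
    using rot[of "- n" "- m"] rot[of m "- n"] rot[of n m] by simp
  have rot_dvd: "5 dvd n + 2 * m - c \<longleftrightarrow> 5 dvd m - 2 * n - 3 * c" for m n c :: int
  proof
    assume "5 dvd n + 2 * m - c"
    hence "5 dvd 3 * (n + 2 * m - c) - 5 * (m + n)" by (rule dvd_diff[OF dvd_mult dvd_triv_left])
    thus "5 dvd m - 2 * n - 3 * c" by (simp add: algebra_simps)
  next
    assume "5 dvd m - 2 * n - 3 * c"
    hence "5 dvd 2 * (m - 2 * n - 3 * c) + 5 * (n + c)" by (rule dvd_add[OF dvd_mult dvd_triv_left])
    thus "5 dvd n + 2 * m - c" by (simp add: algebra_simps)
  qed
  have rot_dvd': "5 dvd - b - 2 * a - 3 * c" if "5 dvd a - 2 * b - c" for a b c :: int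
    using rot_dvd[of a "- b" c] that by simp
  \<comment> \<open>The rotation is multiplication by i, which is -2 = 3 modulo 2 + i. Starting from
    the class 1 it runs through 1, 3, 9 = 4, 12 = 2.\<close>
  have A_rot: "(G has_sum S) (A (3 * c))" if "(G has_sum S) (A c)" for S c
    by (rule has_sum_reindex_bij_witness[of _ "\<lambda>(m, n). (- n, m)" "\<lambda>(m, n). (n, - m)", THEN iffD2, OF _ _ _ _ _ _ that])
       (use rot' rot_dvd rot_dvd' in \<open>auto simp: A_def\<close>)
  have A3: "(G has_sum S1) (A 3)" using A_rot[OF A1] by simp
  have "5 dvd k - 9 \<longleftrightarrow> 5 dvd k - 4" "5 dvd k - 12 \<longleftrightarrow> 5 dvd k - 2" for k :: int by presburger+
  hence A94: "A 9 = A 4" and A122: "A 12 = A 2" by (simp_all add: A_def)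
  have A4: "(G has_sum S1) (A 4)" using A_rot[OF A3] A94 by simp
  have A2: "(G has_sum S1) (A 2)" using A_rot[OF A4] A122 by simp
  have disj: "A c \<inter> A d = {}" if "\<not> 5 dvd c - d" for c d
  proof -
    have "5 dvd (m - 2 * n - d) - (m - 2 * n - c)" if "(m, n) \<in> A c \<inter> A d" for m n
      by (rule dvd_diff) (use that in \<open>auto simp: A_def\<close>)
    thus ?thesis using that by auto
  qed
  have "(G has_sum (S0 + (S1 + (S1 + (S1 + S1))))) (A 0 \<union> (A 1 \<union> (A 2 \<union> (A 3 \<union> A 4))))"
    by (intro has_sum_Un_disjoint A0 A1 A2 A3 A4) (simp_all add: Int_Un_distrib disj)
  also have "A 0 \<union> (A 1 \<union> (A 2 \<union> (A 3 \<union> A 4))) = UNIV"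
  proof -
    have "5 dvd k \<or> 5 dvd k - 1 \<or> 5 dvd k - 2 \<or> 5 dvd k - 3 \<or> 5 dvd k - 4" for k :: int by presburger
    from this have "z \<in> A 0 \<union> (A 1 \<union> (A 2 \<union> (A 3 \<union> A 4)))" for z
      by (cases z) (simp add: A_def)
    thus ?thesis by blast
  qed
  finally show ?thesis by simp
qed

text \<open>Makes the exponent of q itself visible, so that quadratic forms in the exponents can be
  compared.\<close>

lemma theta_term_powi:
  assumes "q \<noteq> 0" "c \<noteq> 0"
  shows "theta_term (c * q ^ a) (q ^ b) n = c powi n * q powi (int a * n + int b * (n * (n - 1) div 2))"
proof -
  have "n * (n - 1) \<ge> 0" by (cases "n \<ge> 1") (auto intro: mult_nonneg_nonneg mult_nonpos_nonpos)
  hence "(q ^ b) ^ nat (n * (n - 1) div 2) = q powi (int b * (n * (n - 1) div 2))"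
    by (simp add: power_int_def nat_mult_distrib power_mult)
  moreover have "(q ^ a) powi n = q powi (int a * n)"
    by (simp add: power_int_mult)
  ultimately show ?thesis
    unfolding theta_term_def using assms by (simp add: power_int_mult_distrib power_int_add)
qed

section \<open>Classical theta functions as quotients of Euler products\<close>

definition euler_prod :: "complex \<Rightarrow> complex" where
  "euler_prod q = q_poch_inf q q"

lemma euler_prod_nonzero: "norm q < 1 \<Longrightarrow> euler_prod q \<noteq> 0"
  unfolding euler_prod_def
proof (rule q_poch_inf_nonzero)
  fix n assume q: "norm q < 1"
  show "q * q ^ n \<noteq> 1"
    using q_poch_nonzero[OF q, of "Suc n"] by (auto simp: q_poch_def)
qed auto

lemma norm_power_less_one: "norm (q :: complex) < 1 \<Longrightarrow> n > 0 \<Longrightarrow> norm (q ^ n) < 1"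
  by (simp add: norm_power power_less_one_iff)

lemma q_poch_inf_odd:
  assumes "norm q < 1"
  shows "q_poch_inf q (q ^ 2) = euler_prod q / euler_prod (q ^ 2)"
proof -
  have "euler_prod q = q_poch_inf q (q ^ 2) * euler_prod (q ^ 2)"
    unfolding euler_prod_def using q_poch_inf_dissect[OF assms, of 2 q]
    by (simp add: numeral_2_eq_2)
  thus ?thesis using euler_prod_nonzero[OF norm_power_less_one[OF assms, of 2]] by simp
qed

lemma q_poch_inf_minus:
  assumes "norm q < 1"
  shows "q_poch_inf (- q) q = euler_prod (q ^ 2) / euler_prod q"
  using q_poch_inf_mult_minus[OF assms, of q] euler_prod_nonzero[OF assms]
  by (simp add: euler_prod_def field_simps)

lemma q_poch_inf_minus_odd:
  assumes "norm q < 1"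
  shows "q_poch_inf (- q) (q ^ 2) = euler_prod (q ^ 2) ^ 2 / (euler_prod q * euler_prod (q ^ 4))"
proof -
  have q2: "norm (q ^ 2) < 1" "norm (q ^ 4) < 1" using assms by (auto intro: norm_power_less_one)
  have "q_poch_inf q (q ^ 2) * q_poch_inf (- q) (q ^ 2) = q_poch_inf (q ^ 2) ((q ^ 2) ^ 2)"
    by (rule q_poch_inf_mult_minus[OF q2(1)])
  hence "euler_prod q / euler_prod (q ^ 2) * q_poch_inf (- q) (q ^ 2) = euler_prod (q ^ 2) / euler_prod ((q ^ 2) ^ 2)"
    unfolding q_poch_inf_odd[OF assms] q_poch_inf_odd[OF q2(1)] .
  moreover have "(q ^ 2) ^ 2 = q ^ 4" by (simp flip: power_mult)
  ultimately show ?thesis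
    using euler_prod_nonzero[OF assms] euler_prod_nonzero[OF q2(1)] euler_prod_nonzero[OF q2(2)]
    by (simp add: field_simps power2_eq_square)
qed

text \<open>The series is Ramanujan's phi(-q), the sum of (-1)^n q^(n^2). In the triple product both
  outer factors are the product over odd powers of q.\<close>

lemma theta_phi:
  assumes "norm q < 1" "q \<noteq> 0"
  shows "(theta_term (- q) (q ^ 2) has_sum (euler_prod q ^ 2 / euler_prod (q ^ 2))) UNIV"
proof -
  have q2: "norm (q ^ 2) < 1" using assms by (auto intro: norm_power_less_one)
  have "(theta_term (- q) (q ^ 2) has_sum (euler_prod (q ^ 2) * q_poch_inf q (q ^ 2) * q_poch_inf q (q ^ 2))) UNIV"
    using jacobi_triple_product[OF q2, of "- q"] assms by (simp add: power2_eq_square euler_prod_def)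
  also have "euler_prod (q ^ 2) * q_poch_inf q (q ^ 2) * q_poch_inf q (q ^ 2) = euler_prod q ^ 2 / euler_prod (q ^ 2)"
    using euler_prod_nonzero[OF q2] unfolding q_poch_inf_odd[OF assms(1)] by (simp add: power2_eq_square)
  finally show ?thesis .
qed

text \<open>The series is psi(q), the sum of q^(2 j^2 + j) over all integers j. The outer factors of
  the triple product run over the residues 3 and 1 modulo 4, together the odd numbers.\<close>

lemma theta_psi:
  assumes "norm q < 1" "q \<noteq> 0"
  shows "(theta_term (q ^ 3) (q ^ 4) has_sum (euler_prod (q ^ 2) ^ 2 / euler_prod q)) UNIV"
proof -
  have q4: "norm (q ^ 4) < 1" and q2: "norm (q ^ 2) < 1" using assms by (auto intro: norm_power_less_one)
  have s: "q ^ 4 / q ^ 3 = q" using assms by (simp add: field_simps power_def)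
  have "q_poch_inf (- q) (q ^ 2) = q_poch_inf (- q) (q ^ 4) * q_poch_inf (- (q ^ 3)) (q ^ 4)"
    using q_poch_inf_dissect[OF q2, of 2 "- q"] by (simp add: numeral_2_eq_2 numeral_3_eq_3 flip: power_mult)
       (simp add: numeral_eq_Suc mult.assoc)
  moreover have "(theta_term (q ^ 3) (q ^ 4) has_sum (euler_prod (q ^ 4) * q_poch_inf (- (q ^ 3)) (q ^ 4) * q_poch_inf (- q) (q ^ 4))) UNIV"
    using jacobi_triple_product[OF q4, of "q ^ 3"] assms by (simp add: euler_prod_def s)
  ultimately have "(theta_term (q ^ 3) (q ^ 4) has_sum (euler_prod (q ^ 4) * q_poch_inf (- q) (q ^ 2))) UNIV"
    by (simp add: mult_ac)
  also have "euler_prod (q ^ 4) * q_poch_inf (- q) (q ^ 2) = euler_prod (q ^ 2) ^ 2 / euler_prod q"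
    using euler_prod_nonzero[OF q4] unfolding q_poch_inf_minus_odd[OF assms(1)] by simp
  finally show ?thesis .
qed

text \<open>The two triple products use the residues 9, 1 and 3, 7 modulo 10. These are the odd
  residues except 5, so the product of the two series is the product over odd powers of q with the
  multiples of 5 removed, times the square of \<open>euler_prod (q ^ 10)\<close>.\<close>

lemma theta_odd_residues_10:
  assumes "norm q < 1" "q \<noteq> 0"
  obtains a b where "(theta_term (- (q ^ 9)) (q ^ 10) has_sum a) UNIV" "(theta_term (- (q ^ 3)) (q ^ 10) has_sum b) UNIV"
    "a * b = euler_prod (q ^ 10) ^ 3 * euler_prod q / (euler_prod (q ^ 2) * euler_prod (q ^ 5))"
proof
  have q: "norm (q ^ 10) < 1" "norm (q ^ 2) < 1" "norm (q ^ 5) < 1" using assms by (auto intro: norm_power_less_one)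
  let ?Q = "\<lambda>k. q_poch_inf (q ^ k) (q ^ 10)"
  have s: "q ^ 10 / q ^ 9 = q" "q ^ 10 / q ^ 3 = q ^ 7"
    using assms by (simp_all add: field_simps flip: power_add) (simp add: numeral_eq_Suc)
  show "(theta_term (- (q ^ 9)) (q ^ 10) has_sum (euler_prod (q ^ 10) * ?Q 9 * ?Q 1)) UNIV"
    using jacobi_triple_product[OF q(1), of "- (q ^ 9)"] assms by (simp add: euler_prod_def s)
  show "(theta_term (- (q ^ 3)) (q ^ 10) has_sum (euler_prod (q ^ 10) * ?Q 3 * ?Q 7)) UNIV"
    using jacobi_triple_product[OF q(1), of "- (q ^ 3)"] assms by (simp add: euler_prod_def s)
  have "q_poch_inf q (q ^ 2) = ?Q 1 * ?Q 3 * ?Q 5 * ?Q 7 * ?Q 9"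
    using q_poch_inf_dissect[OF q(2), of 5 q]
    by (simp add: eval_nat_numeral mult_ac)
  moreover have "?Q 5 = euler_prod (q ^ 5) / euler_prod (q ^ 10)"
    using q_poch_inf_odd[OF q(3)] by (simp flip: power_mult)
  ultimately have "euler_prod q / euler_prod (q ^ 2) = ?Q 1 * ?Q 3 * (euler_prod (q ^ 5) / euler_prod (q ^ 10)) * ?Q 7 * ?Q 9"
    using q_poch_inf_odd[OF assms(1)] by simp
  thus "euler_prod (q ^ 10) * ?Q 9 * ?Q 1 * (euler_prod (q ^ 10) * ?Q 3 * ?Q 7) =
     euler_prod (q ^ 10) ^ 3 * euler_prod q / (euler_prod (q ^ 2) * euler_prod (q ^ 5))"
    using euler_prod_nonzero[OF q(1)] euler_prod_nonzero[OF q(2)] euler_prod_nonzero[OF q(3)]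
    by (simp add: field_simps power3_eq_cube)
qed

text \<open>As before, now with the residues 1, 4 and 2, 3 modulo 5: together they give
  \<open>q_poch_inf (- q) q\<close> without the exponents divisible by 5.\<close>

lemma theta_residues_5:
  assumes "norm q < 1" "q \<noteq> 0"
  obtains a b where "(theta_term q (q ^ 5) has_sum a) UNIV" "(theta_term (q ^ 2) (q ^ 5) has_sum b) UNIV"
    "a * b = euler_prod (q ^ 5) ^ 3 * euler_prod (q ^ 2) / (euler_prod q * euler_prod (q ^ 10))"
proof
  have q: "norm (q ^ 10) < 1" "norm (q ^ 2) < 1" "norm (q ^ 5) < 1" using assms by (auto intro: norm_power_less_one)
  let ?Q = "\<lambda>k. q_poch_inf (- (q ^ k)) (q ^ 5)"
  have s: "q ^ 5 / q = q ^ 4" "q ^ 5 / q ^ 2 = q ^ 3"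
    using assms by (simp_all add: field_simps flip: power_add) (simp add: numeral_eq_Suc)
  show "(theta_term q (q ^ 5) has_sum (euler_prod (q ^ 5) * ?Q 1 * ?Q 4)) UNIV"
    using jacobi_triple_product[OF q(3), of "q"] assms by (simp add: euler_prod_def s)
  show "(theta_term (q ^ 2) (q ^ 5) has_sum (euler_prod (q ^ 5) * ?Q 2 * ?Q 3)) UNIV"
    using jacobi_triple_product[OF q(3), of "q ^ 2"] assms by (simp add: euler_prod_def s)
  have "q_poch_inf (- q) q = ?Q 1 * ?Q 2 * ?Q 3 * ?Q 4 * ?Q 5"
    using q_poch_inf_dissect[OF assms(1), of 5 "- q"]
    by (simp add: eval_nat_numeral mult_ac)
  moreover have "?Q 5 = euler_prod (q ^ 10) / euler_prod (q ^ 5)"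
    using q_poch_inf_minus[OF q(3)] by (simp flip: power_mult)
  ultimately have "euler_prod (q ^ 2) / euler_prod q = ?Q 1 * ?Q 2 * ?Q 3 * ?Q 4 * (euler_prod (q ^ 10) / euler_prod (q ^ 5))"
    using q_poch_inf_minus[OF assms(1)] by simp
  thus "euler_prod (q ^ 5) * ?Q 1 * ?Q 4 * (euler_prod (q ^ 5) * ?Q 2 * ?Q 3) =
     euler_prod (q ^ 5) ^ 3 * euler_prod (q ^ 2) / (euler_prod q * euler_prod (q ^ 10))"
    using euler_prod_nonzero[OF q(1)] euler_prod_nonzero[OF assms(1)] euler_prod_nonzero[OF q(3)]
    by (simp add: field_simps power3_eq_cube)
qed

text \<open>The left side is phi(-q)^2, a sum of (-1)^(m+n) q^(m^2+n^2) over the Gaussian integers m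
  + n i. Multiples of 2 + i have five times the norm of the cofactor and contribute phi(-q^5)^2. On
  the class of 1 the exponent is 1 plus a function of x plus a function of y, so the sum factors
  into the two series of \<open>theta_odd_residues_10\<close>.\<close>

lemma phi_identity:
  assumes "norm q < 1" "q \<noteq> 0"
  shows "(euler_prod q ^ 2 / euler_prod (q ^ 2)) ^ 2 = (euler_prod (q ^ 5) ^ 2 / euler_prod (q ^ 10)) ^ 2
     - 4 * q * (euler_prod (q ^ 10) ^ 3 * euler_prod q / (euler_prod (q ^ 2) * euler_prod (q ^ 5)))"
proof -
  define G where "G = (\<lambda>(m, n). theta_term (- q) (q ^ 2) m * theta_term (- q) (q ^ 2) n)"
  have ev: "2 * (n * (n - 1) div 2) = n * n - n" for n :: int
    by (simp add: right_diff_distrib)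
  have t1: "theta_term (- q) (q ^ 2) n = (-1) powi n * q powi (n * n)" for n
    using theta_term_powi[of q "-1" 1 2 n] assms ev[of n] by simp
  have t5: "theta_term (- (q ^ 5)) ((q ^ 5) ^ 2) n = (-1) powi n * q powi (5 * (n * n))" for n
  proof -
    have e: "int 5 * n + int 10 * (n * (n - 1) div 2) = 5 * (n * n)" using ev[of n] unfolding of_nat_numeral by linarith
    show ?thesis using theta_term_powi[of q "-1" 5 10 n, unfolded e] assms by (simp flip: power_mult)
  qed
  have t9: "theta_term (- (q ^ 9)) (q ^ 10) n = (-1) powi n * q powi (5 * (n * n) + 4 * n)" for n
  proof -
    have e: "int 9 * n + int 10 * (n * (n - 1) div 2) = 5 * (n * n) + 4 * n" using ev[of n] unfolding of_nat_numeral by linarith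
    show ?thesis using theta_term_powi[of q "-1" 9 10 n, unfolded e] assms by simp
  qed
  have t3: "theta_term (- (q ^ 3)) (q ^ 10) n = (-1) powi n * q powi (5 * (n * n) - 2 * n)" for n
  proof -
    have e: "int 3 * n + int 10 * (n * (n - 1) div 2) = 5 * (n * n) - 2 * n" using ev[of n] unfolding of_nat_numeral by linarith
    show ?thesis using theta_term_powi[of q "-1" 3 10 n, unfolded e] assms by simp
  qed
  have G: "G (m, n) = (-1) powi (m + n) * q powi (m * m + n * n)" for m n
    unfolding G_def using assms by (simp add: t1 power_int_add)
  have q5: "norm (q ^ 5) < 1" "q ^ 5 \<noteq> 0" using assms by (auto intro: norm_power_less_one)
  have sgn: "(-1 :: complex) powi m = (-1) powi n" if "even (m - n)" for m n :: int
    using that by (auto simp: power_int_minus_left)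
  obtain a b where ab: "(theta_term (- (q ^ 9)) (q ^ 10) has_sum a) UNIV" "(theta_term (- (q ^ 3)) (q ^ 10) has_sum b) UNIV"
    "a * b = euler_prod (q ^ 10) ^ 3 * euler_prod q / (euler_prod (q ^ 2) * euler_prod (q ^ 5))"
    using theta_odd_residues_10[OF assms] .
  define c where "c = euler_prod (q ^ 5) ^ 2 / euler_prod (q ^ 10)"
  have c: "(theta_term (- (q ^ 5)) ((q ^ 5) ^ 2) has_sum c) UNIV"
    using theta_phi[OF q5] by (simp add: c_def flip: power_mult)
  have "(G has_sum (euler_prod q ^ 2 / euler_prod (q ^ 2)) * (euler_prod q ^ 2 / euler_prod (q ^ 2))) UNIV"
    using has_sum_times_complex[OF theta_phi[OF assms] theta_phi[OF assms]] by (simp add: G_def)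
  moreover have "(G has_sum (c * c + 4 * (- q * (a * b)))) UNIV"
  proof (rule has_sum_gauss_residues)
    show "G (- n, m) = G (m, n)" for m n
      unfolding G using sgn[of "- n + m" "m + n"] by (simp add: add.commute)
    have "G (2 * x - y, x + 2 * y) = theta_term (- (q ^ 5)) ((q ^ 5) ^ 2) x * theta_term (- (q ^ 5)) ((q ^ 5) ^ 2) y" for x y
    proof -
      have "(2 * x - y) * (2 * x - y) + (x + 2 * y) * (x + 2 * y) = 5 * (x * x) + 5 * (y * y)" by (simp add: algebra_simps)
      thus ?thesis unfolding G t5 using assms sgn[of "2 * x - y + (x + 2 * y)" "x + y"] by (simp add: power_int_add)
    qed
    thus "((\<lambda>(x, y). G (2 * x - y, x + 2 * y)) has_sum c * c) UNIV"
      using has_sum_times_complex[OF c c] by simp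
    have "G (1 + 2 * x - y, x + 2 * y) = - q * (theta_term (- (q ^ 9)) (q ^ 10) x * theta_term (- (q ^ 3)) (q ^ 10) y)" for x y
    proof -
      have "(1 + 2 * x - y) * (1 + 2 * x - y) + (x + 2 * y) * (x + 2 * y) = 1 + (5 * (x * x) + 4 * x) + (5 * (y * y) - 2 * y)"
        by (simp add: algebra_simps)
      moreover have "(-1 :: complex) powi (1 + 2 * x - y + (x + 2 * y)) = (-1) powi (1 + x + y)"
        by (rule sgn) auto
      ultimately show ?thesis unfolding G t9 t3 using assms by (simp add: power_int_add del: power_int_add_1 power_int_add_1')
    qed
    thus "((\<lambda>(x, y). G (1 + 2 * x - y, x + 2 * y)) has_sum - q * (a * b)) UNIV"
      using has_sum_cmult_right[OF has_sum_times_complex[OF ab(1,2)], of "- q"] by (simp add: case_prod_unfold)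
  qed
  ultimately have "(euler_prod q ^ 2 / euler_prod (q ^ 2)) * (euler_prod q ^ 2 / euler_prod (q ^ 2)) = c * c + 4 * (- q * (a * b))"
    by (rule has_sum_unique)
  thus ?thesis unfolding ab(3) c_def[symmetric] by (simp add: power2_eq_square)
qed

text \<open>The same dissection for psi(q)^2, with the sum restricted to odd m and n and exponent
  (m^2 + n^2 - 2) / 8.\<close>

lemma psi_identity:
  assumes "norm q < 1" "q \<noteq> 0"
  shows "(euler_prod (q ^ 2) ^ 2 / euler_prod q) ^ 2 = q * (euler_prod (q ^ 10) ^ 2 / euler_prod (q ^ 5)) ^ 2
     + euler_prod (q ^ 5) ^ 3 * euler_prod (q ^ 2) / (euler_prod q * euler_prod (q ^ 10))"
proof -
  \<comment> \<open>Over odd m the exponents (m^2 - 1) / 8 produce 2 psi(q): the m with m mod 4 = 1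
    give psi(q) and their negatives give it again. In this form the summand of the square is
    invariant under rotation by i.\<close>
  define h where "h q m = (if odd m then q powi ((m * m - 1) div 8) else 0)" for q :: complex and m :: int
  have h_sum: "(h q has_sum 2 * (euler_prod (q ^ 2) ^ 2 / euler_prod q)) UNIV" if q: "norm q < 1" "q \<noteq> 0" for q
  proof -
    let ?A = "{m::int. m mod 4 = 1}" and ?B = "{m::int. m mod 4 = 3}"
    have t: "h q (4 * j + 1) = theta_term (q ^ 3) (q ^ 4) j" for j
    proof -
      have "((4 * j + 1) * (4 * j + 1) - 1) div 8 = 2 * (j * j) + j"
        by (simp add: algebra_simps)
      moreover have e: "int 3 * j + int 4 * (j * (j - 1) div 2) = 2 * (j * j) + j"
      proof -
        have "2 * (j * (j - 1) div 2) = j * j - j" by (simp add: right_diff_distrib)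
        thus ?thesis unfolding of_nat_numeral by linarith
      qed
      ultimately show ?thesis
        using theta_term_powi[of q 1 3 4 j, unfolded e] q by (simp add: h_def)
    qed
    have A: "(h q has_sum (euler_prod (q ^ 2) ^ 2 / euler_prod q)) ?A"
      by (rule has_sum_reindex_bij_witness[of _ "\<lambda>j. 4 * j + 1" "\<lambda>m. m div 4", THEN iffD2, OF _ _ _ _ _ _ theta_psi[OF q]])
         (auto simp: t[symmetric], (presburger | metis mult_div_mod_eq)+)
    have B: "(h q has_sum (euler_prod (q ^ 2) ^ 2 / euler_prod q)) ?B"
      by (rule has_sum_reindex_bij_witness[of _ "\<lambda>m. - m" "\<lambda>m. - m", THEN iffD2, OF _ _ _ _ _ _ A])
         (auto simp: h_def, presburger+)
    have "(h q has_sum (euler_prod (q ^ 2) ^ 2 / euler_prod q + euler_prod (q ^ 2) ^ 2 / euler_prod q)) (?A \<union> ?B)"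
      by (intro has_sum_Un_disjoint A B) auto
    hence "(h q has_sum (euler_prod (q ^ 2) ^ 2 / euler_prod q + euler_prod (q ^ 2) ^ 2 / euler_prod q)) UNIV"
      by (rule has_sum_cong_neutral[THEN iffD1, rotated -1]) (auto simp: h_def, presburger+)
    thus ?thesis by simp
  qed
  define G where "G = (\<lambda>(m, n). h q m * h q n)"
  have q5: "norm (q ^ 5) < 1" "q ^ 5 \<noteq> 0" using assms by (auto intro: norm_power_less_one)
  obtain a b where ab: "(theta_term q (q ^ 5) has_sum a) UNIV" "(theta_term (q ^ 2) (q ^ 5) has_sum b) UNIV"
    "a * b = euler_prod (q ^ 5) ^ 3 * euler_prod (q ^ 2) / (euler_prod q * euler_prod (q ^ 10))"
    using theta_residues_5[OF assms] .
  define c where "c = euler_prod (q ^ 10) ^ 2 / euler_prod (q ^ 5)"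
  have c: "(h (q ^ 5) has_sum (2 * c)) UNIV"
    using h_sum[OF q5] by (simp add: c_def flip: power_mult)
  \<comment> \<open>On the class of 1 the coordinates 1 + 2 x - y and x + 2 y are both odd exactly
    if x is odd and y is even. \<open>k1\<close> and \<open>k2\<close> are the two factors of the
    summand, written with x = 2 i - 1 and y = 2 j.\<close>
  define k1 where "k1 x = (if odd x then theta_term q (q ^ 5) ((x + 1) div 2) else 0)" for x :: int
  define k2 where "k2 y = (if even y then theta_term (q ^ 2) (q ^ 5) (y div 2) else 0)" for y :: int
  have k1_sum: "(k1 has_sum a) UNIV"
  proof -
    have "(k1 has_sum a) {x. odd x}"
      by (rule has_sum_reindex_bij_witness[of _ "\<lambda>j. 2 * j - 1" "\<lambda>m. (m + 1) div 2", THEN iffD2, OF _ _ _ _ _ _ ab(1)])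
         (auto simp: k1_def, presburger)
    thus ?thesis
      by (rule has_sum_cong_neutral[THEN iffD1, rotated -1]) (auto simp: k1_def)
  qed
  have k2_sum: "(k2 has_sum b) UNIV"
  proof -
    have "(k2 has_sum b) {x. even x}"
      by (rule has_sum_reindex_bij_witness[of _ "\<lambda>j. 2 * j" "\<lambda>m. m div 2", THEN iffD2, OF _ _ _ _ _ _ ab(2)])
         (auto simp: k2_def)
    thus ?thesis
      by (rule has_sum_cong_neutral[THEN iffD1, rotated -1]) (auto simp: k2_def)
  qed
  have odd_sq: "\<exists>k. m * m = 8 * k + 1" if "odd m" for m :: int
  proof -
    obtain j where "m = 2 * j + 1" using \<open>odd m\<close> by (rule oddE)
    moreover have "even (j * (j + 1))" by simp
    then obtain i where "j * (j + 1) = 2 * i" by (rule evenE)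
    ultimately have "m * m = 8 * i + 1" by (simp add: algebra_simps)
    thus ?thesis by blast
  qed
  have "(G has_sum (2 * (euler_prod (q ^ 2) ^ 2 / euler_prod q)) * (2 * (euler_prod (q ^ 2) ^ 2 / euler_prod q))) UNIV"
    using has_sum_times_complex[OF h_sum[OF assms] h_sum[OF assms]] by (simp add: G_def)
  moreover have "(G has_sum (q * ((2 * c) * (2 * c)) + 4 * (a * b))) UNIV"
  proof (rule has_sum_gauss_residues)
    show "G (- n, m) = G (m, n)" for m n
      by (auto simp: G_def h_def)
    have "G (2 * x - y, x + 2 * y) = q * (h (q ^ 5) x * h (q ^ 5) y)" for x y
    proof (cases "odd x \<and> odd y")
      case True
      then obtain i j where ij: "x * x = 8 * i + 1" "y * y = 8 * j + 1" using odd_sq by blast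
      have o: "odd (2 * x - y)" "odd (x + 2 * y)" using True by auto
      obtain k l where kl: "(2 * x - y) * (2 * x - y) = 8 * k + 1" "(x + 2 * y) * (x + 2 * y) = 8 * l + 1"
        using odd_sq[OF o(1)] odd_sq[OF o(2)] by blast
      have "(2 * x - y) * (2 * x - y) + (x + 2 * y) * (x + 2 * y) = 5 * (x * x) + 5 * (y * y)" by (simp add: algebra_simps)
      hence "k + l = 1 + 5 * i + 5 * j" using ij kl by simp
      hence "q powi k * q powi l = q * (q powi (5 * i) * q powi (5 * j))"
        using assms by (metis (no_types, lifting) add.assoc power_int_1_right power_int_add)
      thus ?thesis using True o by (simp add: G_def h_def ij kl power_int_mult)
    qed (auto simp: G_def h_def)
    thus "((\<lambda>(x, y). G (2 * x - y, x + 2 * y)) has_sum q * ((2 * c) * (2 * c))) UNIV"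
      using has_sum_cmult_right[OF has_sum_times_complex[OF c c], of q] by (simp add: case_prod_unfold)
    have "G (1 + 2 * x - y, x + 2 * y) = k1 x * k2 y" for x y
    proof (cases "odd x \<and> even y")
      case True
      define i j where "i = (x + 1) div 2" and "j = y div 2"
      have ij: "x = 2 * i - 1" "y = 2 * j" using True by (auto elim!: oddE evenE simp: i_def j_def)
      have o: "odd (1 + 2 * x - y)" "odd (x + 2 * y)" using True by auto
      obtain k l where kl: "(1 + 2 * x - y) * (1 + 2 * x - y) = 8 * k + 1" "(x + 2 * y) * (x + 2 * y) = 8 * l + 1"
        using odd_sq[OF o(1)] odd_sq[OF o(2)] by blast
      have "8 * (k + l) = 4 * (5 * (i * (i - 1)) + 2 * i) + 4 * (5 * (j * (j - 1)) + 4 * j)"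
        using kl by (simp add: ij algebra_simps)
      moreover define I J where "I = i * (i - 1) div 2" and "J = j * (j - 1) div 2"
      have "i * (i - 1) = 2 * I" "j * (j - 1) = 2 * J" by (simp_all add: I_def J_def)
      ultimately have "k + l = (i + 5 * I) + (2 * j + 5 * J)" by simp
      hence "k + l = (i + 5 * (i * (i - 1) div 2)) + (2 * j + 5 * (j * (j - 1) div 2))"
        by (simp only: I_def J_def)
      hence "q powi k * q powi l = q powi (i + 5 * (i * (i - 1) div 2)) * q powi (2 * j + 5 * (j * (j - 1) div 2))"
        using assms by (simp flip: power_int_add)
      moreover have "k1 x = q powi (i + 5 * (i * (i - 1) div 2))"
        using theta_term_powi[of q 1 1 5 i] assms by (simp add: k1_def ij)
      moreover have "k2 y = q powi (2 * j + 5 * (j * (j - 1) div 2))"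
        using theta_term_powi[of q 1 2 5 j] assms by (simp add: k2_def ij)
      ultimately show ?thesis using o by (simp add: G_def h_def kl)
    qed (auto simp: G_def h_def k1_def k2_def)
    thus "((\<lambda>(x, y). G (1 + 2 * x - y, x + 2 * y)) has_sum (a * b)) UNIV"
      using has_sum_times_complex[OF k1_sum k2_sum] by simp
  qed
  ultimately have "(2 * (euler_prod (q ^ 2) ^ 2 / euler_prod q)) * (2 * (euler_prod (q ^ 2) ^ 2 / euler_prod q))
      = q * ((2 * c) * (2 * c)) + 4 * (a * b)"
    by (rule has_sum_unique)
  moreover have "X ^ 2 = q * c ^ 2 + Y" if "2 * X * (2 * X) = q * (2 * c * (2 * c)) + 4 * Y" for X Y
    using that by algebra
  ultimately show ?thesis unfolding ab(3) c_def by blast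
qed

section \<open>Modular equations\<close>

lemma euler_prod_holomorphic [holomorphic_intros]: "euler_prod holomorphic_on ball 0 1"
proof (rule holomorphic_uniform_sequence)
  let ?P = "\<lambda>N q. \<Prod>n<N. 1 - q * q ^ n :: complex"
  fix z :: complex assume z: "z \<in> ball 0 1"
  define r where "r = (1 + norm z) / 2"
  have r: "norm z < r" "r < 1" "0 < r" using z by (auto simp: r_def intro: add_pos_nonneg)
  have sub: "cball z (r - norm z) \<subseteq> cball 0 r"
    by (rule cball_subset_cball_iff[THEN iffD2]) (auto simp: dist_norm)
  have "uniformly_convergent_on (cball 0 r) ?P"
  proof (rule uniformly_convergent_on_prod')
    show "uniformly_convergent_on (cball 0 r) (\<lambda>N q. \<Sum>n<N. norm (1 - q * q ^ n - 1 :: complex))"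
    proof (rule Weierstrass_m_test'_ev)
      show "\<forall>\<^sub>F n in sequentially. \<forall>q\<in>cball 0 r. norm (norm (1 - q * q ^ n - 1 :: complex)) \<le> r ^ Suc n"
        by (intro always_eventually allI ballI) (auto simp: norm_mult norm_power simp flip: power_Suc intro!: power_mono)
      show "summable (\<lambda>n. r ^ Suc n)" using r by (subst summable_Suc_iff) (auto intro: summable_geometric)
    qed
  qed (auto intro!: continuous_intros)
  then obtain g where g: "uniform_limit (cball 0 r) ?P g sequentially"
    by (auto simp: uniformly_convergent_on_def)
  also have "?this \<longleftrightarrow> uniform_limit (cball 0 r) ?P euler_prod sequentially"
  proof (intro uniform_limit_cong)
    fix q :: complex assume q: "q \<in> cball 0 r"
    have "(\<lambda>n. ?P n q) \<longlonglongrightarrow> g q" using g q by (rule tendsto_uniform_limitI)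
    moreover have "(\<lambda>n. ?P n q) \<longlonglongrightarrow> euler_prod q"
      unfolding euler_prod_def using q r by (intro q_poch_inf_LIMSEQ) auto
    ultimately show "g q = euler_prod q" by (rule LIMSEQ_unique)
  qed auto
  finally have "uniform_limit (cball z (r - norm z)) ?P euler_prod sequentially"
    by (rule uniform_limit_on_subset[OF _ sub])
  moreover have "cball z (r - norm z) \<subseteq> ball 0 1" using sub r by force
  ultimately show "\<exists>d>0. cball z d \<subseteq> ball 0 1 \<and> uniform_limit (cball z d) ?P euler_prod sequentially"
    using r by (intro exI[of _ "r - norm z"]) auto
qed (auto intro!: holomorphic_intros)

abbreviation punctured_disc :: "complex set" where
  "punctured_disc \<equiv> ball 0 1 - {0}"

lemma punctured_discD:
  assumes "x \<in> punctured_disc"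
  shows "norm x < 1" "x \<noteq> 0"
  using assms by auto

lemma power_punctured_disc: "x \<in> punctured_disc \<Longrightarrow> n > 0 \<Longrightarrow> x ^ n \<in> punctured_disc"
  using norm_power_less_one by auto

lemma euler_prod_power_holomorphic [holomorphic_intros]:
  "n > 0 \<Longrightarrow> (\<lambda>x. euler_prod (x ^ n)) holomorphic_on punctured_disc"
  by (rule holomorphic_on_compose_gen[OF _ euler_prod_holomorphic, unfolded o_def])
     (auto intro!: holomorphic_intros norm_power_less_one)

lemma euler_prod_power_nonzero: "x \<in> punctured_disc \<Longrightarrow> n > 0 \<Longrightarrow> euler_prod (x ^ n) \<noteq> 0"
  by (rule euler_prod_nonzero) (auto intro: norm_power_less_one)

lemma euler_prod_0: "euler_prod 0 = 1"
  by (simp add: euler_prod_def q_poch_inf_def)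

lemma euler_prod_power_tendsto:
  assumes "n > 0"
  shows "((\<lambda>x. euler_prod (x ^ n)) \<longlongrightarrow> 1) (at 0)"
proof -
  have "isCont euler_prod 0"
    using euler_prod_holomorphic holomorphic_on_imp_continuous_on continuous_on_interior
    by (metis centre_in_ball interior_ball zero_less_one)
  hence "(euler_prod \<longlongrightarrow> 1) (nhds 0)" by (simp add: isCont_def tendsto_nhds_iff euler_prod_0)
  moreover have "((\<lambda>x::complex. x ^ n) \<longlongrightarrow> 0) (at 0)" using assms by (auto intro!: tendsto_eq_intros)
  ultimately show ?thesis by (rule filterlim_compose)
qed

lemma euler_prod_tendsto: "(euler_prod \<longlongrightarrow> 1) (at 0)"
  using euler_prod_power_tendsto[of 1] by simp

lemma eventually_punctured_disc: "eventually (\<lambda>x. x \<in> punctured_disc) (at 0)"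
  unfolding eventually_at by (intro exI[of _ 1]) auto

lemma connected_punctured_disc: "connected punctured_disc"
  by (rule connected_punctured_convex) (auto simp: aff_dim_open)

text \<open>Allows an identity to be checked near 0 only, where leading terms show that a factor to
  be cancelled is nonzero.\<close>

lemma holomorphic_eq_punctured_disc:
  assumes "f holomorphic_on punctured_disc" "g holomorphic_on punctured_disc"
  assumes "eventually (\<lambda>x. f x = g x) (at 0)" "x \<in> punctured_disc"
  shows "f x = g x"
proof -
  obtain d where d: "d > 0" "\<And>x. x \<noteq> 0 \<Longrightarrow> norm x < d \<Longrightarrow> f x = g x"
    using assms(3) by (auto simp: eventually_at dist_norm)
  define e where "e = min d 1"
  have e: "e > 0" "e \<le> d" "e \<le> 1" using d by (auto simp: e_def)
  show ?thesis
  proof (rule analytic_continuation_open[of "ball 0 e - {0}" punctured_disc f g x])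
    have "of_real (e / 2) \<in> ball 0 e - {0::complex}" using e by auto
    thus "ball 0 e - {0::complex} \<noteq> {}" by blast
    show "ball 0 e - {0} \<subseteq> punctured_disc" using e by auto
  qed (use assms d e connected_punctured_disc in auto)
qed

text \<open>The isolated power of q collects the factors q^(1/24) of the eta functions: (3 + 5 - 2 -
  30) / 24 = -1 here, 2 for \<open>u_q\<close> and 1 for \<open>A_q\<close>.\<close>

definition t_q :: "complex \<Rightarrow> complex" where
  "t_q q = euler_prod q ^ 3 * euler_prod (q ^ 5) / (q * euler_prod (q ^ 2) * euler_prod (q ^ 10) ^ 3)"

definition u_q :: "complex \<Rightarrow> complex" where
  "u_q q = q ^ 2 * euler_prod (q ^ 10) ^ 7 / (euler_prod q * euler_prod (q ^ 2) ^ 3 * euler_prod (q ^ 5) ^ 3)"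

definition A_q :: "complex \<Rightarrow> complex" where
  "A_q q = q * euler_prod (q ^ 2) ^ 2 * euler_prod (q ^ 25) ^ 5 / (euler_prod q ^ 5 * euler_prod (q ^ 50) ^ 2)"

text \<open>\<open>phi_identity\<close>, divided by the eta quotient that turns its term with
  coefficient 4 q into the constant 4.\<close>

lemma t_q_plus_4:
  assumes "q \<in> punctured_disc"
  shows "t_q q + 4 = euler_prod (q ^ 2) * euler_prod (q ^ 5) ^ 5 / (q * euler_prod q * euler_prod (q ^ 10) ^ 5)"
proof -
  note q = punctured_discD[OF assms]
  define a b c d where "a = euler_prod q" and "b = euler_prod (q ^ 2)" and "c = euler_prod (q ^ 5)" and "d = euler_prod (q ^ 10)"
  have nz: "a \<noteq> 0" "b \<noteq> 0" "c \<noteq> 0" "d \<noteq> 0"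
    using euler_prod_power_nonzero[OF assms] euler_prod_nonzero[OF q(1)] by (simp_all add: a_def b_def c_def d_def)
  have "(a ^ 2 / b) ^ 2 = (c ^ 2 / d) ^ 2 - 4 * q * (d ^ 3 * a / (b * c))"
    unfolding a_def b_def c_def d_def by (rule phi_identity[OF q])
  hence "a ^ 4 * c * d ^ 2 + 4 * q * d ^ 5 * a * b = c ^ 5 * b ^ 2"
    using nz by (simp add: field_simps) algebra
  hence "a ^ 3 * c / (q * b * d ^ 3) + 4 = b * c ^ 5 / (q * a * d ^ 5)"
    using nz q by (simp add: field_simps) algebra
  thus ?thesis by (simp add: t_q_def a_def b_def c_def d_def)
qed

text \<open>\<open>psi_identity\<close>, normalised in the same way, adds 1 to the product found for
  t + 4.\<close>

lemma t_q_plus_5: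
  assumes "q \<in> punctured_disc"
  shows "t_q q + 5 = euler_prod (q ^ 2) ^ 4 * euler_prod (q ^ 5) ^ 2 / (q * euler_prod q ^ 2 * euler_prod (q ^ 10) ^ 4)"
proof -
  note q = punctured_discD[OF assms]
  define a b c d where "a = euler_prod q" and "b = euler_prod (q ^ 2)" and "c = euler_prod (q ^ 5)" and "d = euler_prod (q ^ 10)"
  have nz: "a \<noteq> 0" "b \<noteq> 0" "c \<noteq> 0" "d \<noteq> 0"
    using euler_prod_power_nonzero[OF assms] euler_prod_nonzero[OF q(1)] by (simp_all add: a_def b_def c_def d_def)
  have "(b ^ 2 / a) ^ 2 = q * (d ^ 2 / c) ^ 2 + c ^ 3 * b / (a * d)"
    unfolding a_def b_def c_def d_def by (rule psi_identity[OF q])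
  hence "b ^ 4 * c ^ 2 * d = q * d ^ 5 * a ^ 2 + c ^ 5 * b * a"
    using nz by (simp add: field_simps) algebra
  hence "b * c ^ 5 / (q * a * d ^ 5) + 1 = b ^ 4 * c ^ 2 / (q * a ^ 2 * d ^ 4)"
    using nz q by (simp add: field_simps) algebra
  hence "t_q q + 4 + 1 = b ^ 4 * c ^ 2 / (q * a ^ 2 * d ^ 4)"
    unfolding t_q_plus_4[OF assms] by (simp add: a_def b_def c_def d_def)
  thus ?thesis by (simp add: a_def b_def c_def d_def add.commute)
qed

lemma t_q_nonzero:
  assumes "q \<in> punctured_disc"
  shows "t_q q \<noteq> 0" "t_q q + 4 \<noteq> 0" "t_q q + 5 \<noteq> 0"
  using euler_prod_power_nonzero[OF assms] euler_prod_nonzero[OF punctured_discD(1)[OF assms]] punctured_discD(2)[OF assms]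
  unfolding t_q_plus_4[OF assms] t_q_plus_5[OF assms] by (simp_all add: t_q_def)

lemma u_q_eq:
  assumes "q \<in> punctured_disc"
  shows "u_q q = 1 / (t_q q * (t_q q + 5))"
  using euler_prod_power_nonzero[OF assms] euler_prod_nonzero[OF punctured_discD(1)[OF assms]] punctured_discD(2)[OF assms]
  unfolding t_q_plus_5[OF assms] by (simp add: t_q_def u_q_def field_simps power_def)

section \<open>The modular equation of degree 5\<close>

definition w_q :: "complex \<Rightarrow> complex" where
  "w_q x = euler_prod (x ^ 2) * euler_prod (x ^ 25) / (x * euler_prod x * euler_prod (x ^ 50))"

text \<open>With x the nome of tau this is eta(tau) / eta(25 tau).\<close>

definition P_q :: "complex \<Rightarrow> complex" where
  "P_q x = euler_prod x / (x * euler_prod (x ^ 25))"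

text \<open>Since t + 4 and t + 5 are products both at tau and at 5 tau, every side is an eta
  quotient and only exponents have to be compared. The last relation is the one that ties
  \<open>A\<close> to \<open>P\<close>.\<close>

lemma level_50_relations:
  assumes x: "x \<in> punctured_disc"
  defines "T \<equiv> t_q (x ^ 5)"
  shows "(t_q x + 4) * (T + 5) = w_q x * T"
    and "P_q x ^ 2 * (T + 4) = w_q x * t_q x * (T + 5)"
    and "w_q x ^ 4 * P_q x ^ 2 = (T + 5) * (t_q x + 5)"
    and "A_q x * t_q x ^ 2 * (T + 5) ^ 2 = (T + 4) ^ 2 * P_q x"
proof -
  have x5: "x ^ 5 \<in> punctured_disc" using power_punctured_disc[OF x] by auto
  define a b c d e f where "a = euler_prod x" and "b = euler_prod (x ^ 2)" and "c = euler_prod (x ^ 5)"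
    and "d = euler_prod (x ^ 10)" and "e = euler_prod (x ^ 25)" and "f = euler_prod (x ^ 50)"
  have nz: "a \<noteq> 0" "b \<noteq> 0" "c \<noteq> 0" "d \<noteq> 0" "e \<noteq> 0" "f \<noteq> 0" "x \<noteq> 0"
    using euler_prod_power_nonzero[OF x] euler_prod_nonzero[OF punctured_discD(1)[OF x]] punctured_discD(2)[OF x]
    by (simp_all add: a_def b_def c_def d_def e_def f_def)
  have T: "T = c ^ 3 * e / (x ^ 5 * d * f ^ 3)" "T + 4 = d * e ^ 5 / (x ^ 5 * c * f ^ 5)" "T + 5 = d ^ 4 * e ^ 2 / (x ^ 5 * c ^ 2 * f ^ 4)"
    unfolding T_def t_q_plus_4[OF x5] t_q_plus_5[OF x5] by (simp_all add: t_q_def c_def d_def e_def f_def flip: power_mult)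
  have t: "t_q x = a ^ 3 * c / (x * b * d ^ 3)" "t_q x + 4 = b * c ^ 5 / (x * a * d ^ 5)" "t_q x + 5 = b ^ 4 * c ^ 2 / (x * a ^ 2 * d ^ 4)"
    unfolding t_q_plus_4[OF x] t_q_plus_5[OF x] by (simp_all add: t_q_def a_def b_def c_def d_def)
  have w: "w_q x = b * e / (x * a * f)" and P: "P_q x = a / (x * e)" and A: "A_q x = x * b ^ 2 * e ^ 5 / (a ^ 5 * f ^ 2)"
    by (simp_all add: w_q_def P_q_def A_q_def a_def b_def e_def f_def)
  show "(t_q x + 4) * (T + 5) = w_q x * T"
    unfolding t(2) T(3) w by (subst T(1)) (use nz in \<open>simp add: divide_simps, simp add: power_def\<close>)
  show "P_q x ^ 2 * (T + 4) = w_q x * t_q x * (T + 5)"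
    unfolding t(1) T(3) w T(2) P using nz by (simp add: divide_simps) (simp add: power_def)?
  show "w_q x ^ 4 * P_q x ^ 2 = (T + 5) * (t_q x + 5)"
    unfolding t(3) T(3) w P using nz by (simp add: divide_simps) (simp add: power_def)?
  show "A_q x * t_q x ^ 2 * (T + 5) ^ 2 = (T + 4) ^ 2 * P_q x"
    unfolding t(1) T(2,3) A P using nz by (simp add: divide_simps) (simp add: power_def)?
qed

text \<open>Eliminating \<open>P_q\<close> from the second and third relation and
  \<open>t_q x\<close> by means of the first leaves an equation of degree 6 in w, which splits off
  the factor w + 1.\<close>

lemma w_q_cleared_equation:
  assumes x: "x \<in> punctured_disc"
  defines "T \<equiv> t_q (x ^ 5)" and "w \<equiv> w_q x"
  shows "(w + 1) * (T * w ^ 5 - (T + 4) * (5 * w ^ 4 - 5 * w ^ 3 + 5 * w ^ 2 - 5 * w + T + 5)) = 0"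
proof -
  note r = level_50_relations[OF x, folded T_def w_def]
  have nz: "T + 5 \<noteq> 0" "T + 4 \<noteq> 0"
    using t_q_nonzero[OF power_punctured_disc[OF x, of 5]] by (auto simp: T_def)
  have "(T + 5) * (w ^ 5 * t_q x) = (T + 5) * ((T + 4) * (t_q x + 5))"
    using r(2,3) by algebra
  hence "w ^ 5 * t_q x = (T + 4) * (t_q x + 5)" using nz by simp
  with r(1) show ?thesis by algebra
qed

lemma w_q_tendsto: "((\<lambda>x. x * w_q x) \<longlongrightarrow> 1) (at 0)"
proof (rule Lim_transform_eventually)
  show "((\<lambda>x. euler_prod (x ^ 2) * euler_prod (x ^ 25) / (euler_prod (x ^ 1) * euler_prod (x ^ 50))) \<longlongrightarrow> 1) (at 0)"
    by (auto intro!: tendsto_eq_intros euler_prod_power_tendsto euler_prod_tendsto)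
  show "eventually (\<lambda>x. euler_prod (x ^ 2) * euler_prod (x ^ 25) / (euler_prod (x ^ 1) * euler_prod (x ^ 50)) = x * w_q x) (at 0)"
    using eventually_punctured_disc by eventually_elim (simp add: w_q_def)
qed

lemma P_q_tendsto: "((\<lambda>x. x * P_q x) \<longlongrightarrow> 1) (at 0)"
proof (rule Lim_transform_eventually)
  show "((\<lambda>x. euler_prod (x ^ 1) / euler_prod (x ^ 25)) \<longlongrightarrow> 1) (at 0)"
    by (auto intro!: tendsto_eq_intros euler_prod_power_tendsto euler_prod_tendsto)
  show "eventually (\<lambda>x. euler_prod (x ^ 1) / euler_prod (x ^ 25) = x * P_q x) (at 0)"
    using eventually_punctured_disc by eventually_elim (simp add: P_q_def)
qed

lemma t_q_power_tendsto: "((\<lambda>x. x ^ 5 * t_q (x ^ 5)) \<longlongrightarrow> 1) (at 0)"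
proof (rule Lim_transform_eventually)
  show "((\<lambda>x. euler_prod (x ^ 5) ^ 3 * euler_prod (x ^ 25) / (euler_prod (x ^ 10) * euler_prod (x ^ 50) ^ 3)) \<longlongrightarrow> 1) (at 0)"
    by (auto intro!: tendsto_eq_intros euler_prod_power_tendsto euler_prod_tendsto)
  show "eventually (\<lambda>x. euler_prod (x ^ 5) ^ 3 * euler_prod (x ^ 25) / (euler_prod (x ^ 10) * euler_prod (x ^ 50) ^ 3)
      = x ^ 5 * t_q (x ^ 5)) (at 0)"
    using eventually_punctured_disc by eventually_elim (simp add: t_q_def flip: power_mult)
qed

lemma w_q_holomorphic: "w_q holomorphic_on punctured_disc"
  and P_q_holomorphic: "P_q holomorphic_on punctured_disc"
  and t_q_power_holomorphic: "(\<lambda>x. t_q (x ^ 5)) holomorphic_on punctured_disc"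
proof -
  have 1: "euler_prod holomorphic_on punctured_disc"
    using euler_prod_holomorphic by (rule holomorphic_on_subset) auto
  show "w_q holomorphic_on punctured_disc" "P_q holomorphic_on punctured_disc"
    unfolding w_q_def[abs_def] P_q_def[abs_def] using euler_prod_power_nonzero[of _ 1] euler_prod_power_nonzero
    by (auto intro!: holomorphic_intros 1)
  have "(\<lambda>x. t_q (x ^ 5)) = (\<lambda>x. euler_prod (x ^ 5) ^ 3 * euler_prod (x ^ 25) / (x ^ 5 * euler_prod (x ^ 10) * euler_prod (x ^ 50) ^ 3))"
    by (simp add: t_q_def flip: power_mult)
  thus "(\<lambda>x. t_q (x ^ 5)) holomorphic_on punctured_disc"
    using euler_prod_power_nonzero by (auto intro!: holomorphic_intros)
qed

lemma w_q_modular_equation: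
  assumes x: "x \<in> punctured_disc"
  defines "T \<equiv> t_q (x ^ 5)" and "w \<equiv> w_q x"
  shows "T * w ^ 5 = (T + 4) * (5 * w ^ 4 - 5 * w ^ 3 + 5 * w ^ 2 - 5 * w + T + 5)"
proof -
  \<comment> \<open>As w behaves like 1 / x, the factor w + 1 is nonzero near 0.\<close>
  have "((\<lambda>x. x * (w_q x + 1)) \<longlongrightarrow> 1) (at 0)"
    unfolding distrib_left by (rule tendsto_eq_intros w_q_tendsto refl | simp)+
  hence "eventually (\<lambda>x. x * (w_q x + 1) \<noteq> 0) (at 0)"
    by (rule tendsto_imp_eventually_ne) auto
  with eventually_punctured_disc have ev: "eventually (\<lambda>x. t_q (x ^ 5) * w_q x ^ 5 =
     (t_q (x ^ 5) + 4) * (5 * w_q x ^ 4 - 5 * w_q x ^ 3 + 5 * w_q x ^ 2 - 5 * w_q x + t_q (x ^ 5) + 5)) (at 0)"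
  proof eventually_elim
    case (elim x)
    thus ?case using w_q_cleared_equation[of x] by simp
  qed
  show ?thesis
    unfolding T_def w_def by (rule holomorphic_eq_punctured_disc[OF _ _ ev x]) (auto intro!: holomorphic_intros w_q_holomorphic t_q_power_holomorphic)
qed

section \<open>Power sums over the five conjugates\<close>

lemma sum_lessThan_5: "(\<Sum>l<5. f l) = f 0 + f 1 + f 2 + f 3 + f (4::nat)"
  for f :: "nat \<Rightarrow> 'a :: comm_monoid_add"
  by (simp add: eval_nat_numeral add_ac)

text \<open>A monic quintic with five known distinct roots is the product of the linear factors, so
  its coefficients are the elementary symmetric functions of the roots; Newton's identities do the
  rest.\<close>

lemma quintic_power_sums:
  fixes r :: "nat \<Rightarrow> complex"
  assumes inj: "inj_on r {..<5}"
    and root: "\<And>l. l < 5 \<Longrightarrow> r l ^ 5 = e1 * r l ^ 4 - e2 * r l ^ 3 + e3 * r l ^ 2 - e4 * r l + e5"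
  shows "(\<Sum>l<5. r l) = e1" "(\<Sum>l<5. r l ^ 2) = e1 ^ 2 - 2 * e2"
    "(\<Sum>l<5. r l ^ 3) = e1 ^ 3 - 3 * e1 * e2 + 3 * e3"
    "(\<Sum>l<5. r l ^ 4) = e1 ^ 4 - 4 * e1 ^ 2 * e2 + 2 * e2 ^ 2 + 4 * e1 * e3 - 4 * e4"
proof -
  define a b c d e where "a = r 0" and "b = r 1" and "c = r 2" and "d = r 3" and "e = r 4"
  let ?p = "[:-a, 1:] * [:-b, 1:] * [:-c, 1:] * [:-d, 1:] * [:-e, 1:]"
  let ?q = "[:-e5, e4, -e3, e2, -e1, 1:]"
  have p: "?p = [:- (a*b*c*d*e), a*b*c*d + a*b*c*e + a*b*d*e + a*c*d*e + b*c*d*e,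
      - (a*b*c + a*b*d + a*b*e + a*c*d + a*c*e + a*d*e + b*c*d + b*c*e + b*d*e + c*d*e),
      a*b + a*c + a*d + a*e + b*c + b*d + b*e + c*d + c*e + d*e, - (a + b + c + d + e), 1:]"
    by (simp add: algebra_simps)
  have "?p = ?q"
  proof (rule poly_eqI_degree_lead_coeff[where n = 5 and A = "r ` {..<5}"])
    show "coeff ?p 5 = coeff ?q 5" unfolding p by (simp add: eval_nat_numeral)
    show "card (r ` {..<5}) \<ge> 5" using inj by (simp add: card_image)
    show "degree ?p \<le> 5" "degree ?q \<le> 5" unfolding p by simp_all
    fix z assume "z \<in> r ` {..<5}"
    then obtain l where l: "l < 5" "z = r l" by auto
    have "poly ?q z = 0" unfolding l(2) using root[OF l(1)] by (simp add: algebra_simps eval_nat_numeral)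
    moreover have "l = 0 \<or> l = 1 \<or> l = 2 \<or> l = 3 \<or> l = 4" using l(1) by auto
    hence "poly ?p z = 0" unfolding l(2) poly_mult by (auto simp: a_def b_def c_def d_def e_def)
    ultimately show "poly ?p z = poly ?q z" by simp
  qed
  hence E: "e1 = a + b + c + d + e"
    "e2 = a*b + a*c + a*d + a*e + b*c + b*d + b*e + c*d + c*e + d*e"
    "e3 = a*b*c + a*b*d + a*b*e + a*c*d + a*c*e + a*d*e + b*c*d + b*c*e + b*d*e + c*d*e"
    "e4 = a*b*c*d + a*b*c*e + a*b*d*e + a*c*d*e + b*c*d*e"
    unfolding p pCons_eq_iff neg_equal_iff_equal by blast+
  show "(\<Sum>l<5. r l) = e1" "(\<Sum>l<5. r l ^ 2) = e1 ^ 2 - 2 * e2"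
    "(\<Sum>l<5. r l ^ 3) = e1 ^ 3 - 3 * e1 * e2 + 3 * e3"
    "(\<Sum>l<5. r l ^ 4) = e1 ^ 4 - 4 * e1 ^ 2 * e2 + 2 * e2 ^ 2 + 4 * e1 * e3 - 4 * e4"
    unfolding sum_lessThan_5 a_def[symmetric] b_def[symmetric] c_def[symmetric] d_def[symmetric] e_def[symmetric] E
    by algebra+
qed

definition zeta5 :: complex where
  "zeta5 = exp (2 * of_real pi * \<i> / 5)"

lemma zeta5_power_5: "zeta5 ^ 5 = 1"
proof -
  have "zeta5 ^ 5 = exp (of_nat 5 * (2 * of_real pi * \<i> / 5))"
    by (simp only: zeta5_def exp_of_nat_mult)
  also have "of_nat 5 * (2 * of_real pi * \<i> / 5) = 2 * complex_of_real pi * \<i>" by simp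
  finally show ?thesis by (simp only: exp_two_pi_i)
qed

lemma norm_zeta5 [simp]: "norm zeta5 = 1"
  by (simp add: zeta5_def norm_exp_eq_Re)

lemma zeta5_nonzero [simp]: "zeta5 \<noteq> 0"
  by (simp add: zeta5_def)

lemma zeta5_inj: "inj_on (\<lambda>l. zeta5 ^ l) {..<5::nat}"
proof (rule inj_onI)
  fix i j :: nat assume ij: "i \<in> {..<5}" "j \<in> {..<5}" "zeta5 ^ i = zeta5 ^ j"
  have "exp (of_nat i * (2 * of_real pi * \<i> / 5)) = exp (of_nat j * (2 * of_real pi * \<i> / 5 :: complex))"
    using ij(3) by (simp only: zeta5_def exp_of_nat_mult)
  then obtain n :: int where "of_nat i * (2 * of_real pi * \<i> / 5) = of_nat j * (2 * of_real pi * \<i> / 5) + of_int (2 * n) * of_real pi * \<i>"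
    unfolding exp_eq by auto
  hence "complex_of_real pi * \<i> * of_int (2 * (int i - int j - 5 * n)) = 0"
    by (simp add: field_simps)
  hence "complex_of_int (2 * (int i - int j - 5 * n)) = 0"
    unfolding mult_eq_0_iff by simp
  hence "2 * (int i - int j - 5 * n) = 0" by (simp only: of_int_eq_0_iff)
  hence "int i - int j = 5 * n" by simp
  thus "i = j" using ij(1,2) by (simp, presburger)
qed

lemma zeta5_mult_punctured_disc: "x \<in> punctured_disc \<Longrightarrow> zeta5 ^ l * x \<in> punctured_disc"
  by (auto simp: norm_mult norm_power)

lemma zeta5_mult_power_5 [simp]: "(zeta5 ^ l * x) ^ 5 = x ^ 5"
proof -
  have "(zeta5 ^ l) ^ 5 = (zeta5 ^ 5) ^ l" by (simp add: mult.commute flip: power_mult)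
  thus ?thesis by (simp add: power_mult_distrib zeta5_power_5)
qed

lemma zeta5_compose_holomorphic:
  assumes "f holomorphic_on punctured_disc"
  shows "(\<lambda>x. f (zeta5 ^ l * x)) holomorphic_on punctured_disc"
  by (rule holomorphic_on_compose_gen[OF _ assms, unfolded o_def])
     (auto intro!: holomorphic_intros simp: norm_mult norm_power)

lemma filterlim_zeta5_mult: "filterlim (\<lambda>x. zeta5 ^ l * x) (at 0) (at 0)"
  by (auto intro!: filterlim_atI tendsto_eq_intros simp: eventually_at_filter)

text \<open>By the simple pole of w, x w(zeta^l x) tends to zeta^(-l), and these five limits are
  distinct.\<close>

lemma w_q_conjugates_inj: "eventually (\<lambda>x. inj_on (\<lambda>l. w_q (zeta5 ^ l * x)) {..<5}) (at 0)"
proof -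
  have lim: "((\<lambda>x. x * w_q (zeta5 ^ l * x)) \<longlongrightarrow> 1 / zeta5 ^ l) (at 0)" for l
  proof -
    have "((\<lambda>x. zeta5 ^ l * x * w_q (zeta5 ^ l * x) / zeta5 ^ l) \<longlongrightarrow> 1 / zeta5 ^ l) (at 0)"
      by (intro tendsto_divide filterlim_compose[OF w_q_tendsto filterlim_zeta5_mult] tendsto_const) auto
    thus ?thesis by simp
  qed
  have ne: "eventually (\<lambda>x. w_q (zeta5 ^ i * x) \<noteq> w_q (zeta5 ^ j * x)) (at 0)" if "i < 5" "j < 5" "i \<noteq> j" for i j
  proof -
    have "((\<lambda>x. x * w_q (zeta5 ^ i * x) - x * w_q (zeta5 ^ j * x)) \<longlongrightarrow> 1 / zeta5 ^ i - 1 / zeta5 ^ j) (at 0)"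
      by (intro tendsto_diff lim)
    moreover have "1 / zeta5 ^ i - 1 / zeta5 ^ j \<noteq> 0"
      using inj_onD[OF zeta5_inj, of i j] that by auto
    ultimately have "eventually (\<lambda>x. x * w_q (zeta5 ^ i * x) - x * w_q (zeta5 ^ j * x) \<noteq> 0) (at 0)"
      by (rule tendsto_imp_eventually_ne)
    thus ?thesis by eventually_elim auto
  qed
  have "eventually (\<lambda>x. \<forall>i\<in>{..<5}. \<forall>j\<in>{..<5}. i \<noteq> j \<longrightarrow> w_q (zeta5 ^ i * x) \<noteq> w_q (zeta5 ^ j * x)) (at 0)"
    by (intro eventually_ball_finite ballI finite_lessThan) (use ne in \<open>auto simp: eventually_mono\<close>)
  thus ?thesis by eventually_elim (auto simp: inj_on_def)
qed

lemma w_q_power_sums: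
  assumes x: "x \<in> punctured_disc"
  defines "T \<equiv> t_q (x ^ 5)" and "w \<equiv> \<lambda>l. w_q (zeta5 ^ l * x)"
  shows "(\<Sum>l<5. w l) = 5 * (T + 4) / T"
    "(\<Sum>l<5. w l ^ 2) = 5 * (3 * T ^ 2 + 32 * T + 80) / T ^ 2"
    "(\<Sum>l<5. w l ^ 3) = 5 * (13 * T ^ 3 + 192 * T ^ 2 + 960 * T + 1600) / T ^ 3"
    "(\<Sum>l<5. w l ^ 4) = 5 * (51 * T ^ 4 + 1024 * T ^ 3 + 7680 * T ^ 2 + 25600 * T + 32000) / T ^ 4"
proof -
  have "eventually (\<lambda>x. let T = t_q (x ^ 5); w = \<lambda>l. w_q (zeta5 ^ l * x) in
    (\<Sum>l<5. w l) = 5 * (T + 4) / T \<and>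
    (\<Sum>l<5. w l ^ 2) = 5 * (3 * T ^ 2 + 32 * T + 80) / T ^ 2 \<and>
    (\<Sum>l<5. w l ^ 3) = 5 * (13 * T ^ 3 + 192 * T ^ 2 + 960 * T + 1600) / T ^ 3 \<and>
    (\<Sum>l<5. w l ^ 4) = 5 * (51 * T ^ 4 + 1024 * T ^ 3 + 7680 * T ^ 2 + 25600 * T + 32000) / T ^ 4) (at 0)"
    using w_q_conjugates_inj eventually_punctured_disc
  proof eventually_elim
    case (elim x)
    define T where "T = t_q (x ^ 5)"
    define w where "w = (\<lambda>l. w_q (zeta5 ^ l * x))"
    \<comment> \<open>In the monic equation the four middle coefficients agree up to sign, so e1 =
      e2 = e3 = e4.\<close>
    define e1 where "e1 = 5 * (T + 4) / T"
    have T: "T \<noteq> 0" unfolding T_def using t_q_nonzero[OF power_punctured_disc[OF elim(2), of 5]] by simp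
    have "w l ^ 5 = e1 * w l ^ 4 - e1 * w l ^ 3 + e1 * w l ^ 2 - e1 * w l + (T + 4) * (T + 5) / T" for l
    proof -
      have "T * w l ^ 5 = (T + 4) * (5 * w l ^ 4 - 5 * w l ^ 3 + 5 * w l ^ 2 - 5 * w l + T + 5)"
        using w_q_modular_equation[OF zeta5_mult_punctured_disc[OF elim(2), of l]] by (simp add: w_def T_def)
      hence "w l ^ 5 = (T + 4) / T * (5 * w l ^ 4 - 5 * w l ^ 3 + 5 * w l ^ 2 - 5 * w l + T + 5)"
        using T by (simp add: nonzero_eq_divide_eq mult.commute)
      moreover have "(T + 4) * (T + 5) / T = (T + 4) / T * (T + 5)" "e1 = 5 * ((T + 4) / T)" by (simp_all add: e1_def)
      ultimately show ?thesis by (simp only:) (simp only: algebra_simps)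
    qed
    from quintic_power_sums[OF elim(1)[folded w_def] this]
    have "(\<Sum>l<5. w l) = e1 \<and> (\<Sum>l<5. w l ^ 2) = e1 ^ 2 - 2 * e1 \<and> (\<Sum>l<5. w l ^ 3) = e1 ^ 3 - 3 * e1 * e1 + 3 * e1 \<and>
      (\<Sum>l<5. w l ^ 4) = e1 ^ 4 - 4 * e1 ^ 2 * e1 + 2 * e1 ^ 2 + 4 * e1 * e1 - 4 * e1" by blast
    moreover have "e1 ^ 2 - 2 * e1 = 5 * (3 * T ^ 2 + 32 * T + 80) / T ^ 2"
      using T unfolding e1_def by (simp add: divide_simps) algebra
    moreover have "e1 ^ 3 - 3 * e1 * e1 + 3 * e1 = 5 * (13 * T ^ 3 + 192 * T ^ 2 + 960 * T + 1600) / T ^ 3"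
      using T unfolding e1_def by (simp add: divide_simps) algebra
    moreover have "e1 ^ 4 - 4 * e1 ^ 2 * e1 + 2 * e1 ^ 2 + 4 * e1 * e1 - 4 * e1 =
        5 * (51 * T ^ 4 + 1024 * T ^ 3 + 7680 * T ^ 2 + 25600 * T + 32000) / T ^ 4"
      using T unfolding e1_def by (simp add: divide_simps) algebra
    ultimately show ?case unfolding Let_def T_def[symmetric] w_def[symmetric] e1_def[symmetric] by simp
  qed
  hence ev: "eventually (\<lambda>x. (\<Sum>l<5. w_q (zeta5 ^ l * x)) = 5 * (t_q (x ^ 5) + 4) / t_q (x ^ 5)) (at 0)"
    "eventually (\<lambda>x. (\<Sum>l<5. w_q (zeta5 ^ l * x) ^ 2) = 5 * (3 * t_q (x ^ 5) ^ 2 + 32 * t_q (x ^ 5) + 80) / t_q (x ^ 5) ^ 2) (at 0)"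
    "eventually (\<lambda>x. (\<Sum>l<5. w_q (zeta5 ^ l * x) ^ 3) = 5 * (13 * t_q (x ^ 5) ^ 3 + 192 * t_q (x ^ 5) ^ 2 + 960 * t_q (x ^ 5) + 1600) / t_q (x ^ 5) ^ 3) (at 0)"
    "eventually (\<lambda>x. (\<Sum>l<5. w_q (zeta5 ^ l * x) ^ 4) = 5 * (51 * t_q (x ^ 5) ^ 4 + 1024 * t_q (x ^ 5) ^ 3 + 7680 * t_q (x ^ 5) ^ 2 + 25600 * t_q (x ^ 5) + 32000) / t_q (x ^ 5) ^ 4) (at 0)"
    by (auto elim!: eventually_mono simp: Let_def)
  note hol = zeta5_compose_holomorphic[OF w_q_holomorphic] t_q_power_holomorphic
  have nz: "t_q (x ^ 5) \<noteq> 0" if "x \<in> punctured_disc" for x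
    using t_q_nonzero[OF power_punctured_disc[OF that, of 5]] by simp
  show "(\<Sum>l<5. w l) = 5 * (T + 4) / T" unfolding T_def w_def
    by (rule holomorphic_eq_punctured_disc[OF _ _ ev(1) x]) (use nz in \<open>auto intro!: holomorphic_intros hol\<close>)
  show "(\<Sum>l<5. w l ^ 2) = 5 * (3 * T ^ 2 + 32 * T + 80) / T ^ 2" unfolding T_def w_def
    by (rule holomorphic_eq_punctured_disc[OF _ _ ev(2) x]) (use nz in \<open>auto intro!: holomorphic_intros hol\<close>)
  show "(\<Sum>l<5. w l ^ 3) = 5 * (13 * T ^ 3 + 192 * T ^ 2 + 960 * T + 1600) / T ^ 3" unfolding T_def w_def
    by (rule holomorphic_eq_punctured_disc[OF _ _ ev(3) x]) (use nz in \<open>auto intro!: holomorphic_intros hol\<close>)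
  show "(\<Sum>l<5. w l ^ 4) = 5 * (51 * T ^ 4 + 1024 * T ^ 3 + 7680 * T ^ 2 + 25600 * T + 32000) / T ^ 4" unfolding T_def w_def
    by (rule holomorphic_eq_punctured_disc[OF _ _ ev(4) x]) (use nz in \<open>auto intro!: holomorphic_intros hol\<close>)
qed

text \<open>
  On the curve given by the modular equation, the right-hand side below is a square root of
  \<open>(T\<^sup>3 + 34 T\<^sup>2 + 220 T + 400)\<^sup>2 w (w T - 4 (T + 5)) / (T + 4)\<close>, which is the square of the left-hand side.
\<close>

lemma P_q_relation:
  assumes x: "x \<in> punctured_disc"
  defines "T \<equiv> t_q (x ^ 5)" and "w \<equiv> w_q x"
  shows "(T ^ 3 + 34 * T ^ 2 + 220 * T + 400) * P_q x =
    - (2 * T ^ 3 + 58 * T ^ 2 + 400 * T + 800) + w * (T ^ 3 + 44 * T ^ 2 + 360 * T + 800)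
    + w ^ 3 * (6 * T ^ 2 + 120 * T + 400) - w ^ 4 * (2 * T ^ 2 + 20 * T)"
proof -
  define D where "D = (\<lambda>T::complex. T ^ 3 + 34 * T ^ 2 + 220 * T + 400)"
  define R where "R = (\<lambda>T w::complex. - (2 * T ^ 3 + 58 * T ^ 2 + 400 * T + 800) + w * (T ^ 3 + 44 * T ^ 2 + 360 * T + 800)
    + w ^ 3 * (6 * T ^ 2 + 120 * T + 400) - w ^ 4 * (2 * T ^ 2 + 20 * T))"
  \<comment> \<open>Choice of the sign. Both \<open>D * P\<close> and \<open>R\<close> have leading
    term x^(-16), so x^16 (D P + R) tends to 2. This excludes \<open>D * P = - R\<close> near
    0.\<close>
  have "((\<lambda>x. ((x ^ 5 * t_q (x ^ 5)) ^ 3 + 34 * x ^ 5 * (x ^ 5 * t_q (x ^ 5)) ^ 2 + 220 * x ^ 10 * (x ^ 5 * t_q (x ^ 5)) + 400 * x ^ 15) * (x * P_q x)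
     + (- (2 * x * (x ^ 5 * t_q (x ^ 5)) ^ 3 + 58 * x ^ 6 * (x ^ 5 * t_q (x ^ 5)) ^ 2 + 400 * x ^ 11 * (x ^ 5 * t_q (x ^ 5)) + 800 * x ^ 16)
        + (x * w_q x) * ((x ^ 5 * t_q (x ^ 5)) ^ 3 + 44 * x ^ 5 * (x ^ 5 * t_q (x ^ 5)) ^ 2 + 360 * x ^ 10 * (x ^ 5 * t_q (x ^ 5)) + 800 * x ^ 15)
        + (x * w_q x) ^ 3 * (6 * x ^ 3 * (x ^ 5 * t_q (x ^ 5)) ^ 2 + 120 * x ^ 8 * (x ^ 5 * t_q (x ^ 5)) + 400 * x ^ 13)
        - (x * w_q x) ^ 4 * (2 * x ^ 2 * (x ^ 5 * t_q (x ^ 5)) ^ 2 + 20 * x ^ 7 * (x ^ 5 * t_q (x ^ 5))))) \<longlongrightarrow> 2) (at 0)"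
    by (rule tendsto_eq_intros w_q_tendsto P_q_tendsto t_q_power_tendsto refl | simp)+
  also have "(\<lambda>x. ((x ^ 5 * t_q (x ^ 5)) ^ 3 + 34 * x ^ 5 * (x ^ 5 * t_q (x ^ 5)) ^ 2 + 220 * x ^ 10 * (x ^ 5 * t_q (x ^ 5)) + 400 * x ^ 15) * (x * P_q x)
     + (- (2 * x * (x ^ 5 * t_q (x ^ 5)) ^ 3 + 58 * x ^ 6 * (x ^ 5 * t_q (x ^ 5)) ^ 2 + 400 * x ^ 11 * (x ^ 5 * t_q (x ^ 5)) + 800 * x ^ 16)
        + (x * w_q x) * ((x ^ 5 * t_q (x ^ 5)) ^ 3 + 44 * x ^ 5 * (x ^ 5 * t_q (x ^ 5)) ^ 2 + 360 * x ^ 10 * (x ^ 5 * t_q (x ^ 5)) + 800 * x ^ 15)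
        + (x * w_q x) ^ 3 * (6 * x ^ 3 * (x ^ 5 * t_q (x ^ 5)) ^ 2 + 120 * x ^ 8 * (x ^ 5 * t_q (x ^ 5)) + 400 * x ^ 13)
        - (x * w_q x) ^ 4 * (2 * x ^ 2 * (x ^ 5 * t_q (x ^ 5)) ^ 2 + 20 * x ^ 7 * (x ^ 5 * t_q (x ^ 5)))))
     = (\<lambda>x. x ^ 16 * (D (t_q (x ^ 5)) * P_q x + R (t_q (x ^ 5)) (w_q x)))"
    unfolding D_def R_def by (rule ext) algebra
  finally have "eventually (\<lambda>x. x ^ 16 * (D (t_q (x ^ 5)) * P_q x + R (t_q (x ^ 5)) (w_q x)) \<noteq> 0) (at 0)"
    by (rule tendsto_imp_eventually_ne) auto
  with eventually_punctured_disc have ev: "eventually (\<lambda>x. D (t_q (x ^ 5)) * P_q x = R (t_q (x ^ 5)) (w_q x)) (at 0)"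
  proof eventually_elim
    case (elim x)
    define T w P where "T = t_q (x ^ 5)" and "w = w_q x" and "P = P_q x"
    note r = level_50_relations[OF elim(1), folded T_def w_def P_def]
    have m: "T * w ^ 5 = (T + 4) * (5 * w ^ 4 - 5 * w ^ 3 + 5 * w ^ 2 - 5 * w + T + 5)"
      using w_q_modular_equation[OF elim(1)] by (simp add: T_def w_def)
    have nz: "T + 4 \<noteq> 0"
      using t_q_nonzero[OF power_punctured_disc[OF elim(1), of 5]] by (auto simp: T_def)
    have P2: "P ^ 2 * (T + 4) = w * (w * T - 4 * (T + 5))"
      using r(1,2) by algebra
    \<comment> \<open>The last factor vanishes by the modular equation; the one before it is the
      quotient of the polynomial division in w.\<close>
    have id: "(T + 4) * R T w ^ 2 - D T ^ 2 * (w * (w * T - 4 * (T + 5))) =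
      (- 4 * T ^ 5 - 212 * T ^ 4 - 3904 * T ^ 3 - 30080 * T ^ 2 - 102400 * T - 128000
       + w * (- 4 * T ^ 4 - 336 * T ^ 3 - 4480 * T ^ 2 - 20800 * T - 32000)
       + w ^ 2 * (- 4 * T ^ 4 - 256 * T ^ 3 - 3760 * T ^ 2 - 19200 * T - 32000)
       + w ^ 3 * (4 * T ^ 4 + 96 * T ^ 3 + 720 * T ^ 2 + 1600 * T))
      * (T * w ^ 5 - (T + 4) * (5 * w ^ 4 - 5 * w ^ 3 + 5 * w ^ 2 - 5 * w + T + 5))"
      unfolding R_def D_def by algebra
    have "(T + 4) * R T w ^ 2 = D T ^ 2 * (P ^ 2 * (T + 4))"
      unfolding P2 using id m by simp
    hence "(T + 4) * ((D T * P - R T w) * (D T * P + R T w)) = 0"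
      by algebra
    thus ?case using nz elim(2) unfolding T_def w_def P_def by simp
  qed
  note hol = w_q_holomorphic P_q_holomorphic t_q_power_holomorphic
  have "D (t_q (x ^ 5)) * P_q x = R (t_q (x ^ 5)) (w_q x)"
    by (rule holomorphic_eq_punctured_disc[OF _ _ ev x]) (auto simp: D_def R_def intro!: holomorphic_intros hol)
  thus ?thesis by (simp add: T_def w_def D_def R_def)
qed

lemma w_q_higher_power_sums:
  assumes x: "x \<in> punctured_disc"
  defines "T \<equiv> t_q (x ^ 5)" and "s \<equiv> \<lambda>n. \<Sum>l<5. w_q (zeta5 ^ l * x) ^ n"
  shows "s 0 = 5" "T * s 1 = 5 * T + 20" "T ^ 2 * s 2 = 15 * T ^ 2 + 160 * T + 400"
    "T ^ 3 * s 3 = 65 * T ^ 3 + 960 * T ^ 2 + 4800 * T + 8000"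
    "T ^ 4 * s 4 = 255 * T ^ 4 + 5120 * T ^ 3 + 38400 * T ^ 2 + 128000 * T + 160000"
    "T * s (n + 5) = (T + 4) * (5 * s (n + 4) - 5 * s (n + 3) + 5 * s (n + 2) - 5 * s (n + 1) + (T + 5) * s n)"
proof -
  have T: "T \<noteq> 0" using t_q_nonzero[OF power_punctured_disc[OF x, of 5]] by (auto simp: T_def)
  note p = w_q_power_sums[OF x, folded T_def]
  show "s 0 = 5" by (simp add: s_def)
  show "T * s 1 = 5 * T + 20" "T ^ 2 * s 2 = 15 * T ^ 2 + 160 * T + 400"
    "T ^ 3 * s 3 = 65 * T ^ 3 + 960 * T ^ 2 + 4800 * T + 8000"
    "T ^ 4 * s 4 = 255 * T ^ 4 + 5120 * T ^ 3 + 38400 * T ^ 2 + 128000 * T + 160000"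
    unfolding s_def power_one_right p using T by simp_all
  have "T * w_q (zeta5 ^ l * x) ^ (n + 5) = (T + 4) * (5 * w_q (zeta5 ^ l * x) ^ (n + 4) - 5 * w_q (zeta5 ^ l * x) ^ (n + 3)
      + 5 * w_q (zeta5 ^ l * x) ^ (n + 2) - 5 * w_q (zeta5 ^ l * x) ^ (n + 1) + (T + 5) * w_q (zeta5 ^ l * x) ^ n)" for l
  proof -
    define w where "w = w_q (zeta5 ^ l * x)"
    have "T * w ^ 5 = (T + 4) * (5 * w ^ 4 - 5 * w ^ 3 + 5 * w ^ 2 - 5 * w + T + 5)"
      using w_q_modular_equation[OF zeta5_mult_punctured_disc[OF x, of l]] by (simp add: w_def T_def)
    hence "w ^ n * (T * w ^ 5) = w ^ n * ((T + 4) * (5 * w ^ 4 - 5 * w ^ 3 + 5 * w ^ 2 - 5 * w + T + 5))" by simp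
    thus ?thesis unfolding w_def[symmetric] power_add by (simp add: algebra_simps)
  qed
  thus "T * s (n + 5) = (T + 4) * (5 * s (n + 4) - 5 * s (n + 3) + 5 * s (n + 2) - 5 * s (n + 1) + (T + 5) * s n)"
    unfolding s_def sum_distrib_left sum_subtractf[symmetric] sum.distrib[symmetric] by simp
qed

text \<open>By \<open>P_q_relation\<close>, \<open>D * P\<close> is a polynomial in w, so
  \<open>D\<close> times each sum is a combination of power sums of w, up to the eighth. The results
  turn out to be multiples of \<open>D\<close>, which is cancelled near 0, where it behaves like
  x^(-15).\<close>

lemma P_q_power_sums:
  assumes x: "x \<in> punctured_disc"
  defines "T \<equiv> t_q (x ^ 5)" and "y \<equiv> \<lambda>l. zeta5 ^ l * x"
  shows "(\<Sum>l<5. P_q (y l)) = - 5" "(\<Sum>l<5. P_q (y l) * w_q (y l)) = - 5" "(\<Sum>l<5. P_q (y l) * w_q (y l) ^ 2) = 5"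
    "(\<Sum>l<5. P_q (y l) * w_q (y l) ^ 3) = 25 * (T + 4) / T"
    "(\<Sum>l<5. P_q (y l) * w_q (y l) ^ 4) = 5 * (T ^ 3 + 29 * T ^ 2 + 200 * T + 400) / T ^ 2"
proof -
  define D where "D = (\<lambda>T::complex. T ^ 3 + 34 * T ^ 2 + 220 * T + 400)"
  have *: "D (t_q (x ^ 5)) * (\<Sum>l<5. P_q (zeta5 ^ l * x)) = D (t_q (x ^ 5)) * (- 5)"
    "D (t_q (x ^ 5)) * (\<Sum>l<5. P_q (zeta5 ^ l * x) * w_q (zeta5 ^ l * x)) = D (t_q (x ^ 5)) * (- 5)"
    "D (t_q (x ^ 5)) * (\<Sum>l<5. P_q (zeta5 ^ l * x) * w_q (zeta5 ^ l * x) ^ 2) = D (t_q (x ^ 5)) * 5"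
    "D (t_q (x ^ 5)) * (\<Sum>l<5. P_q (zeta5 ^ l * x) * w_q (zeta5 ^ l * x) ^ 3) = D (t_q (x ^ 5)) * (25 * (t_q (x ^ 5) + 4) / t_q (x ^ 5))"
    "D (t_q (x ^ 5)) * (\<Sum>l<5. P_q (zeta5 ^ l * x) * w_q (zeta5 ^ l * x) ^ 4) =
       D (t_q (x ^ 5)) * (5 * (t_q (x ^ 5) ^ 3 + 29 * t_q (x ^ 5) ^ 2 + 200 * t_q (x ^ 5) + 400) / t_q (x ^ 5) ^ 2)"
    if x: "x \<in> punctured_disc" for x
  proof -
    define T where "T = t_q (x ^ 5)"
    define s where "s = (\<lambda>n. \<Sum>l<5. w_q (zeta5 ^ l * x) ^ n)"
    have T: "T \<noteq> 0" using t_q_nonzero[OF power_punctured_disc[OF x, of 5]] by (auto simp: T_def)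
    have s: "s 0 = 5" "T * s 1 = 5 * T + 20" "T ^ 2 * s 2 = 15 * T ^ 2 + 160 * T + 400"
      "T ^ 3 * s 3 = 65 * T ^ 3 + 960 * T ^ 2 + 4800 * T + 8000"
      "T ^ 4 * s 4 = 255 * T ^ 4 + 5120 * T ^ 3 + 38400 * T ^ 2 + 128000 * T + 160000"
      and s_rec: "T * s (n + 5) = (T + 4) * (5 * s (n + 4) - 5 * s (n + 3) + 5 * s (n + 2) - 5 * s (n + 1) + (T + 5) * s n)" for n
      unfolding s_def T_def by (rule w_q_higher_power_sums[OF x])+
    \<comment> \<open>T^n s(n) is a polynomial in T, so in this normalisation the recurrence runs
      without denominators.\<close>
    have s_rec': "T ^ (n + 5) * s (n + 5) = (T + 4) * (5 * (T ^ (n + 4) * s (n + 4)) - 5 * T * (T ^ (n + 3) * s (n + 3))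
       + 5 * T ^ 2 * (T ^ (n + 2) * s (n + 2)) - 5 * T ^ 3 * (T ^ (n + 1) * s (n + 1)) + (T + 5) * T ^ 4 * (T ^ n * s n))" for n
    proof -
      have "T ^ (n + 5) * s (n + 5) = T ^ n * T ^ 4 * (T * s (n + 5))" by (simp add: power_add eval_nat_numeral)
      also have "\<dots> = T ^ n * T ^ 4 * ((T + 4) * (5 * s (n + 4) - 5 * s (n + 3) + 5 * s (n + 2) - 5 * s (n + 1) + (T + 5) * s n))"
        by (simp only: s_rec)
      also have "X * T ^ 4 * ((T + 4) * (5 * a - 5 * b + 5 * c - 5 * d + (T + 5) * e)) = (T + 4) * (5 * (X * T ^ 4 * a) - 5 * T * (X * T ^ 3 * b)
         + 5 * T ^ 2 * (X * T ^ 2 * c) - 5 * T ^ 3 * (X * T * d) + (T + 5) * T ^ 4 * (X * e))" for X a b c d e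
        by algebra
      finally show ?thesis by (simp only: power_add power_one_right)
    qed
    have DP: "D T * (\<Sum>l<5. P_q (zeta5 ^ l * x) * w_q (zeta5 ^ l * x) ^ n) =
      - (2 * T ^ 3 + 58 * T ^ 2 + 400 * T + 800) * s n + (T ^ 3 + 44 * T ^ 2 + 360 * T + 800) * s (n + 1)
      + (6 * T ^ 2 + 120 * T + 400) * s (n + 3) - (2 * T ^ 2 + 20 * T) * s (n + 4)" for n
    proof -
      have "D T * (P_q (zeta5 ^ l * x) * w_q (zeta5 ^ l * x) ^ n) =
          - (2 * T ^ 3 + 58 * T ^ 2 + 400 * T + 800) * w_q (zeta5 ^ l * x) ^ n
          + (T ^ 3 + 44 * T ^ 2 + 360 * T + 800) * w_q (zeta5 ^ l * x) ^ (n + 1)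
          + (6 * T ^ 2 + 120 * T + 400) * w_q (zeta5 ^ l * x) ^ (n + 3) - (2 * T ^ 2 + 20 * T) * w_q (zeta5 ^ l * x) ^ (n + 4)" for l
      proof -
        define w where "w = w_q (zeta5 ^ l * x)"
        have "D T * P_q (zeta5 ^ l * x) = - (2 * T ^ 3 + 58 * T ^ 2 + 400 * T + 800) + w * (T ^ 3 + 44 * T ^ 2 + 360 * T + 800)
            + w ^ 3 * (6 * T ^ 2 + 120 * T + 400) - w ^ 4 * (2 * T ^ 2 + 20 * T)"
          using P_q_relation[OF zeta5_mult_punctured_disc[OF x, of l]] by (simp add: w_def T_def D_def)
        hence "D T * P_q (zeta5 ^ l * x) * w ^ n = (- (2 * T ^ 3 + 58 * T ^ 2 + 400 * T + 800) + w * (T ^ 3 + 44 * T ^ 2 + 360 * T + 800)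
            + w ^ 3 * (6 * T ^ 2 + 120 * T + 400) - w ^ 4 * (2 * T ^ 2 + 20 * T)) * w ^ n" by simp
        thus ?thesis unfolding w_def[symmetric] power_add by (simp only: algebra_simps power_one_right)
      qed
      thus ?thesis unfolding s_def sum_distrib_left sum_subtractf[symmetric] sum.distrib[symmetric] by simp
    qed
    have s_rec'': "T ^ m5 * s m5 = (T + 4) * (5 * (T ^ m4 * s m4) - 5 * T * (T ^ m3 * s m3)
       + 5 * T ^ 2 * (T ^ m2 * s m2) - 5 * T ^ 3 * (T ^ m1 * s m1) + (T + 5) * T ^ 4 * (T ^ n * s n))"
      if "m5 = n + 5" "m4 = n + 4" "m3 = n + 3" "m2 = n + 2" "m1 = n + 1" for n m1 m2 m3 m4 m5
      unfolding that by (rule s_rec')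
    have r0: "T ^ 5 * s 5 = (T + 4) * (5 * (T ^ 4 * s 4) - 5 * T * (T ^ 3 * s 3) + 5 * T ^ 2 * (T ^ 2 * s 2) - 5 * T ^ 3 * (T * s 1) + (T + 5) * T ^ 4 * (s 0))"
      using s_rec'[of 0] by (simp only: add_0 power_0 mult_1_left power_one_right)
    have r1: "T ^ 6 * s 6 = (T + 4) * (5 * (T ^ 5 * s 5) - 5 * T * (T ^ 4 * s 4) + 5 * T ^ 2 * (T ^ 3 * s 3) - 5 * T ^ 3 * (T ^ 2 * s 2) + (T + 5) * T ^ 4 * (T ^ 1 * s 1))"
      by (rule s_rec'') simp_all
    have r2: "T ^ 7 * s 7 = (T + 4) * (5 * (T ^ 6 * s 6) - 5 * T * (T ^ 5 * s 5) + 5 * T ^ 2 * (T ^ 4 * s 4) - 5 * T ^ 3 * (T ^ 3 * s 3) + (T + 5) * T ^ 4 * (T ^ 2 * s 2))"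
      by (rule s_rec'') simp_all
    have r3: "T ^ 8 * s 8 = (T + 4) * (5 * (T ^ 7 * s 7) - 5 * T * (T ^ 6 * s 6) + 5 * T ^ 2 * (T ^ 5 * s 5) - 5 * T ^ 3 * (T ^ 4 * s 4) + (T + 5) * T ^ 4 * (T ^ 3 * s 3))"
      by (rule s_rec'') simp_all
    have s5: "T ^ 5 * s 5 = 5 * T ^ 6 + 1045 * T ^ 5 + 25600 * T ^ 4 + 256000 * T ^ 3 + 1280000 * T ^ 2 + 3200000 * T + 3200000"
      unfolding r0 s by algebra
    have s6: "T ^ 6 * s 6 = 30 * T ^ 7 + 4365 * T ^ 6 + 123480 * T ^ 5 + 1536000 * T ^ 4 + 10240000 * T ^ 3 + 38400000 * T ^ 2 + 76800000 * T + 64000000"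
      unfolding r1 power_one_right s s5 by algebra
    have s7: "T ^ 7 * s 7 = 140 * T ^ 8 + 18345 * T ^ 7 + 582540 * T ^ 6 + 8615600 * T ^ 5 + 71680000 * T ^ 4 + 358400000 * T ^ 3
        + 1075200000 * T ^ 2 + 1792000000 * T + 1280000000"
      unfolding r2 s s5 s6 by algebra
    have s8: "T ^ 8 * s 8 = 640 * T ^ 9 + 77695 * T ^ 8 + 2707840 * T ^ 7 + 46147200 * T ^ 6 + 459072000 * T ^ 5 + 2867200000 * T ^ 4
        + 11468800000 * T ^ 3 + 28672000000 * T ^ 2 + 40960000000 * T + 25600000000"
      unfolding r3 s s5 s6 s7 by algebra
    have DP': "T ^ m4 * (D T * (\<Sum>l<5. P_q (zeta5 ^ l * x) * w_q (zeta5 ^ l * x) ^ n)) =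
      - (2 * T ^ 3 + 58 * T ^ 2 + 400 * T + 800) * T ^ 4 * (T ^ n * s n) + (T ^ 3 + 44 * T ^ 2 + 360 * T + 800) * T ^ 3 * (T ^ m1 * s m1)
      + (6 * T ^ 2 + 120 * T + 400) * T * (T ^ m3 * s m3) - (2 * T ^ 2 + 20 * T) * (T ^ m4 * s m4)"
      if "m1 = n + 1" "m3 = n + 3" "m4 = n + 4" for n m1 m3 m4
    proof -
      have "X * T ^ 4 * (- a * s0 + b * s1 + c * s3 - d * s4) = - a * T ^ 4 * (X * s0) + b * T ^ 3 * (X * T * s1) + c * T * (X * T ^ 3 * s3)
          - d * (X * T ^ 4 * s4)" for X a b c d s0 s1 s3 s4
        by algebra
      thus ?thesis unfolding that DP by (simp only: power_add power_one_right)
    qed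
    have d0: "T ^ 4 * (D T * (\<Sum>l<5. P_q (zeta5 ^ l * x) * w_q (zeta5 ^ l * x) ^ 0)) =
      - (2 * T ^ 3 + 58 * T ^ 2 + 400 * T + 800) * T ^ 4 * (T ^ 0 * s 0) + (T ^ 3 + 44 * T ^ 2 + 360 * T + 800) * T ^ 3 * (T ^ 1 * s 1)
      + (6 * T ^ 2 + 120 * T + 400) * T * (T ^ 3 * s 3) - (2 * T ^ 2 + 20 * T) * (T ^ 4 * s 4)"
      by (rule DP') simp_all
    have d1: "T ^ 5 * (D T * (\<Sum>l<5. P_q (zeta5 ^ l * x) * w_q (zeta5 ^ l * x) ^ 1)) =
      - (2 * T ^ 3 + 58 * T ^ 2 + 400 * T + 800) * T ^ 4 * (T ^ 1 * s 1) + (T ^ 3 + 44 * T ^ 2 + 360 * T + 800) * T ^ 3 * (T ^ 2 * s 2)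
      + (6 * T ^ 2 + 120 * T + 400) * T * (T ^ 4 * s 4) - (2 * T ^ 2 + 20 * T) * (T ^ 5 * s 5)"
      by (rule DP') simp_all
    have d2: "T ^ 6 * (D T * (\<Sum>l<5. P_q (zeta5 ^ l * x) * w_q (zeta5 ^ l * x) ^ 2)) =
      - (2 * T ^ 3 + 58 * T ^ 2 + 400 * T + 800) * T ^ 4 * (T ^ 2 * s 2) + (T ^ 3 + 44 * T ^ 2 + 360 * T + 800) * T ^ 3 * (T ^ 3 * s 3)
      + (6 * T ^ 2 + 120 * T + 400) * T * (T ^ 5 * s 5) - (2 * T ^ 2 + 20 * T) * (T ^ 6 * s 6)"
      by (rule DP') simp_all
    have d3: "T ^ 7 * (D T * (\<Sum>l<5. P_q (zeta5 ^ l * x) * w_q (zeta5 ^ l * x) ^ 3)) =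
      - (2 * T ^ 3 + 58 * T ^ 2 + 400 * T + 800) * T ^ 4 * (T ^ 3 * s 3) + (T ^ 3 + 44 * T ^ 2 + 360 * T + 800) * T ^ 3 * (T ^ 4 * s 4)
      + (6 * T ^ 2 + 120 * T + 400) * T * (T ^ 6 * s 6) - (2 * T ^ 2 + 20 * T) * (T ^ 7 * s 7)"
      by (rule DP') simp_all
    have d4: "T ^ 8 * (D T * (\<Sum>l<5. P_q (zeta5 ^ l * x) * w_q (zeta5 ^ l * x) ^ 4)) =
      - (2 * T ^ 3 + 58 * T ^ 2 + 400 * T + 800) * T ^ 4 * (T ^ 4 * s 4) + (T ^ 3 + 44 * T ^ 2 + 360 * T + 800) * T ^ 3 * (T ^ 5 * s 5)
      + (6 * T ^ 2 + 120 * T + 400) * T * (T ^ 7 * s 7) - (2 * T ^ 2 + 20 * T) * (T ^ 8 * s 8)"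
      by (rule DP') simp_all
    have cancel: "a = b" if "T ^ k * a = T ^ k * b" for a b k
      using that T by simp
    have "T ^ 4 * (D T * (\<Sum>l<5. P_q (zeta5 ^ l * x) * w_q (zeta5 ^ l * x) ^ 0)) = T ^ 4 * (D T * (- 5))"
      unfolding d0 unfolding power_0 power_one_right mult_1_left s  unfolding D_def by algebra
    hence "D T * (\<Sum>l<5. P_q (zeta5 ^ l * x) * w_q (zeta5 ^ l * x) ^ 0) = D T * (- 5)" by (rule cancel)
    thus "D (t_q (x ^ 5)) * (\<Sum>l<5. P_q (zeta5 ^ l * x)) = D (t_q (x ^ 5)) * (- 5)" by (simp add: T_def)
    have "T ^ 5 * (D T * (\<Sum>l<5. P_q (zeta5 ^ l * x) * w_q (zeta5 ^ l * x) ^ 1)) = T ^ 5 * (D T * (- 5))"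
      unfolding d1 unfolding power_0 power_one_right mult_1_left s s5 unfolding D_def by algebra
    hence "D T * (\<Sum>l<5. P_q (zeta5 ^ l * x) * w_q (zeta5 ^ l * x) ^ 1) = D T * (- 5)" by (rule cancel)
    thus "D (t_q (x ^ 5)) * (\<Sum>l<5. P_q (zeta5 ^ l * x) * w_q (zeta5 ^ l * x)) = D (t_q (x ^ 5)) * (- 5)" by (simp add: T_def)
    have "T ^ 6 * (D T * (\<Sum>l<5. P_q (zeta5 ^ l * x) * w_q (zeta5 ^ l * x) ^ 2)) = T ^ 6 * (D T * 5)"
      unfolding d2 unfolding power_0 power_one_right mult_1_left s s5 s6 unfolding D_def by algebra
    thus "D (t_q (x ^ 5)) * (\<Sum>l<5. P_q (zeta5 ^ l * x) * w_q (zeta5 ^ l * x) ^ 2) = D (t_q (x ^ 5)) * 5"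
      unfolding T_def[symmetric] by (rule cancel)
    have "T ^ 7 * (D T * (\<Sum>l<5. P_q (zeta5 ^ l * x) * w_q (zeta5 ^ l * x) ^ 3)) = T ^ 6 * (D T * (25 * (T + 4)))"
      unfolding d3 unfolding power_0 power_one_right mult_1_left s s5 s6 s7 unfolding D_def by algebra
    also have "\<dots> = T ^ 7 * (D T * (25 * (T + 4) / T))" using T by (simp add: eval_nat_numeral)
    finally show "D (t_q (x ^ 5)) * (\<Sum>l<5. P_q (zeta5 ^ l * x) * w_q (zeta5 ^ l * x) ^ 3) = D (t_q (x ^ 5)) * (25 * (t_q (x ^ 5) + 4) / t_q (x ^ 5))"
      unfolding T_def[symmetric] by (rule cancel)
    have "T ^ 8 * (D T * (\<Sum>l<5. P_q (zeta5 ^ l * x) * w_q (zeta5 ^ l * x) ^ 4)) = T ^ 6 * (D T * (5 * (T ^ 3 + 29 * T ^ 2 + 200 * T + 400)))"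
      unfolding d4 unfolding power_0 power_one_right mult_1_left s s5 s6 s7 s8 unfolding D_def by algebra
    also have "\<dots> = T ^ 8 * (D T * (5 * (T ^ 3 + 29 * T ^ 2 + 200 * T + 400) / T ^ 2))" using T by (simp add: eval_nat_numeral)
    finally show "D (t_q (x ^ 5)) * (\<Sum>l<5. P_q (zeta5 ^ l * x) * w_q (zeta5 ^ l * x) ^ 4) =
       D (t_q (x ^ 5)) * (5 * (t_q (x ^ 5) ^ 3 + 29 * t_q (x ^ 5) ^ 2 + 200 * t_q (x ^ 5) + 400) / t_q (x ^ 5) ^ 2)"
      unfolding T_def[symmetric] by (rule cancel)
  qed
  have "((\<lambda>x. (x ^ 5 * t_q (x ^ 5)) ^ 3 + 34 * x ^ 5 * (x ^ 5 * t_q (x ^ 5)) ^ 2 + 220 * x ^ 10 * (x ^ 5 * t_q (x ^ 5)) + 400 * x ^ 15) \<longlongrightarrow> 1) (at 0)"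
    by (rule tendsto_eq_intros t_q_power_tendsto refl | simp)+
  also have "(\<lambda>x. (x ^ 5 * t_q (x ^ 5)) ^ 3 + 34 * x ^ 5 * (x ^ 5 * t_q (x ^ 5)) ^ 2 + 220 * x ^ 10 * (x ^ 5 * t_q (x ^ 5)) + 400 * x ^ 15)
     = (\<lambda>x. x ^ 15 * D (t_q (x ^ 5)))"
    unfolding D_def by (rule ext) algebra
  finally have ev: "eventually (\<lambda>x. x ^ 15 * D (t_q (x ^ 5)) \<noteq> 0) (at 0)"
    by (rule tendsto_imp_eventually_ne) auto
  note hol = zeta5_compose_holomorphic[OF w_q_holomorphic] zeta5_compose_holomorphic[OF P_q_holomorphic] t_q_power_holomorphic
  have nz: "t_q (x ^ 5) \<noteq> 0" if "x \<in> punctured_disc" for x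
    using t_q_nonzero[OF power_punctured_disc[OF that, of 5]] by simp
  have ev_eq: "eventually (\<lambda>x. f x = g x) (at 0)" if "\<And>x. x \<in> punctured_disc \<Longrightarrow> D (t_q (x ^ 5)) * f x = D (t_q (x ^ 5)) * g x" for f g
    using ev eventually_punctured_disc by eventually_elim (use that in force)
  show "(\<Sum>l<5. P_q (y l)) = - 5" unfolding y_def
    by (rule holomorphic_eq_punctured_disc[OF _ _ ev_eq[OF *(1)] x]) (auto intro!: holomorphic_intros hol)
  show "(\<Sum>l<5. P_q (y l) * w_q (y l)) = - 5" unfolding y_def
    by (rule holomorphic_eq_punctured_disc[OF _ _ ev_eq[OF *(2)] x]) (auto intro!: holomorphic_intros hol)
  show "(\<Sum>l<5. P_q (y l) * w_q (y l) ^ 2) = 5" unfolding y_def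
    by (rule holomorphic_eq_punctured_disc[OF _ _ ev_eq[OF *(3)] x]) (auto intro!: holomorphic_intros hol)
  show "(\<Sum>l<5. P_q (y l) * w_q (y l) ^ 3) = 25 * (T + 4) / T" unfolding y_def T_def
    by (rule holomorphic_eq_punctured_disc[OF _ _ ev_eq[OF *(4)] x]) (use nz in \<open>auto intro!: holomorphic_intros hol\<close>)
  show "(\<Sum>l<5. P_q (y l) * w_q (y l) ^ 4) = 5 * (T ^ 3 + 29 * T ^ 2 + 200 * T + 400) / T ^ 2" unfolding y_def T_def
    by (rule holomorphic_eq_punctured_disc[OF _ _ ev_eq[OF *(5)] x]) (use nz in \<open>auto intro!: holomorphic_intros hol\<close>)
qed

section \<open>Polynomials in \<open>u\<close> and \<open>t\<close>\<close>

definition eval_int :: "int poly \<Rightarrow> complex \<Rightarrow> complex" where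
  "eval_int p u = poly (map_poly of_int p) u"

lemma eval_int_0 [simp]: "eval_int 0 u = 0"
  by (simp add: eval_int_def)

lemma eval_int_pCons [simp]: "eval_int (pCons a p) u = of_int a + u * eval_int p u"
  by (simp add: eval_int_def map_poly_pCons)

lemma eval_int_add [simp]: "eval_int (p + q) u = eval_int p u + eval_int q u"
proof -
  have "map_poly complex_of_int (p + q) = map_poly of_int p + map_poly of_int q"
    by (rule poly_eqI) (simp add: coeff_map_poly)
  thus ?thesis by (simp add: eval_int_def)
qed

lemma eval_int_smult [simp]: "eval_int (smult c p) u = of_int c * eval_int p u"
proof -
  have "map_poly complex_of_int (smult c p) = smult (of_int c) (map_poly of_int p)"
    by (rule poly_eqI) (simp add: coeff_map_poly)
  thus ?thesis by (simp add: eval_int_def)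
qed

lemma eval_int_diff [simp]: "eval_int (p - q) u = eval_int p u - eval_int q u"
proof -
  have "map_poly complex_of_int (p - q) = map_poly of_int p - map_poly of_int q"
    by (rule poly_eqI) (simp add: coeff_map_poly)
  thus ?thesis by (simp add: eval_int_def)
qed

lemma eval_int_mult [simp]: "eval_int (p * q) u = eval_int p u * eval_int q u"
  by (induction p) (simp_all add: algebra_simps)

text \<open>The pair \<open>(p, q)\<close> represents \<open>p(u) + q(u) t\<close>, where \<open>u t\<^sup>2 = 1 - 5 u t\<close>.\<close>

type_synonym ut_poly = "int poly \<times> int poly"

definition eval_ut :: "complex \<Rightarrow> complex \<Rightarrow> ut_poly \<Rightarrow> complex" where
  "eval_ut u t P = eval_int (fst P) u + eval_int (snd P) u * t"

lemma eval_ut_add [simp]: "eval_ut u t (P + Q) = eval_ut u t P + eval_ut u t Q"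
  by (simp add: eval_ut_def algebra_simps)

definition ut_scale :: "int \<Rightarrow> ut_poly \<Rightarrow> ut_poly" where
  "ut_scale c P = (smult c (fst P), smult c (snd P))"

lemma eval_ut_scale [simp]: "eval_ut u t (ut_scale c P) = of_int c * eval_ut u t P"
  by (simp add: eval_ut_def ut_scale_def algebra_simps)

text \<open>Multiplication by \<open>s(u) + u s'(u) t\<close> for \<open>S = (s, s')\<close>; the factor \<open>u\<close> makes room for \<open>u t\<^sup>2 = 1 - 5 u t\<close>.\<close>

definition ut_mult :: "int poly \<times> int poly \<Rightarrow> ut_poly \<Rightarrow> ut_poly" where
  "ut_mult S P = (fst S * fst P + snd S * snd P,
                  fst S * snd P + pCons 0 (snd S * (fst P - smult 5 (snd P))))"

definition eval_mult :: "complex \<Rightarrow> complex \<Rightarrow> int poly \<times> int poly \<Rightarrow> complex" where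
  "eval_mult u t S = eval_int (fst S) u + u * t * eval_int (snd S) u"

lemma eval_ut_mult:
  assumes "u * t ^ 2 = 1 - 5 * u * t"
  shows "eval_ut u t (ut_mult S P) = eval_mult u t S * eval_ut u t P"
proof -
  have "s * p + s' * q + (s * q + u * (s' * (p - 5 * q))) * t = (s + u * t * s') * (p + q * t)" for s s' p q
    using assms by algebra
  thus ?thesis
    unfolding eval_ut_def ut_mult_def eval_mult_def by simp
qed

text \<open>The five sigmas normalise the equation of 1 / u(tau), over polynomials in u and u t at 5
  tau, to the shape sum of sigma_k u^(-k) = 1. The powers of 5 in their coefficients are what the
  later divisibility bounds rest on.\<close>

definition sigma1 :: "int poly \<times> int poly" where
  "sigma1 = ([:0, 1125, 114625, 3137500, 31015625, 100000000:], [:30, 10625, 435000, 5359375, 19921875:])"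

definition sigma2 :: "int poly \<times> int poly" where
  "sigma2 = ([:0, 635, 96500, 2925000, 30250000, 100000000:], [:5, 8825, 406875, 5250000, 20000000:])"

definition sigma3 :: "int poly \<times> int poly" where
  "sigma3 = ([:0, 160, 31125, 1025625, 11062500, 37500000:], [:0, 2700, 140625, 1912500, 7500000:])"

definition sigma4 :: "int poly \<times> int poly" where
  "sigma4 = ([:0, 20, 4525, 160000, 1796875, 6250000:], [:0, 375, 21625, 309375, 1250000:])"

definition sigma5 :: "int poly \<times> int poly" where
  "sigma5 = ([:0, 1, 250, 9375, 109375, 390625:], [:0, 20, 1250, 18750, 78125:])"

text \<open>Everything is rational in z = 1 / (T + 5): T = (1 - 5 z) / z and u = z^2 / (1 - 5 z).
  After multiplication by a power of 1 - 5 z, identities in u and u t become polynomial identities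
  in z alone.\<close>

lemma level_10_ring:
  fixes x :: complex
  assumes x: "x \<in> punctured_disc"
  defines "T \<equiv> t_q x" and "u \<equiv> u_q x" and "z \<equiv> u_q x * t_q x"
  shows "z * (T + 5) = 1" "u * (1 - 5 * z) = z ^ 2" "z ^ 2 = u - 5 * u * z" "T * z = 1 - 5 * z" "1 - 5 * z \<noteq> 0" "z \<noteq> 0"
    "u * T ^ 2 = 1 - 5 * u * T"
proof -
  have nz: "T \<noteq> 0" "T + 5 \<noteq> 0" using t_q_nonzero[OF x] by (simp_all add: T_def)
  have u: "u = 1 / (T * (T + 5))" using u_q_eq[OF x] by (simp add: T_def u_def)
  have z: "z = 1 / (T + 5)" unfolding z_def u_def[symmetric] T_def[symmetric] u using nz by simp
  show 1: "z * (T + 5) = 1" using nz by (simp add: z)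
  have d: "1 - 5 * z = T / (T + 5)" using nz by (simp add: z field_simps)
  show "1 - 5 * z \<noteq> 0" "z \<noteq> 0" unfolding d z using nz by simp_all
  show 2: "u * (1 - 5 * z) = z ^ 2"
  proof -
    have "u * (1 - 5 * z) = 1 / (T * (T + 5)) * (T / (T + 5))" by (simp only: d u)
    thus ?thesis using nz by (simp add: z power2_eq_square)
  qed
  thus "z ^ 2 = u - 5 * u * z" by (simp add: algebra_simps)
  show "T * z = 1 - 5 * z" using 1 by (simp add: algebra_simps)
  have "u * T = z" by (simp add: z_def u_def T_def)
  with 1 show "u * T ^ 2 = 1 - 5 * u * T" by algebra
qed

text \<open>Here d = T / (T + 5), so the first relation of level 50 reads t + 4 = d w. The equation
  of w, multiplied by z^2 d^4, turns into one for W with coefficients polynomial in z.\<close>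

lemma W_modular_equation:
  assumes x: "x \<in> punctured_disc"
  defines "z \<equiv> u_q (x ^ 5) * t_q (x ^ 5)" and "W \<equiv> t_q x + 4"
  defines "d \<equiv> 1 - 5 * z"
  shows "W = d * w_q x"
    and "z * W ^ 5 = 5 * z * (1 - z) * (W ^ 4 - d * W ^ 3 + d ^ 2 * W ^ 2 - d ^ 3 * W) + (1 - z) * d ^ 4"
proof -
  have x5: "x ^ 5 \<in> punctured_disc" using power_punctured_disc[OF x] by auto
  define T w where "T = t_q (x ^ 5)" and "w = w_q x"
  note r = level_10_ring[OF x5, folded z_def T_def, folded d_def]
  have "W * (T + 5) = w * T" using level_50_relations(1)[OF x] by (simp add: W_def w_def T_def)
  hence "W * (z * (T + 5)) = w * (T * z)" by algebra
  thus W: "W = d * w_q x" unfolding r(1,4) w_def by (simp add: mult.commute)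
  have m: "T * w ^ 5 = (T + 4) * (5 * w ^ 4 - 5 * w ^ 3 + 5 * w ^ 2 - 5 * w + T + 5)"
    using w_q_modular_equation[OF x] by (simp add: T_def w_def)
  have "z * (z * (T * w ^ 5)) = (z * (T + 5) - z) * (z * (5 * w ^ 4 - 5 * w ^ 3 + 5 * w ^ 2 - 5 * w) + z * (T + 5))"
    unfolding m by algebra
  hence "z * d * w ^ 5 = (1 - z) * (z * (5 * w ^ 4 - 5 * w ^ 3 + 5 * w ^ 2 - 5 * w) + 1)"
    unfolding r(1) using r(4) by algebra
  hence "d ^ 4 * (z * d * w ^ 5) = d ^ 4 * ((1 - z) * (z * (5 * w ^ 4 - 5 * w ^ 3 + 5 * w ^ 2 - 5 * w) + 1))" by simp
  thus "z * W ^ 5 = 5 * z * (1 - z) * (W ^ 4 - d * W ^ 3 + d ^ 2 * W ^ 2 - d ^ 3 * W) + (1 - z) * d ^ 4"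
    unfolding W w_def[symmetric] by algebra
qed

text \<open>
  If \<open>M(W) = 0\<close> is the equation of \<open>W = t + 4\<close>, then \<open>M(W) M(3 - W)\<close> is a polynomial in
  \<open>(W - 4) (W + 1) = t (t + 5) = 1 / u\<close>, whose coefficients are, up to a common factor, the \<open>\<sigma>\<close>s.
\<close>

lemma u_modular_equation:
  assumes x: "x \<in> punctured_disc"
  defines "u \<equiv> u_q (x ^ 5)" and "t \<equiv> t_q (x ^ 5)" and "y \<equiv> 1 / u_q x"
  shows "y = t_q x * (t_q x + 5)"
    "eval_mult u t sigma1 * y + eval_mult u t sigma2 * y ^ 2 + eval_mult u t sigma3 * y ^ 3
     + eval_mult u t sigma4 * y ^ 4 + eval_mult u t sigma5 * y ^ 5 = 1"
proof -
  have x5: "x ^ 5 \<in> punctured_disc" using power_punctured_disc[OF x] by auto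
  define z where "z = u * t"
  define W where "W = t_q x + 4"
  define d where "d = 1 - 5 * z"
  show y: "y = t_q x * (t_q x + 5)" unfolding y_def using t_q_nonzero[OF x] u_q_eq[OF x] by simp
  have yW: "y = (W - 4) * (W + 1)" unfolding y by (simp add: W_def)
  have ud: "u * d = z ^ 2" and d0: "d \<noteq> 0"
    using level_10_ring[OF x5] by (simp_all add: z_def u_def t_def d_def)
  have h: "d ^ 5 * u = z ^ 2 * d ^ 4" "d ^ 5 * u ^ 2 = z ^ 4 * d ^ 3" "d ^ 5 * u ^ 3 = z ^ 6 * d ^ 2"
     "d ^ 5 * u ^ 4 = z ^ 8 * d" "d ^ 5 * u ^ 5 = z ^ 10"
    using ud by algebra+
  have M: "z * W ^ 5 = 5 * z * (1 - z) * (W ^ 4 - d * W ^ 3 + d ^ 2 * W ^ 2 - d ^ 3 * W) + (1 - z) * d ^ 4"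
    using W_modular_equation(2)[OF x] by (simp add: W_def d_def z_def u_def t_def)
  have s1: "d ^ 5 * eval_mult u t sigma1 = 1125 * (d ^ 5 * u) + 114625 * (d ^ 5 * u ^ 2) + 3137500 * (d ^ 5 * u ^ 3) + 31015625 * (d ^ 5 * u ^ 4) + 100000000 * (d ^ 5 * u ^ 5) + z * (30 * (d ^ 5) + 10625 * (d ^ 5 * u) + 435000 * (d ^ 5 * u ^ 2) + 5359375 * (d ^ 5 * u ^ 3) + 19921875 * (d ^ 5 * u ^ 4))"
    unfolding eval_mult_def sigma1_def z_def by (simp add: algebra_simps power_def)
  have s2: "d ^ 5 * eval_mult u t sigma2 = 635 * (d ^ 5 * u) + 96500 * (d ^ 5 * u ^ 2) + 2925000 * (d ^ 5 * u ^ 3) + 30250000 * (d ^ 5 * u ^ 4) + 100000000 * (d ^ 5 * u ^ 5) + z * (5 * (d ^ 5) + 8825 * (d ^ 5 * u) + 406875 * (d ^ 5 * u ^ 2) + 5250000 * (d ^ 5 * u ^ 3) + 20000000 * (d ^ 5 * u ^ 4))"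
    unfolding eval_mult_def sigma2_def z_def by (simp add: algebra_simps power_def)
  have s3: "d ^ 5 * eval_mult u t sigma3 = 160 * (d ^ 5 * u) + 31125 * (d ^ 5 * u ^ 2) + 1025625 * (d ^ 5 * u ^ 3) + 11062500 * (d ^ 5 * u ^ 4) + 37500000 * (d ^ 5 * u ^ 5) + z * (2700 * (d ^ 5 * u) + 140625 * (d ^ 5 * u ^ 2) + 1912500 * (d ^ 5 * u ^ 3) + 7500000 * (d ^ 5 * u ^ 4))"
    unfolding eval_mult_def sigma3_def z_def by (simp add: algebra_simps power_def)
  have s4: "d ^ 5 * eval_mult u t sigma4 = 20 * (d ^ 5 * u) + 4525 * (d ^ 5 * u ^ 2) + 160000 * (d ^ 5 * u ^ 3) + 1796875 * (d ^ 5 * u ^ 4) + 6250000 * (d ^ 5 * u ^ 5) + z * (375 * (d ^ 5 * u) + 21625 * (d ^ 5 * u ^ 2) + 309375 * (d ^ 5 * u ^ 3) + 1250000 * (d ^ 5 * u ^ 4))"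
    unfolding eval_mult_def sigma4_def z_def by (simp add: algebra_simps power_def)
  have s5: "d ^ 5 * eval_mult u t sigma5 = 1 * (d ^ 5 * u) + 250 * (d ^ 5 * u ^ 2) + 9375 * (d ^ 5 * u ^ 3) + 109375 * (d ^ 5 * u ^ 4) + 390625 * (d ^ 5 * u ^ 5) + z * (20 * (d ^ 5 * u) + 1250 * (d ^ 5 * u ^ 2) + 18750 * (d ^ 5 * u ^ 3) + 78125 * (d ^ 5 * u ^ 4))"
    unfolding eval_mult_def sigma5_def z_def by (simp add: algebra_simps power_def)
  have "d ^ 5 * (eval_mult u t sigma1 * y + eval_mult u t sigma2 * y ^ 2 + eval_mult u t sigma3 * y ^ 3
     + eval_mult u t sigma4 * y ^ 4 + eval_mult u t sigma5 * y ^ 5) =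
     (d ^ 5 * eval_mult u t sigma1) * y + (d ^ 5 * eval_mult u t sigma2) * y ^ 2 + (d ^ 5 * eval_mult u t sigma3) * y ^ 3
     + (d ^ 5 * eval_mult u t sigma4) * y ^ 4 + (d ^ 5 * eval_mult u t sigma5) * y ^ 5"
    by (simp only: algebra_simps)
  \<comment> \<open>The common factor is d^5: the product M(W) M(3 - W) equals d^5 times 1 minus the
    sum with the sigmas.\<close>
  also have "\<dots> = d ^ 5 - (z * W ^ 5 - 5 * z * (1 - z) * (W ^ 4 - d * W ^ 3 + d ^ 2 * W ^ 2 - d ^ 3 * W) - (1 - z) * d ^ 4) *
     (z * (3 - W) ^ 5 - 5 * z * (1 - z) * ((3 - W) ^ 4 - d * (3 - W) ^ 3 + d ^ 2 * (3 - W) ^ 2 - d ^ 3 * (3 - W)) - (1 - z) * d ^ 4)"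
    unfolding s1 s2 s3 s4 s5 h yW unfolding d_def by algebra
  also have "\<dots> = d ^ 5" using M by simp
  finally show "eval_mult u t sigma1 * y + eval_mult u t sigma2 * y ^ 2 + eval_mult u t sigma3 * y ^ 3
     + eval_mult u t sigma4 * y ^ 4 + eval_mult u t sigma5 * y ^ 5 = 1"
    using d0 by simp
qed

section \<open>The operator \<open>U\<^sub>5\<close>\<close>

text \<open>\<open>U5\<close> in the nome: if x is the nome of tau / 5, then (tau + l) / 5 has nome
  \<open>zeta5 ^ l * x\<close>. The result depends only on x^5, the nome of tau, but is kept as a
  function of x so that no fifth root has to be chosen.\<close>

definition U_q :: "(complex \<Rightarrow> complex) \<Rightarrow> complex \<Rightarrow> complex" where
  "U_q f x = (\<Sum>l<5. f (zeta5 ^ l * x)) / 5"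

abbreviation eval_ut5 :: "complex \<Rightarrow> ut_poly \<Rightarrow> complex" where
  "eval_ut5 x \<equiv> eval_ut (u_q (x ^ 5)) (t_q (x ^ 5))"

lemma U_q_add: "U_q (\<lambda>y. f y + g y) x = U_q f x + U_q g x"
  by (simp add: U_q_def sum.distrib add_divide_distrib)

lemma U_q_mult_const: "U_q (\<lambda>y. c (y ^ 5) * f y) x = c (x ^ 5) * U_q f x"
  by (simp add: U_q_def sum_distrib_left)

lemma U_q_cmult: "U_q (\<lambda>y. c * f y) x = c * U_q f x"
  by (rule U_q_mult_const)

text \<open>All conjugates have the same fifth power, so inside the average every quantity depending
  on x^5 is a constant and the modular equations can be applied with constant coefficients.\<close>

lemma U_q_cong:
  assumes "x \<in> punctured_disc" "\<And>y. y \<in> punctured_disc \<Longrightarrow> y ^ 5 = x ^ 5 \<Longrightarrow> f y = g y"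
  shows "U_q f x = U_q g x"
proof -
  have "f (zeta5 ^ l * x) = g (zeta5 ^ l * x)" for l
    by (rule assms(2)) (use zeta5_mult_punctured_disc[OF assms(1)] in auto)
  thus ?thesis by (simp add: U_q_def)
qed

text \<open>Coefficients of the equation \<open>W\<^sup>5 = K\<^sub>4 W\<^sup>4 + K\<^sub>3 W\<^sup>3 + K\<^sub>2 W\<^sup>2 + K\<^sub>1 W + K\<^sub>0\<close> of \<open>W = t + 4\<close>.\<close>

definition K1 :: "int poly \<times> int poly" where
  "K1 = ([:- 5, - 450, - 5625, - 15625:], [:80, 3250, 31250, 78125:])"

definition K2 :: "int poly \<times> int poly" where
  "K2 = ([:5, 175, 625:], [:- 55, - 1000, - 3125:])"

definition K3 :: "int poly \<times> int poly" where
  "K3 = ([:- 5, - 25:], [:30, 125:])"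

definition K4 :: "int poly \<times> int poly" where
  "K4 = ([:5:], [:- 5:])"

definition K0 :: ut_poly where
  "K0 = ([:- 16, - 650, - 6250, - 15625:], [:1, 170, 4375, 34375, 78125:])"

text \<open>Inside the average W^5 is replaced by lower powers of W. The constant coefficient (t +
  4) d^4 contains a bare t and is therefore not a multiplier s + u s' t. In that product the roles
  are exchanged: \<open>X n\<close> acts as the multiplier, which requires its t-part to be
  divisible by u.\<close>

lemma U_q_W_recurrence:
  fixes g :: "complex \<Rightarrow> complex"
  assumes x: "x \<in> punctured_disc"
  defines "u \<equiv> u_q (x ^ 5)" and "t \<equiv> t_q (x ^ 5)"
  defines "X \<equiv> \<lambda>n. U_q (\<lambda>y. g y * (t_q y + 4) ^ n) x"
  assumes Y: "X (n + 4) = eval_ut u t Y4" "X (n + 3) = eval_ut u t Y3" "X (n + 2) = eval_ut u t Y2"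
    "X (n + 1) = eval_ut u t Y1" "X n = eval_ut u t (fst Y0, pCons 0 (snd Y0))"
  shows "X (n + 5) = eval_ut u t (ut_mult K4 Y4 + ut_mult K3 Y3 + ut_mult K2 Y2 + ut_mult K1 Y1 + ut_mult Y0 K0)"
proof -
  have x5: "x ^ 5 \<in> punctured_disc" using power_punctured_disc[OF x] by auto
  define z where "z = u * t"
  define d where "d = 1 - 5 * z"
  note r = level_10_ring[OF x5, folded u_def t_def, folded z_def]
  have utz: "u * t = z" by (simp add: z_def)
  have zt: "(1 - z) = z * (t + 4)" using r(1) by (simp add: algebra_simps)
  have W5: "(t_q y + 4) ^ 5 = 5 * (1 - z) * ((t_q y + 4) ^ 4 - d * (t_q y + 4) ^ 3 + d ^ 2 * (t_q y + 4) ^ 2 - d ^ 3 * (t_q y + 4)) + (t + 4) * d ^ 4"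
    if y: "y \<in> punctured_disc" "y ^ 5 = x ^ 5" for y
  proof -
    have "z * (t_q y + 4) ^ 5 = z * (5 * (1 - z) * ((t_q y + 4) ^ 4 - d * (t_q y + 4) ^ 3 + d ^ 2 * (t_q y + 4) ^ 2 - d ^ 3 * (t_q y + 4)) + (t + 4) * d ^ 4)"
      using W_modular_equation(2)[OF y(1)] zt unfolding y(2) u_def[symmetric] t_def[symmetric] utz d_def[symmetric] by algebra
    thus ?thesis using r(6) by simp
  qed
  have "X (n + 5) = U_q (\<lambda>y. 5 * (1 - z) * (g y * (t_q y + 4) ^ (n + 4)) + (- 5 * (1 - z) * d * (g y * (t_q y + 4) ^ (n + 3))
       + (5 * (1 - z) * d ^ 2 * (g y * (t_q y + 4) ^ (n + 2)) + (- 5 * (1 - z) * d ^ 3 * (g y * (t_q y + 4) ^ (n + 1))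
       + (t + 4) * d ^ 4 * (g y * (t_q y + 4) ^ n))))) x"
    unfolding X_def
  proof (rule U_q_cong[OF x])
    fix y assume y: "y \<in> punctured_disc" "y ^ 5 = x ^ 5"
    have "G * (N * V ^ 5) = 5 * (1 - z) * (G * (N * V ^ 4)) + (- 5 * (1 - z) * d * (G * (N * V ^ 3)) + (5 * (1 - z) * d ^ 2 * (G * (N * V ^ 2))
        + (- 5 * (1 - z) * d ^ 3 * (G * (N * V)) + (t + 4) * d ^ 4 * (G * N))))"
      if "V ^ 5 = 5 * (1 - z) * (V ^ 4 - d * V ^ 3 + d ^ 2 * V ^ 2 - d ^ 3 * V) + (t + 4) * d ^ 4" for G N V
      unfolding that by algebra
    from this[OF W5[OF y]] show "g y * (t_q y + 4) ^ (n + 5) = 5 * (1 - z) * (g y * (t_q y + 4) ^ (n + 4)) + (- 5 * (1 - z) * d * (g y * (t_q y + 4) ^ (n + 3))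
       + (5 * (1 - z) * d ^ 2 * (g y * (t_q y + 4) ^ (n + 2)) + (- 5 * (1 - z) * d ^ 3 * (g y * (t_q y + 4) ^ (n + 1))
       + (t + 4) * d ^ 4 * (g y * (t_q y + 4) ^ n))))"
      by (simp only: power_add power_one_right)
  qed
  also have "\<dots> = 5 * (1 - z) * X (n + 4) + (- 5 * (1 - z) * d * X (n + 3)
       + (5 * (1 - z) * d ^ 2 * X (n + 2) + (- 5 * (1 - z) * d ^ 3 * X (n + 1) + (t + 4) * d ^ 4 * X n)))"
    unfolding U_q_add U_q_cmult X_def ..
  also have "- 5 * (1 - z) * d = eval_mult u t K3"
    unfolding eval_mult_def K3_def utz d_def using r(3) by simp algebra
  also have "5 * (1 - z) * d ^ 2 = eval_mult u t K2"
    unfolding eval_mult_def K2_def utz d_def using r(3) by simp algebra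
  also have "- 5 * (1 - z) * d ^ 3 = eval_mult u t K1"
    unfolding eval_mult_def K1_def utz d_def using r(3) by simp algebra
  also have "5 * (1 - z) = eval_mult u t K4"
    unfolding eval_mult_def K4_def utz by (simp add: algebra_simps)
  also have "(t + 4) * d ^ 4 = eval_ut u t K0"
    unfolding eval_ut_def K0_def d_def using r(3,4) utz by simp algebra
  also have "X n = eval_mult u t Y0"
    unfolding Y by (simp add: eval_ut_def eval_mult_def mult_ac)
  finally show ?thesis
    unfolding Y eval_ut_add eval_ut_mult[OF r(7)] by (simp add: mult_ac)
qed

section \<open>Averages of powers of \<open>t + 4\<close>, plain and with
  \<open>A t^2\<close>\<close>

text \<open>
  The entries with index \<open>n\<close> represent \<open>U\<^sub>5((t + 4)\<^sup>n)\<close> and \<open>U\<^sub>5(A t\<^sup>2 (t + 4)\<^sup>n)\<close>.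
\<close>

definition S_data :: "ut_poly list" where
  "S_data = [([:1:], 0),
   ([:1:], [:0, - 1:]),
   ([:3, - 5:], [:0, 2, 25:]),
   ([:13, 15, 125:], [:0, - 3, - 100, - 625:]),
   ([:51, - 30, - 625, - 3125:], [:0, 4, 250, 3750, 15625:]),
   ([:184, - 1450, - 26250, - 165625, - 312500:], [:1, 270, 11375, 161875, 890625, 1562500:]),
   ([:693, - 9075, - 173125, - 1212500, - 3046875, - 1953125:], [:6, 1656, 72125, 1085000, 6656250, 15625000, 9765625:]),
   ([:2689, - 41895, - 778750, - 4987500, - 7421875, 21484375, 48828125:], [:28, 7693, 331100, 4821250, 26562500, 33203125, - 117187500, - 244140625:]),
   ([:10419, - 192140, - 3615750, - 24656250, - 62890625, - 128906250, - 634765625, - 1220703125:], [:128, 35208, 1522100, 22557500, 135156250, 335937500, 761718750, 3417968750, 6103515625:]),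
   ([:40333, - 863820, - 16173750, - 106556250, - 186328125, 558593750, 4443359375, 18310546875, 30517578125:], [:576, 158391, 6837000, 100511250, 572625000, 845703125, - 3554687500, - 25634765625, - 97656250000, - 152587890625:])]"

definition C_data :: "ut_poly list" where
  "C_data = [([:- 1, - 1:], [:0, 2, 5:]),
   ([:- 1, - 11, - 25:], [:0, 7, 60, 125:]),
   ([:1, 46, 325, 625:], [:0, - 12, - 290, - 1750, - 3125:]),
   ([:5, 290, 3075, 11875, 15625:], [:0, - 65, - 1980, - 17625, - 62500, - 78125:]),
   ([:7, 764, 8775, 35000, 46875:], [:1, - 137, - 5325, - 50500, - 184375, - 234375:]),
   ([:33, 4121, 73350, 652500, 3328125, 8984375, 9765625:], [:4, - 663, - 31680, - 475750, - 3862500, - 18359375, - 46875000, - 48828125:]),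
   ([:183, 22276, 493050, 5741250, 39046875, 150781250, 302734375, 244140625:], [:14, - 3448, - 181360, - 3380000, - 35487500, - 223125000, - 812500000, - 1562500000, - 1220703125:]),
   ([:727, 86764, 1789150, 17461250, 74765625, - 49218750, - 1669921875, - 5615234375, - 6103515625:], [:56, - 13627, - 695160, - 11880250, - 101900000, - 374140625, 539062500, 9423828125, 29296875000, 30517578125:]),
   ([:2705, 307555, 4854450, 8082500, - 604640625, - 7987890625, - 47314453125, - 148437500000, - 238037109375, - 152587890625:], [:230, - 50520, - 2333195, - 27766000, 38968750, 4323125000, 48357421875, 264453125000, 788574218750, 1220703125000, 762939453125:])]"

text \<open>From t + 4 = d w and A t^2 = (1 - z)^2 P the first two families reduce to the power sums
  already computed. \<open>A t\<close> is not of this shape; there the equation of W is used to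
  divide by t = W - 4.\<close>

lemma U_q_W_base:
  assumes x: "x \<in> punctured_disc" and n: "n < 5"
  shows "U_q (\<lambda>y. (t_q y + 4) ^ n) x = eval_ut5 x (S_data ! n)"
    and "U_q (\<lambda>y. A_q y * t_q y ^ 2 * (t_q y + 4) ^ n) x = eval_ut5 x (C_data ! n)"
    and "U_q (\<lambda>y. A_q y * t_q y) x = eval_ut5 x ([:1, 256, 6080, 32000:], [:0, 23, 960, 6400:])"
proof -
  have x5: "x ^ 5 \<in> punctured_disc" using power_punctured_disc[OF x] by auto
  define u t where "u = u_q (x ^ 5)" and "t = t_q (x ^ 5)"
  define z where "z = u * t"
  define d where "d = 1 - 5 * z"
  note r = level_10_ring[OF x5, folded u_def t_def, folded z_def, folded d_def]
  have utz: "u * t = z" by (simp add: z_def)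
  have tz: "t = d / z" using r(4,6) by (simp add: field_simps)
  have t4: "t + 4 = (1 - z) / z" using r(1,6) by (simp add: field_simps)
  have t5: "t + 5 = 1 / z" using r(1,6) by (simp add: field_simps)
  \<comment> \<open>Since u = z^2 / d, the factor d^5 turns the powers of u up to the fifth into
    polynomials in z. The further factor z in \<open>cancel\<close> takes care of t = d / z.\<close>
  have h: "d ^ 5 * u = z ^ 2 * d ^ 4" "d ^ 5 * u ^ 2 = z ^ 4 * d ^ 3" "d ^ 5 * u ^ 3 = z ^ 6 * d ^ 2"
     "d ^ 5 * u ^ 4 = z ^ 8 * d" "d ^ 5 * u ^ 5 = z ^ 10"
    using r(2) by algebra+
  have cancel: "a = b" if "d ^ 5 * z * a = d ^ 5 * z * b" for a b using that r(5,6) by simp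
  have W: "t_q y + 4 = d * w_q y" if "y \<in> punctured_disc" "y ^ 5 = x ^ 5" for y
    using W_modular_equation(1)[OF that(1)] by (simp add: that(2) d_def z_def u_def t_def)
  have AT: "A_q y * t_q y ^ 2 = (1 - z) ^ 2 * P_q y" if y: "y \<in> punctured_disc" "y ^ 5 = x ^ 5" for y
  proof -
    have "A_q y * t_q y ^ 2 * (t + 5) ^ 2 = (t + 4) ^ 2 * P_q y"
      using level_50_relations(4)[OF y(1)] by (simp add: y(2) t_def)
    hence "A_q y * t_q y ^ 2 * (z * (t + 5)) ^ 2 = (z * (t + 4)) ^ 2 * P_q y" by algebra
    moreover have "z * (t + 4) = 1 - z" using r(6) by (simp add: t4)
    ultimately show ?thesis using r(1) by simp
  qed
  have S0: "U_q (\<lambda>y. (t_q y + 4) ^ n) x = d ^ n * (\<Sum>l<5. w_q (zeta5 ^ l * x) ^ n) / 5" for n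
  proof -
    have "U_q (\<lambda>y. (t_q y + 4) ^ n) x = U_q (\<lambda>y. d ^ n * w_q y ^ n) x"
      by (rule U_q_cong[OF x]) (simp add: W power_mult_distrib)
    thus ?thesis by (simp add: U_q_cmult) (simp add: U_q_def)
  qed
  have C0: "U_q (\<lambda>y. A_q y * t_q y ^ 2 * (t_q y + 4) ^ n) x =
      (1 - z) ^ 2 * d ^ n * (\<Sum>l<5. P_q (zeta5 ^ l * x) * w_q (zeta5 ^ l * x) ^ n) / 5" for n
  proof -
    have "U_q (\<lambda>y. A_q y * t_q y ^ 2 * (t_q y + 4) ^ n) x = U_q (\<lambda>y. ((1 - z) ^ 2 * d ^ n) * (P_q y * w_q y ^ n)) x"
      by (rule U_q_cong[OF x]) (simp add: AT W power_mult_distrib)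
    thus ?thesis unfolding U_q_cmult by (simp add: U_q_def)
  qed
  note p = w_q_power_sums[OF x, folded t_def]
  have S: "U_q (\<lambda>y. (t_q y + 4) ^ 0) x = 1"
    "U_q (\<lambda>y. (t_q y + 4) ^ 1) x = 4 * d ^ 0 * z ^ 1 + 1 * d ^ 1 * z ^ 0"
    "U_q (\<lambda>y. (t_q y + 4) ^ 2) x = 80 * d ^ 0 * z ^ 2 + 32 * d ^ 1 * z ^ 1 + 3 * d ^ 2 * z ^ 0"
    "U_q (\<lambda>y. (t_q y + 4) ^ 3) x = 1600 * d ^ 0 * z ^ 3 + 960 * d ^ 1 * z ^ 2 + 192 * d ^ 2 * z ^ 1 + 13 * d ^ 3 * z ^ 0"
    "U_q (\<lambda>y. (t_q y + 4) ^ 4) x = 32000 * d ^ 0 * z ^ 4 + 25600 * d ^ 1 * z ^ 3 + 7680 * d ^ 2 * z ^ 2 + 1024 * d ^ 3 * z ^ 1 + 51 * d ^ 4 * z ^ 0"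
    unfolding S0 unfolding power_one_right p tz using r(5,6) by (simp_all add: field_simps power_def)
  note p = P_q_power_sums[OF x, folded t_def]
  have CC0: "U_q (\<lambda>y. A_q y * t_q y ^ 2 * (t_q y + 4) ^ 0) x = - ((1 - z) ^ 2)"
    unfolding C0 using p(1) by simp
  have CC1: "U_q (\<lambda>y. A_q y * t_q y ^ 2 * (t_q y + 4) ^ 1) x = - ((1 - z) ^ 2 * d)"
    unfolding C0 using p(2) by simp
  have CC2: "U_q (\<lambda>y. A_q y * t_q y ^ 2 * (t_q y + 4) ^ 2) x = (1 - z) ^ 2 * d ^ 2"
    unfolding C0 p by simp
  have CC3: "U_q (\<lambda>y. A_q y * t_q y ^ 2 * (t_q y + 4) ^ 3) x = 5 * (1 - z) ^ 3 * d ^ 2"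
    unfolding C0 p t4 unfolding tz using r(5,6) by (simp add: divide_simps) (simp add: power_def)?
  have CC4: "U_q (\<lambda>y. A_q y * t_q y ^ 2 * (t_q y + 4) ^ 4) x = (1 - z) ^ 2 * d ^ 2 * (d ^ 3 + 29 * d ^ 2 * z + 200 * d * z ^ 2 + 400 * z ^ 3) / z"
    unfolding C0 p tz using r(5,6) by (simp add: divide_simps) algebra?
  have ES0: "eval_ut u t ([:1:], 0) = 1" (is "eval_ut u t ?P = ?v")
  proof (rule cancel)
    have "d ^ 5 * z * eval_ut u t ?P = z * (1 * (d ^ 5)) + z * z * (0) + 0 * d ^ 5 * (t * z)"
      unfolding eval_ut_def utz[symmetric] by (simp add: algebra_simps power_def)
    also have "t * z = d" using r(4) by (simp add: mult.commute)
    finally show "d ^ 5 * z * eval_ut u t ?P = d ^ 5 * z * ?v"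
      unfolding h unfolding d_def by algebra
  qed
  have ES1: "eval_ut u t ([:1:], [:0, - 1:]) = 4 * d ^ 0 * z ^ 1 + 1 * d ^ 1 * z ^ 0" (is "eval_ut u t ?P = ?v")
  proof (rule cancel)
    have "d ^ 5 * z * eval_ut u t ?P = z * (1 * (d ^ 5)) + z * z * ((- 1) * (d ^ 5)) + 0 * d ^ 5 * (t * z)"
      unfolding eval_ut_def utz[symmetric] by (simp add: algebra_simps power_def)
    also have "t * z = d" using r(4) by (simp add: mult.commute)
    finally show "d ^ 5 * z * eval_ut u t ?P = d ^ 5 * z * ?v"
      unfolding h unfolding d_def by algebra
  qed
  have ES2: "eval_ut u t ([:3, - 5:], [:0, 2, 25:]) = 80 * d ^ 0 * z ^ 2 + 32 * d ^ 1 * z ^ 1 + 3 * d ^ 2 * z ^ 0" (is "eval_ut u t ?P = ?v")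
  proof (rule cancel)
    have "d ^ 5 * z * eval_ut u t ?P = z * (3 * (d ^ 5) + (- 5) * (d ^ 5 * u)) + z * z * (2 * (d ^ 5) + 25 * (d ^ 5 * u)) + 0 * d ^ 5 * (t * z)"
      unfolding eval_ut_def utz[symmetric] by (simp add: algebra_simps power_def)
    also have "t * z = d" using r(4) by (simp add: mult.commute)
    finally show "d ^ 5 * z * eval_ut u t ?P = d ^ 5 * z * ?v"
      unfolding h unfolding d_def by algebra
  qed
  have ES3: "eval_ut u t ([:13, 15, 125:], [:0, - 3, - 100, - 625:]) = 1600 * d ^ 0 * z ^ 3 + 960 * d ^ 1 * z ^ 2 + 192 * d ^ 2 * z ^ 1 + 13 * d ^ 3 * z ^ 0" (is "eval_ut u t ?P = ?v")
  proof (rule cancel)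
    have "d ^ 5 * z * eval_ut u t ?P = z * (13 * (d ^ 5) + 15 * (d ^ 5 * u) + 125 * (d ^ 5 * u ^ 2)) + z * z * ((- 3) * (d ^ 5) + (- 100) * (d ^ 5 * u) + (- 625) * (d ^ 5 * u ^ 2)) + 0 * d ^ 5 * (t * z)"
      unfolding eval_ut_def utz[symmetric] by (simp add: algebra_simps power_def)
    also have "t * z = d" using r(4) by (simp add: mult.commute)
    finally show "d ^ 5 * z * eval_ut u t ?P = d ^ 5 * z * ?v"
      unfolding h unfolding d_def by algebra
  qed
  have ES4: "eval_ut u t ([:51, - 30, - 625, - 3125:], [:0, 4, 250, 3750, 15625:]) = 32000 * d ^ 0 * z ^ 4 + 25600 * d ^ 1 * z ^ 3 + 7680 * d ^ 2 * z ^ 2 + 1024 * d ^ 3 * z ^ 1 + 51 * d ^ 4 * z ^ 0" (is "eval_ut u t ?P = ?v")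
  proof (rule cancel)
    have "d ^ 5 * z * eval_ut u t ?P = z * (51 * (d ^ 5) + (- 30) * (d ^ 5 * u) + (- 625) * (d ^ 5 * u ^ 2) + (- 3125) * (d ^ 5 * u ^ 3)) + z * z * (4 * (d ^ 5) + 250 * (d ^ 5 * u) + 3750 * (d ^ 5 * u ^ 2) + 15625 * (d ^ 5 * u ^ 3)) + 0 * d ^ 5 * (t * z)"
      unfolding eval_ut_def utz[symmetric] by (simp add: algebra_simps power_def)
    also have "t * z = d" using r(4) by (simp add: mult.commute)
    finally show "d ^ 5 * z * eval_ut u t ?P = d ^ 5 * z * ?v"
      unfolding h unfolding d_def by algebra
  qed
  have EC0: "eval_ut u t ([:- 1, - 1:], [:0, 2, 5:]) = - ((1 - z) ^ 2)" (is "eval_ut u t ?P = ?v")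
  proof (rule cancel)
    have "d ^ 5 * z * eval_ut u t ?P = z * ((- 1) * (d ^ 5) + (- 1) * (d ^ 5 * u)) + z * z * (2 * (d ^ 5) + 5 * (d ^ 5 * u)) + 0 * d ^ 5 * (t * z)"
      unfolding eval_ut_def utz[symmetric] by (simp add: algebra_simps power_def)
    also have "t * z = d" using r(4) by (simp add: mult.commute)
    finally show "d ^ 5 * z * eval_ut u t ?P = d ^ 5 * z * ?v"
      unfolding h unfolding d_def by algebra
  qed
  have EC1: "eval_ut u t ([:- 1, - 11, - 25:], [:0, 7, 60, 125:]) = - ((1 - z) ^ 2 * d)" (is "eval_ut u t ?P = ?v")
  proof (rule cancel)
    have "d ^ 5 * z * eval_ut u t ?P = z * ((- 1) * (d ^ 5) + (- 11) * (d ^ 5 * u) + (- 25) * (d ^ 5 * u ^ 2)) + z * z * (7 * (d ^ 5) + 60 * (d ^ 5 * u) + 125 * (d ^ 5 * u ^ 2)) + 0 * d ^ 5 * (t * z)"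
      unfolding eval_ut_def utz[symmetric] by (simp add: algebra_simps power_def)
    also have "t * z = d" using r(4) by (simp add: mult.commute)
    finally show "d ^ 5 * z * eval_ut u t ?P = d ^ 5 * z * ?v"
      unfolding h unfolding d_def by algebra
  qed
  have EC2: "eval_ut u t ([:1, 46, 325, 625:], [:0, - 12, - 290, - 1750, - 3125:]) = (1 - z) ^ 2 * d ^ 2" (is "eval_ut u t ?P = ?v")
  proof (rule cancel)
    have "d ^ 5 * z * eval_ut u t ?P = z * (1 * (d ^ 5) + 46 * (d ^ 5 * u) + 325 * (d ^ 5 * u ^ 2) + 625 * (d ^ 5 * u ^ 3)) + z * z * ((- 12) * (d ^ 5) + (- 290) * (d ^ 5 * u) + (- 1750) * (d ^ 5 * u ^ 2) + (- 3125) * (d ^ 5 * u ^ 3)) + 0 * d ^ 5 * (t * z)"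
      unfolding eval_ut_def utz[symmetric] by (simp add: algebra_simps power_def)
    also have "t * z = d" using r(4) by (simp add: mult.commute)
    finally show "d ^ 5 * z * eval_ut u t ?P = d ^ 5 * z * ?v"
      unfolding h unfolding d_def by algebra
  qed
  have EC3: "eval_ut u t ([:5, 290, 3075, 11875, 15625:], [:0, - 65, - 1980, - 17625, - 62500, - 78125:]) = 5 * (1 - z) ^ 3 * d ^ 2" (is "eval_ut u t ?P = ?v")
  proof (rule cancel)
    have "d ^ 5 * z * eval_ut u t ?P = z * (5 * (d ^ 5) + 290 * (d ^ 5 * u) + 3075 * (d ^ 5 * u ^ 2) + 11875 * (d ^ 5 * u ^ 3) + 15625 * (d ^ 5 * u ^ 4)) + z * z * ((- 65) * (d ^ 5) + (- 1980) * (d ^ 5 * u) + (- 17625) * (d ^ 5 * u ^ 2) + (- 62500) * (d ^ 5 * u ^ 3) + (- 78125) * (d ^ 5 * u ^ 4)) + 0 * d ^ 5 * (t * z)"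
      unfolding eval_ut_def utz[symmetric] by (simp add: algebra_simps power_def)
    also have "t * z = d" using r(4) by (simp add: mult.commute)
    finally show "d ^ 5 * z * eval_ut u t ?P = d ^ 5 * z * ?v"
      unfolding h unfolding d_def by algebra
  qed
  have EC4: "eval_ut u t ([:7, 764, 8775, 35000, 46875:], [:1, - 137, - 5325, - 50500, - 184375, - 234375:]) = (1 - z) ^ 2 * d ^ 2 * (d ^ 3 + 29 * d ^ 2 * z + 200 * d * z ^ 2 + 400 * z ^ 3) / z" (is "eval_ut u t ?P = ?v")
  proof (rule cancel)
    have "d ^ 5 * z * eval_ut u t ?P = z * (7 * (d ^ 5) + 764 * (d ^ 5 * u) + 8775 * (d ^ 5 * u ^ 2) + 35000 * (d ^ 5 * u ^ 3) + 46875 * (d ^ 5 * u ^ 4)) + z * z * ((- 137) * (d ^ 5) + (- 5325) * (d ^ 5 * u) + (- 50500) * (d ^ 5 * u ^ 2) + (- 184375) * (d ^ 5 * u ^ 3) + (- 234375) * (d ^ 5 * u ^ 4)) + 1 * d ^ 5 * (t * z)"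
      unfolding eval_ut_def utz[symmetric] by (simp add: algebra_simps power_def)
    also have "t * z = d" using r(4) by (simp add: mult.commute)
    finally show "d ^ 5 * z * eval_ut u t ?P = d ^ 5 * z * ?v"
      unfolding h using r(6) by (simp add: field_simps) (simp add: d_def, algebra)
  qed
  consider "n = 0" | "n = 1" | "n = 2" | "n = 3" | "n = 4" using n by linarith
  thus "U_q (\<lambda>y. (t_q y + 4) ^ n) x = eval_ut5 x (S_data ! n)"
  proof cases
    case 1
    have *: "S_data ! 0 = ([:1:], 0)" by (simp add: S_data_def)
    show ?thesis unfolding u_def[symmetric] t_def[symmetric] 1 * ES0 by (rule S(1))
  next
    case 2
    have *: "S_data ! 1 = ([:1:], [:0, - 1:])" by (simp add: S_data_def)
    show ?thesis unfolding u_def[symmetric] t_def[symmetric] 2 * ES1 by (rule S(2))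
  next
    case 3
    have *: "S_data ! 2 = ([:3, - 5:], [:0, 2, 25:])" by (simp add: S_data_def)
    show ?thesis unfolding u_def[symmetric] t_def[symmetric] 3 * ES2 by (rule S(3))
  next
    case 4
    have *: "S_data ! 3 = ([:13, 15, 125:], [:0, - 3, - 100, - 625:])" by (simp add: S_data_def)
    show ?thesis unfolding u_def[symmetric] t_def[symmetric] 4 * ES3 by (rule S(4))
  next
    case 5
    have *: "S_data ! 4 = ([:51, - 30, - 625, - 3125:], [:0, 4, 250, 3750, 15625:])" by (simp add: S_data_def)
    show ?thesis unfolding u_def[symmetric] t_def[symmetric] 5 * ES4 by (rule S(5))
  qed
  consider "n = 0" | "n = 1" | "n = 2" | "n = 3" | "n = 4" using n by linarith
  thus "U_q (\<lambda>y. A_q y * t_q y ^ 2 * (t_q y + 4) ^ n) x = eval_ut5 x (C_data ! n)"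
  proof cases
    case 1
    have *: "C_data ! 0 = ([:- 1, - 1:], [:0, 2, 5:])" by (simp add: C_data_def)
    show ?thesis unfolding u_def[symmetric] t_def[symmetric] 1 * EC0 by (rule CC0)
  next
    case 2
    have *: "C_data ! 1 = ([:- 1, - 11, - 25:], [:0, 7, 60, 125:])" by (simp add: C_data_def)
    show ?thesis unfolding u_def[symmetric] t_def[symmetric] 2 * EC1 by (rule CC1)
  next
    case 3
    have *: "C_data ! 2 = ([:1, 46, 325, 625:], [:0, - 12, - 290, - 1750, - 3125:])" by (simp add: C_data_def)
    show ?thesis unfolding u_def[symmetric] t_def[symmetric] 3 * EC2 by (rule CC2)
  next
    case 4
    have *: "C_data ! 3 = ([:5, 290, 3075, 11875, 15625:], [:0, - 65, - 1980, - 17625, - 62500, - 78125:])" by (simp add: C_data_def)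
    show ?thesis unfolding u_def[symmetric] t_def[symmetric] 4 * EC3 by (rule CC3)
  next
    case 5
    have *: "C_data ! 4 = ([:7, 764, 8775, 35000, 46875:], [:1, - 137, - 5325, - 50500, - 184375, - 234375:])" by (simp add: C_data_def)
    show ?thesis unfolding u_def[symmetric] t_def[symmetric] 5 * EC4 by (rule CC4)
  qed
  \<comment> \<open>Synthetic division of the equation of W by W - 4: the quotient is z (W^4 + b3
    W^3 + b2 W^2 + b1 W + b0), the remainder, its value at 4, is -d^5. At a root this gives d^5 = t
    times the quotient, hence an expression for 1 / t.\<close>
  define k where "k = 5 * (1 - z)"
  define b3 b2 b1 b0 where "b3 = 4 - k" and "b2 = k * d + 4 * b3" and "b1 = 4 * b2 - k * d ^ 2" and "b0 = k * d ^ 3 + 4 * b1"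
  have "d ^ 5 * (A_q y * t_q y) = z * (b0 * (A_q y * t_q y ^ 2 * (t_q y + 4) ^ 0) + (b1 * (A_q y * t_q y ^ 2 * (t_q y + 4) ^ 1)
      + (b2 * (A_q y * t_q y ^ 2 * (t_q y + 4) ^ 2) + (b3 * (A_q y * t_q y ^ 2 * (t_q y + 4) ^ 3) + A_q y * t_q y ^ 2 * (t_q y + 4) ^ 4))))"
    if y: "y \<in> punctured_disc" "y ^ 5 = x ^ 5" for y
  proof -
    define V where "V = t_q y + 4"
    have m: "z * V ^ 5 = 5 * z * (1 - z) * (V ^ 4 - d * V ^ 3 + d ^ 2 * V ^ 2 - d ^ 3 * V) + (1 - z) * d ^ 4"
      using W_modular_equation(2)[OF y(1)] by (simp add: y(2) V_def d_def z_def u_def t_def)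
    have "d ^ 5 = (V - 4) * (z * (b0 + b1 * V + b2 * V ^ 2 + b3 * V ^ 3 + V ^ 4))"
      unfolding b0_def b1_def b2_def b3_def k_def using m d_def by algebra
    hence "d ^ 5 * (a * (V - 4)) = z * (b0 * (a * (V - 4) ^ 2) + (b1 * (a * (V - 4) ^ 2 * V) + (b2 * (a * (V - 4) ^ 2 * V ^ 2)
        + (b3 * (a * (V - 4) ^ 2 * V ^ 3) + a * (V - 4) ^ 2 * V ^ 4))))" for a
      by algebra
    moreover have t: "t_q y = V - 4" by (simp add: V_def)
    ultimately show ?thesis
      unfolding V_def[symmetric] unfolding t by (simp only: power_0 mult_1_right power_one_right)
  qed
  hence "U_q (\<lambda>y. d ^ 5 * (A_q y * t_q y)) x = U_q (\<lambda>y. z * (b0 * (A_q y * t_q y ^ 2 * (t_q y + 4) ^ 0) + (b1 * (A_q y * t_q y ^ 2 * (t_q y + 4) ^ 1)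
      + (b2 * (A_q y * t_q y ^ 2 * (t_q y + 4) ^ 2) + (b3 * (A_q y * t_q y ^ 2 * (t_q y + 4) ^ 3) + A_q y * t_q y ^ 2 * (t_q y + 4) ^ 4))))) x"
    by (rule U_q_cong[OF x])
  hence E: "d ^ 5 * U_q (\<lambda>y. A_q y * t_q y) x = z * (b0 * (- ((1 - z) ^ 2)) + (b1 * (- ((1 - z) ^ 2 * d)) + (b2 * ((1 - z) ^ 2 * d ^ 2)
      + (b3 * (5 * (1 - z) ^ 3 * d ^ 2) + (1 - z) ^ 2 * d ^ 2 * (d ^ 3 + 29 * d ^ 2 * z + 200 * d * z ^ 2 + 400 * z ^ 3) / z))))"
    unfolding U_q_add U_q_cmult CC0 CC1 CC2 CC3 CC4 .

  show "U_q (\<lambda>y. A_q y * t_q y) x = eval_ut5 x ([:1, 256, 6080, 32000:], [:0, 23, 960, 6400:])"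
    unfolding u_def[symmetric] t_def[symmetric]
  proof (rule cancel)
    have "d ^ 5 * z * eval_ut u t ([:1, 256, 6080, 32000:], [:0, 23, 960, 6400:]) = z * (1 * (d ^ 5) + 256 * (d ^ 5 * u) + 6080 * (d ^ 5 * u ^ 2) + 32000 * (d ^ 5 * u ^ 3)) + z * z * (23 * (d ^ 5) + 960 * (d ^ 5 * u) + 6400 * (d ^ 5 * u ^ 2))"
      unfolding eval_ut_def utz[symmetric] by (simp add: algebra_simps power_def)
    also have "\<dots> = z * (z * (b0 * (- ((1 - z) ^ 2)) + b1 * (- ((1 - z) ^ 2 * d)) + b2 * ((1 - z) ^ 2 * d ^ 2)
      + b3 * (5 * (1 - z) ^ 3 * d ^ 2)) + (1 - z) ^ 2 * d ^ 2 * (d ^ 3 + 29 * d ^ 2 * z + 200 * d * z ^ 2 + 400 * z ^ 3))"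
      unfolding h b0_def b1_def b2_def b3_def k_def unfolding d_def by algebra
    also have "\<dots> = z * (d ^ 5 * U_q (\<lambda>y. A_q y * t_q y) x)"
      unfolding E using r(6) by (simp add: field_simps)
    finally show "d ^ 5 * z * U_q (\<lambda>y. A_q y * t_q y) x = d ^ 5 * z * eval_ut u t ([:1, 256, 6080, 32000:], [:0, 23, 960, 6400:])"
      by (simp only: mult_ac)
  qed
qed

lemma U_q_W_recurrence_data:
  fixes g :: "complex \<Rightarrow> complex"
  assumes x: "x \<in> punctured_disc"
  assumes Y: "\<And>n. n < m + 5 \<Longrightarrow> U_q (\<lambda>y. g y * (t_q y + 4) ^ n) x = eval_ut5 x (Y ! n)"
  assumes Y0: "Y ! m = (fst Y0, pCons 0 (snd Y0))"
  assumes Y5: "Y ! (m + 5) = ut_mult K4 (Y ! (m + 4)) + ut_mult K3 (Y ! (m + 3)) + ut_mult K2 (Y ! (m + 2)) + ut_mult K1 (Y ! (m + 1)) + ut_mult Y0 K0"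
  assumes n: "n < m + 6"
  shows "U_q (\<lambda>y. g y * (t_q y + 4) ^ n) x = eval_ut5 x (Y ! n)"
proof (cases "n = m + 5")
  case True
  show ?thesis unfolding True Y5
    by (rule U_q_W_recurrence[OF x]; (unfold Y0[symmetric])?, rule Y, simp)
next
  case False
  thus ?thesis using n by (intro Y) auto
qed

text \<open>Ten entries are required because t u^(-4) has degree 9 in t + 4. The recurrence reaches
  exactly this far: \<open>S_data ! 5\<close> contains a bare t and cannot serve as
  multiplier.\<close>

lemma U_q_W:
  assumes x: "x \<in> punctured_disc" and n: "n < 10"
  shows "U_q (\<lambda>y. 1 * (t_q y + 4) ^ n) x = eval_ut5 x (S_data ! n)"
proof -
  have s5: "U_q (\<lambda>y. 1 * (t_q y + 4) ^ n) x = eval_ut5 x (S_data ! n)" if "n < 0 + 5" for n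
    using U_q_W_base(1)[OF x, of n] that by simp
  have s6: "U_q (\<lambda>y. 1 * (t_q y + 4) ^ n) x = eval_ut5 x (S_data ! n)" if "n < 1 + 5" for n
    by (rule U_q_W_recurrence_data[OF x s5, of 0 "([:1:], 0)"])
       (use that in \<open>simp_all add: S_data_def ut_mult_def K0_def K1_def K2_def K3_def K4_def\<close>)
  have s7: "U_q (\<lambda>y. 1 * (t_q y + 4) ^ n) x = eval_ut5 x (S_data ! n)" if "n < 2 + 5" for n
    by (rule U_q_W_recurrence_data[OF x s6, of 1 "([:1:], [:- 1:])"])
       (use that in \<open>simp_all add: S_data_def ut_mult_def K0_def K1_def K2_def K3_def K4_def\<close>)
  have s8: "U_q (\<lambda>y. 1 * (t_q y + 4) ^ n) x = eval_ut5 x (S_data ! n)" if "n < 3 + 5" for n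
    by (rule U_q_W_recurrence_data[OF x s7, of 2 "([:3, - 5:], [:2, 25:])"])
       (use that in \<open>simp_all add: S_data_def ut_mult_def K0_def K1_def K2_def K3_def K4_def\<close>)
  have s9: "U_q (\<lambda>y. 1 * (t_q y + 4) ^ n) x = eval_ut5 x (S_data ! n)" if "n < 4 + 5" for n
    by (rule U_q_W_recurrence_data[OF x s8, of 3 "([:13, 15, 125:], [:- 3, - 100, - 625:])"])
       (use that in \<open>simp_all add: S_data_def ut_mult_def K0_def K1_def K2_def K3_def K4_def\<close>)
  have s10: "U_q (\<lambda>y. 1 * (t_q y + 4) ^ n) x = eval_ut5 x (S_data ! n)" if "n < 5 + 5" for n
    by (rule U_q_W_recurrence_data[OF x s9, of 4 "([:51, - 30, - 625, - 3125:], [:4, 250, 3750, 15625:])"])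
       (use that in \<open>simp_all add: S_data_def ut_mult_def K0_def K1_def K2_def K3_def K4_def\<close>)
  show ?thesis by (rule s10) (use n in simp)
qed

text \<open>A u^(-5) is A t^2 times a polynomial of degree 8 in t + 4, and the bare t in
  \<open>C_data ! 4\<close> stops the recurrence just after index 8.\<close>

lemma U_q_A_W:
  assumes x: "x \<in> punctured_disc" and n: "n < 9"
  shows "U_q (\<lambda>y. (A_q y * t_q y ^ 2) * (t_q y + 4) ^ n) x = eval_ut5 x (C_data ! n)"
proof -
  have s5: "U_q (\<lambda>y. (A_q y * t_q y ^ 2) * (t_q y + 4) ^ n) x = eval_ut5 x (C_data ! n)" if "n < 0 + 5" for n
    using U_q_W_base(2)[OF x, of n] that by simp
  have s6: "U_q (\<lambda>y. (A_q y * t_q y ^ 2) * (t_q y + 4) ^ n) x = eval_ut5 x (C_data ! n)" if "n < 1 + 5" for n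
    by (rule U_q_W_recurrence_data[OF x s5, of 0 "([:- 1, - 1:], [:2, 5:])"])
       (use that in \<open>simp_all add: C_data_def ut_mult_def K0_def K1_def K2_def K3_def K4_def\<close>)
  have s7: "U_q (\<lambda>y. (A_q y * t_q y ^ 2) * (t_q y + 4) ^ n) x = eval_ut5 x (C_data ! n)" if "n < 2 + 5" for n
    by (rule U_q_W_recurrence_data[OF x s6, of 1 "([:- 1, - 11, - 25:], [:7, 60, 125:])"])
       (use that in \<open>simp_all add: C_data_def ut_mult_def K0_def K1_def K2_def K3_def K4_def\<close>)
  have s8: "U_q (\<lambda>y. (A_q y * t_q y ^ 2) * (t_q y + 4) ^ n) x = eval_ut5 x (C_data ! n)" if "n < 3 + 5" for n
    by (rule U_q_W_recurrence_data[OF x s7, of 2 "([:1, 46, 325, 625:], [:- 12, - 290, - 1750, - 3125:])"])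
       (use that in \<open>simp_all add: C_data_def ut_mult_def K0_def K1_def K2_def K3_def K4_def\<close>)
  have s9: "U_q (\<lambda>y. (A_q y * t_q y ^ 2) * (t_q y + 4) ^ n) x = eval_ut5 x (C_data ! n)" if "n < 4 + 5" for n
    by (rule U_q_W_recurrence_data[OF x s8, of 3 "([:5, 290, 3075, 11875, 15625:], [:- 65, - 1980, - 17625, - 62500, - 78125:])"])
       (use that in \<open>simp_all add: C_data_def ut_mult_def K0_def K1_def K2_def K3_def K4_def\<close>)
  show ?thesis by (rule s9) (use n in simp)
qed

section \<open>Averages of negative powers of \<open>u\<close>\<close>

definition int_horner :: "int list \<Rightarrow> complex \<Rightarrow> complex" where
  "int_horner cs v = foldr (\<lambda>c a. of_int c + v * a) cs 0"

lemma U_q_int_horner: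
  assumes Y: "\<And>n. n < length Y \<Longrightarrow> U_q (\<lambda>y. g y * v y ^ n) x = eval_ut u t (Y ! n)"
  assumes "length cs \<le> length Y"
  shows "U_q (\<lambda>y. g y * int_horner cs (v y)) x = eval_ut u t (sum_list (map2 ut_scale cs Y))"
proof -
  have z: "eval_ut u t 0 = 0" by (simp add: eval_ut_def)
  have "U_q (\<lambda>y. g y * v y ^ n * int_horner cs (v y)) x = eval_ut u t (sum_list (map2 ut_scale cs (drop n Y)))"
    if "n + length cs \<le> length Y" for n
    using that
  proof (induction cs arbitrary: n)
    case Nil
    show ?case by (simp add: int_horner_def z U_q_def)
  next
    case (Cons c cs)
    have "(\<lambda>y. g y * v y ^ n * int_horner (c # cs) (v y)) = (\<lambda>y. of_int c * (g y * v y ^ n) + g y * v y ^ Suc n * int_horner cs (v y))"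
      by (rule ext) (simp add: int_horner_def algebra_simps)
    hence "U_q (\<lambda>y. g y * v y ^ n * int_horner (c # cs) (v y)) x = of_int c * U_q (\<lambda>y. g y * v y ^ n) x
        + U_q (\<lambda>y. g y * v y ^ Suc n * int_horner cs (v y)) x"
      by (simp add: U_q_add U_q_cmult)
    also have "U_q (\<lambda>y. g y * v y ^ n) x = eval_ut u t (Y ! n)" using Cons.prems by (intro Y) simp
    also have "U_q (\<lambda>y. g y * v y ^ Suc n * int_horner cs (v y)) x = eval_ut u t (sum_list (map2 ut_scale cs (drop (Suc n) Y)))"
      using Cons.prems by (intro Cons.IH) simp
    finally show ?case
      using Cons.prems by (simp add: Cons_nth_drop_Suc[symmetric])
  qed
  from this[of 0] show ?thesis using assms(2) by simp
qed

text \<open>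
  The entries with index \<open>n\<close> represent \<open>U\<^sub>5(g / u ^ (n + 1))\<close> for \<open>g = 1\<close>, \<open>u t\<close>, \<open>A\<close> and \<open>A t\<close>.
\<close>

definition N1_data :: "ut_poly list" where
  "N1_data = [([:- 4, - 5:], [:0, 5, 25:]),
   ([:16, - 125, - 1375, - 3125:], [:0, 0, 875, 7500, 15625:]),
   ([:- 1, 4500, 59375, 231250, - 234375, - 1953125:], [:- 3, - 825, - 32500, - 343750, - 1125000, 1562500, 9765625:]),
   ([:- 920, - 84000, - 1653125, - 16046875, - 100859375, - 460937500, - 1220703125, - 1220703125:], [:56, 15400, 665000, 10893750, 97421875, 587500000, 2539062500, 6347656250, 6103515625:])]"

definition Nz_data :: "ut_poly list" where
  "Nz_data = [([:- 3:], [:0, - 1:]),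
   ([:16, 50, 125:], [:0, - 25, - 275, - 625:]),
   ([:- 85, - 875, - 16875, - 134375, - 312500:], [:1, 275, 6875, 108750, 734375, 1562500:]),
   ([:235, - 1500, 112500, 2375000, 16250000, 46875000, 48828125:], [:1, 275, - 3750, - 934375, - 14781250, - 90234375, - 244140625, - 244140625:]),
   ([:2315, 238500, 4862500, 63015625, 659765625, 4695312500, 18798828125, 37841796875, 30517578125:], [:- 159, - 43725, - 1888125, - 33684375, - 419296875, - 4109765625, - 26953125000, - 101318359375, - 195312500000, - 152587890625:])]"

definition NA_data :: "ut_poly list" where
  "NA_data = [([:4, 1279, 30400, 160000:], [:0, 117, 4805, 32000:]),
   ([:- 2, 23, 275, 625:], [:0, 4, - 165, - 1500, - 3125:]),
   ([:8, 185, 3050, 17500, 31250:], [:1, - 49, - 1415, - 18500, - 93750, - 156250:]),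
   ([:74, 6310, 193125, 3059375, 25578125, 114843750, 263671875, 244140625:], [:- 12, - 1082, - 56400, - 1431250, - 19646875, - 148906250, - 625000000, - 1367187500, - 1220703125:]),
   ([:- 1428, - 117385, - 4220250, - 83846875, - 987750000, - 7351953125, - 35585937500, - 109619140625, - 195312500000, - 152587890625:], [:119, 18989, 1101600, 33030625, 574996875, 6183203125, 43115234375, 198388671875, 585937500000, 1007080078125, 762939453125:])]"

definition NAt_data :: "ut_poly list" where
  "NAt_data = [([:- 2, - 12, - 25:], [:0, 9, 65, 125:]),
   ([:14, 279, 2600, 10625, 15625:], [:0, - 98, - 1840, - 15000, - 56250, - 78125:]),
   ([:- 58, - 455, 21225, 433750, 3015625, 8984375, 9765625:], [:- 1, 359, 75, - 173875, - 2706250, - 16796875, - 46875000, - 48828125:]),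
   ([:- 126, - 32260, - 1295875, - 22759375, - 215062500, - 1201562500, - 4033203125, - 7568359375, - 6103515625:], [:28, 3598, 322200, 9870625, 149337500, 1287812500, 6757812500, 21630859375, 39062500000, 30517578125:])]"

lemma u_q_nonzero: "x \<in> punctured_disc \<Longrightarrow> u_q x \<noteq> 0"
  using u_q_eq t_q_nonzero by auto

lemma U_q_horner_W:
  assumes x: "x \<in> punctured_disc" and cs: "length cs \<le> 10" and N: "sum_list (map2 ut_scale cs S_data) = N"
    and g: "\<And>y. y \<in> punctured_disc \<Longrightarrow> g y = int_horner cs (t_q y + 4)"
  shows "U_q g x = eval_ut5 x N"
proof -
  have "U_q g x = U_q (\<lambda>y. 1 * int_horner cs (t_q y + 4)) x" by (rule U_q_cong[OF x]) (simp add: g)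
  thus ?thesis
    unfolding N[symmetric] using U_q_int_horner[of S_data "\<lambda>y. 1" "\<lambda>y. t_q y + 4" x, OF U_q_W[OF x]] cs
    by (simp add: S_data_def)
qed

lemma U_q_horner_A_W:
  assumes x: "x \<in> punctured_disc" and cs: "length cs \<le> 9" and N: "sum_list (map2 ut_scale cs C_data) = N"
    and g: "\<And>y. y \<in> punctured_disc \<Longrightarrow> g y = A_q y * t_q y ^ 2 * int_horner cs (t_q y + 4)"
  shows "U_q g x = eval_ut5 x N"
proof -
  have "U_q g x = U_q (\<lambda>y. A_q y * t_q y ^ 2 * int_horner cs (t_q y + 4)) x" by (rule U_q_cong[OF x]) (simp add: g)
  thus ?thesis
    unfolding N[symmetric] using U_q_int_horner[of C_data "\<lambda>y. A_q y * t_q y ^ 2" "\<lambda>y. t_q y + 4" x, OF U_q_A_W[OF x]] cs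
    by (simp add: C_data_def)
qed

lemma inverse_u_q: "y \<in> punctured_disc \<Longrightarrow> 1 / u_q y = (t_q y + 4 - 4) * (t_q y + 4 + 1)"
  using u_modular_equation(1)[of y] by (simp add: add.commute)

text \<open>The lists are the coefficients, lowest first, of ((W - 4) (W + 1))^k with W = t +
  4.\<close>

lemma U_q_neg_1:
  assumes x: "x \<in> punctured_disc"
  shows "U_q (\<lambda>y. 1 * (1 / u_q y) ^ 1) x = eval_ut5 x (N1_data ! 0)"
    "U_q (\<lambda>y. 1 * (1 / u_q y) ^ 2) x = eval_ut5 x (N1_data ! 1)"
    "U_q (\<lambda>y. 1 * (1 / u_q y) ^ 3) x = eval_ut5 x (N1_data ! 2)"
    "U_q (\<lambda>y. 1 * (1 / u_q y) ^ 4) x = eval_ut5 x (N1_data ! 3)"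
proof -
  show "U_q (\<lambda>y. 1 * (1 / u_q y) ^ 1) x = eval_ut5 x (N1_data ! 0)"
    by (rule U_q_horner_W[OF x, of "[- 4, - 3, 1]"], simp, simp add: S_data_def N1_data_def ut_scale_def,
      simp only: inverse_u_q int_horner_def, simp, algebra?)
  show "U_q (\<lambda>y. 1 * (1 / u_q y) ^ 2) x = eval_ut5 x (N1_data ! 1)"
    by (rule U_q_horner_W[OF x, of "[16, 24, 1, - 6, 1]"], simp, simp add: S_data_def N1_data_def ut_scale_def,
      simp only: inverse_u_q int_horner_def, simp, algebra?)
  show "U_q (\<lambda>y. 1 * (1 / u_q y) ^ 3) x = eval_ut5 x (N1_data ! 2)"
    by (rule U_q_horner_W[OF x, of "[- 64, - 144, - 60, 45, 15, - 9, 1]"], simp, simp add: S_data_def N1_data_def ut_scale_def,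
      simp only: inverse_u_q int_horner_def, simp, algebra?)
  show "U_q (\<lambda>y. 1 * (1 / u_q y) ^ 4) x = eval_ut5 x (N1_data ! 3)"
    by (rule U_q_horner_W[OF x, of "[256, 768, 608, - 144, - 255, 36, 38, - 12, 1]"], simp, simp add: S_data_def N1_data_def ut_scale_def,
      simp only: inverse_u_q int_horner_def, simp, algebra?)
qed

text \<open>As u t u^(-k) = t u^(-(k-1)), the lists belong to (W - 4)^k (W + 1)^(k-1).\<close>

lemma U_q_neg_z:
  assumes x: "x \<in> punctured_disc"
  shows "U_q (\<lambda>y. (u_q y * t_q y) * (1 / u_q y) ^ 1) x = eval_ut5 x (Nz_data ! 0)"
    "U_q (\<lambda>y. (u_q y * t_q y) * (1 / u_q y) ^ 2) x = eval_ut5 x (Nz_data ! 1)"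
    "U_q (\<lambda>y. (u_q y * t_q y) * (1 / u_q y) ^ 3) x = eval_ut5 x (Nz_data ! 2)"
    "U_q (\<lambda>y. (u_q y * t_q y) * (1 / u_q y) ^ 4) x = eval_ut5 x (Nz_data ! 3)"
    "U_q (\<lambda>y. (u_q y * t_q y) * (1 / u_q y) ^ 5) x = eval_ut5 x (Nz_data ! 4)"
proof -
  have z: "u_q y * t_q y * (1 / u_q y) ^ k = (t_q y + 4 - 4) * (1 / u_q y) ^ (k - 1)" if "0 < k" "y \<in> punctured_disc" for y k
    using u_q_nonzero[OF that(2)] that(1) by (cases k) simp_all
  show "U_q (\<lambda>y. (u_q y * t_q y) * (1 / u_q y) ^ 1) x = eval_ut5 x (Nz_data ! 0)"
    by (rule U_q_horner_W[OF x, of "[- 4, 1]"], simp, simp add: S_data_def Nz_data_def ut_scale_def,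
      subst z, simp, assumption, simp only: inverse_u_q int_horner_def, simp, algebra?)
  show "U_q (\<lambda>y. (u_q y * t_q y) * (1 / u_q y) ^ 2) x = eval_ut5 x (Nz_data ! 1)"
    by (rule U_q_horner_W[OF x, of "[16, 8, - 7, 1]"], simp, simp add: S_data_def Nz_data_def ut_scale_def,
      subst z, simp, assumption, simp only: inverse_u_q int_horner_def, simp, algebra?)
  show "U_q (\<lambda>y. (u_q y * t_q y) * (1 / u_q y) ^ 3) x = eval_ut5 x (Nz_data ! 2)"
    by (rule U_q_horner_W[OF x, of "[- 64, - 80, 20, 25, - 10, 1]"], simp, simp add: S_data_def Nz_data_def ut_scale_def,
      subst z, simp, assumption, simp only: inverse_u_q int_horner_def, simp, algebra?)
  show "U_q (\<lambda>y. (u_q y * t_q y) * (1 / u_q y) ^ 4) x = eval_ut5 x (Nz_data ! 3)"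
    by (rule U_q_horner_W[OF x, of "[256, 512, 96, - 240, - 15, 51, - 13, 1]"], simp, simp add: S_data_def Nz_data_def ut_scale_def,
      subst z, simp, assumption, simp only: inverse_u_q int_horner_def, simp, algebra?)
  show "U_q (\<lambda>y. (u_q y * t_q y) * (1 / u_q y) ^ 5) x = eval_ut5 x (Nz_data ! 4)"
    by (rule U_q_horner_W[OF x, of "[- 1024, - 2816, - 1664, 1184, 876, - 399, - 116, 86, - 16, 1]"], simp, simp add: S_data_def Nz_data_def ut_scale_def,
      subst z, simp, assumption, simp only: inverse_u_q int_horner_def, simp, algebra?)
qed

text \<open>With A t^2 split off, the lists belong to (W - 4)^(k-2) (W + 1)^k. For k = 1 this is not
  a polynomial; there A / u = A t^2 + 5 A t is used together with the separate average of A
  t.\<close>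

lemma U_q_neg_A:
  assumes x: "x \<in> punctured_disc"
  shows "U_q (\<lambda>y. A_q y * (1 / u_q y) ^ 1) x = eval_ut5 x (NA_data ! 0)"
    "U_q (\<lambda>y. A_q y * (1 / u_q y) ^ 2) x = eval_ut5 x (NA_data ! 1)"
    "U_q (\<lambda>y. A_q y * (1 / u_q y) ^ 3) x = eval_ut5 x (NA_data ! 2)"
    "U_q (\<lambda>y. A_q y * (1 / u_q y) ^ 4) x = eval_ut5 x (NA_data ! 3)"
    "U_q (\<lambda>y. A_q y * (1 / u_q y) ^ 5) x = eval_ut5 x (NA_data ! 4)"
proof -
  show "U_q (\<lambda>y. A_q y * (1 / u_q y) ^ 1) x = eval_ut5 x (NA_data ! 0)"
  proof -
    have "U_q (\<lambda>y. A_q y * (1 / u_q y) ^ 1) x = U_q (\<lambda>y. A_q y * t_q y ^ 2 * (t_q y + 4) ^ 0 + 5 * (A_q y * t_q y)) x"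
      by (rule U_q_cong[OF x]) (simp add: inverse_u_q power2_eq_square algebra_simps)
    also have "\<dots> = eval_ut5 x (C_data ! 0 + ut_scale 5 ([:1, 256, 6080, 32000:], [:0, 23, 960, 6400:]))"
      unfolding U_q_add U_q_cmult using U_q_A_W[OF x, of 0] U_q_W_base(3)[OF x, of 0] by simp
    also have "C_data ! 0 + ut_scale 5 ([:1, 256, 6080, 32000:], [:0, 23, 960, 6400:]) = NA_data ! 0"
      by (simp add: C_data_def NA_data_def ut_scale_def)
    finally show ?thesis .
  qed
  show "U_q (\<lambda>y. A_q y * (1 / u_q y) ^ 2) x = eval_ut5 x (NA_data ! 1)"
    by (rule U_q_horner_A_W[OF x, of "[1, 2, 1]"], simp, simp add: C_data_def NA_data_def ut_scale_def,
      simp only: inverse_u_q int_horner_def, simp, algebra?)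
  show "U_q (\<lambda>y. A_q y * (1 / u_q y) ^ 3) x = eval_ut5 x (NA_data ! 2)"
    by (rule U_q_horner_A_W[OF x, of "[- 4, - 11, - 9, - 1, 1]"], simp, simp add: C_data_def NA_data_def ut_scale_def,
      simp only: inverse_u_q int_horner_def, simp, algebra?)
  show "U_q (\<lambda>y. A_q y * (1 / u_q y) ^ 4) x = eval_ut5 x (NA_data ! 3)"
    by (rule U_q_horner_A_W[OF x, of "[16, 56, 65, 20, - 10, - 4, 1]"], simp, simp add: C_data_def NA_data_def ut_scale_def,
      simp only: inverse_u_q int_horner_def, simp, algebra?)
  show "U_q (\<lambda>y. A_q y * (1 / u_q y) ^ 5) x = eval_ut5 x (NA_data ! 4)"
    by (rule U_q_horner_A_W[OF x, of "[- 64, - 272, - 412, - 219, 45, 66, - 2, - 7, 1]"], simp, simp add: C_data_def NA_data_def ut_scale_def,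
      simp only: inverse_u_q int_horner_def, simp, algebra?)
qed

text \<open>With A t^2 split off, the lists belong to (W - 4)^(k-1) (W + 1)^k.\<close>

lemma U_q_neg_At:
  assumes x: "x \<in> punctured_disc"
  shows "U_q (\<lambda>y. (A_q y * t_q y) * (1 / u_q y) ^ 1) x = eval_ut5 x (NAt_data ! 0)"
    "U_q (\<lambda>y. (A_q y * t_q y) * (1 / u_q y) ^ 2) x = eval_ut5 x (NAt_data ! 1)"
    "U_q (\<lambda>y. (A_q y * t_q y) * (1 / u_q y) ^ 3) x = eval_ut5 x (NAt_data ! 2)"
    "U_q (\<lambda>y. (A_q y * t_q y) * (1 / u_q y) ^ 4) x = eval_ut5 x (NAt_data ! 3)"
proof -
  show "U_q (\<lambda>y. (A_q y * t_q y) * (1 / u_q y) ^ 1) x = eval_ut5 x (NAt_data ! 0)"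
    by (rule U_q_horner_A_W[OF x, of "[1, 1]"], simp, simp add: C_data_def NAt_data_def ut_scale_def,
      simp only: inverse_u_q int_horner_def, simp, algebra?)
  show "U_q (\<lambda>y. (A_q y * t_q y) * (1 / u_q y) ^ 2) x = eval_ut5 x (NAt_data ! 1)"
    by (rule U_q_horner_A_W[OF x, of "[- 4, - 7, - 2, 1]"], simp, simp add: C_data_def NAt_data_def ut_scale_def,
      simp only: inverse_u_q int_horner_def, simp, algebra?)
  show "U_q (\<lambda>y. (A_q y * t_q y) * (1 / u_q y) ^ 3) x = eval_ut5 x (NAt_data ! 2)"
    by (rule U_q_horner_A_W[OF x, of "[16, 40, 25, - 5, - 5, 1]"], simp, simp add: C_data_def NAt_data_def ut_scale_def,
      simp only: inverse_u_q int_horner_def, simp, algebra?)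
  show "U_q (\<lambda>y. (A_q y * t_q y) * (1 / u_q y) ^ 4) x = eval_ut5 x (NAt_data ! 3)"
    by (rule U_q_horner_A_W[OF x, of "[- 64, - 208, - 204, - 15, 60, 6, - 8, 1]"], simp, simp add: C_data_def NAt_data_def ut_scale_def,
      simp only: inverse_u_q int_horner_def, simp, algebra?)
qed

section \<open>The recurrence of order 5 for averages of powers of \<open>u\<close>\<close>

text \<open>
  The summands \<open>D 1, \<dots>, D 4\<close> of the initial values collect the contributions of negative powers of \<open>u\<close>.
\<close>

fun ut_rec :: "(nat \<Rightarrow> ut_poly) \<Rightarrow> nat \<Rightarrow> ut_poly" where
  "ut_rec D 0 = D 0"
| "ut_rec D (Suc 0) = ut_mult sigma1 (ut_rec D 0) + D 1"
| "ut_rec D (Suc (Suc 0)) = ut_mult sigma1 (ut_rec D (Suc 0)) + ut_mult sigma2 (ut_rec D 0) + D 2"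
| "ut_rec D (Suc (Suc (Suc 0))) = ut_mult sigma1 (ut_rec D (Suc (Suc 0))) + ut_mult sigma2 (ut_rec D (Suc 0))
     + ut_mult sigma3 (ut_rec D 0) + D 3"
| "ut_rec D (Suc (Suc (Suc (Suc 0)))) = ut_mult sigma1 (ut_rec D (Suc (Suc (Suc 0)))) + ut_mult sigma2 (ut_rec D (Suc (Suc 0)))
     + ut_mult sigma3 (ut_rec D (Suc 0)) + ut_mult sigma4 (ut_rec D 0) + D 4"
| "ut_rec D (Suc (Suc (Suc (Suc (Suc n))))) = ut_mult sigma1 (ut_rec D (Suc (Suc (Suc (Suc n))))) + ut_mult sigma2 (ut_rec D (Suc (Suc (Suc n))))
     + ut_mult sigma3 (ut_rec D (Suc (Suc n))) + ut_mult sigma4 (ut_rec D (Suc n)) + ut_mult sigma5 (ut_rec D n)"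

lemma ut_rec_numeral:
  "ut_rec D 1 = ut_mult sigma1 (ut_rec D 0) + D 1"
  "ut_rec D 2 = ut_mult sigma1 (ut_rec D 1) + ut_mult sigma2 (ut_rec D 0) + D 2"
  "ut_rec D 3 = ut_mult sigma1 (ut_rec D 2) + ut_mult sigma2 (ut_rec D 1) + ut_mult sigma3 (ut_rec D 0) + D 3"
  "ut_rec D 4 = ut_mult sigma1 (ut_rec D 3) + ut_mult sigma2 (ut_rec D 2) + ut_mult sigma3 (ut_rec D 1)
     + ut_mult sigma4 (ut_rec D 0) + D 4"
  "ut_rec D (n + 5) = ut_mult sigma1 (ut_rec D (n + 4)) + ut_mult sigma2 (ut_rec D (n + 3)) + ut_mult sigma3 (ut_rec D (n + 2))
     + ut_mult sigma4 (ut_rec D (n + 1)) + ut_mult sigma5 (ut_rec D n)"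
  by (simp_all add: eval_nat_numeral)

text \<open>The equation of u writes 1 as the sum of sigma_k u^(-k), and the sigmas are constant on
  the conjugates.\<close>

lemma U_q_u_expand:
  assumes x: "x \<in> punctured_disc"
  defines "e \<equiv> eval_mult (u_q (x ^ 5)) (t_q (x ^ 5))"
  shows "U_q g x = e sigma1 * U_q (\<lambda>y. g y * (1 / u_q y) ^ 1) x + e sigma2 * U_q (\<lambda>y. g y * (1 / u_q y) ^ 2) x
     + e sigma3 * U_q (\<lambda>y. g y * (1 / u_q y) ^ 3) x + e sigma4 * U_q (\<lambda>y. g y * (1 / u_q y) ^ 4) x
     + e sigma5 * U_q (\<lambda>y. g y * (1 / u_q y) ^ 5) x"
proof -
  have "U_q g x = U_q (\<lambda>y. e sigma1 * (g y * (1 / u_q y) ^ 1) + e sigma2 * (g y * (1 / u_q y) ^ 2)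
     + e sigma3 * (g y * (1 / u_q y) ^ 3) + e sigma4 * (g y * (1 / u_q y) ^ 4) + e sigma5 * (g y * (1 / u_q y) ^ 5)) x"
  proof (rule U_q_cong[OF x])
    fix y assume y: "y \<in> punctured_disc" "y ^ 5 = x ^ 5"
    have "a * v + b * v ^ 2 + c * v ^ 3 + d * v ^ 4 + f * v ^ 5 = 1 \<Longrightarrow>
      h = a * (h * v ^ 1) + b * (h * v ^ 2) + c * (h * v ^ 3) + d * (h * v ^ 4) + f * (h * v ^ 5)" for a b c d f h v :: complex
      by algebra
    from this[OF u_modular_equation(2)[OF y(1)]]
    show "g y = e sigma1 * (g y * (1 / u_q y) ^ 1) + e sigma2 * (g y * (1 / u_q y) ^ 2)
     + e sigma3 * (g y * (1 / u_q y) ^ 3) + e sigma4 * (g y * (1 / u_q y) ^ 4) + e sigma5 * (g y * (1 / u_q y) ^ 5)"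
      unfolding e_def y(2) .
  qed
  thus ?thesis by (simp only: U_q_add U_q_cmult)
qed

text \<open>\<open>U_q_u_expand\<close> applied to g u^n lowers the exponent by 1 to 5. Exponents
  that become negative are served by \<open>N\<close>.\<close>

lemma U_q_ut_rec:
  assumes N: "\<And>x. x \<in> punctured_disc \<Longrightarrow> U_q (\<lambda>y. g y * (1 / u_q y) ^ 1) x = eval_ut5 x (N ! 0)"
      "\<And>x. x \<in> punctured_disc \<Longrightarrow> U_q (\<lambda>y. g y * (1 / u_q y) ^ 2) x = eval_ut5 x (N ! 1)"
      "\<And>x. x \<in> punctured_disc \<Longrightarrow> U_q (\<lambda>y. g y * (1 / u_q y) ^ 3) x = eval_ut5 x (N ! 2)"
      "\<And>x. x \<in> punctured_disc \<Longrightarrow> U_q (\<lambda>y. g y * (1 / u_q y) ^ 4) x = eval_ut5 x (N ! 3)"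
    and D0: "\<And>x. x \<in> punctured_disc \<Longrightarrow> U_q g x = eval_ut5 x (D 0)"
    and D1: "D 1 = ut_mult sigma2 (N ! 0) + ut_mult sigma3 (N ! 1) + ut_mult sigma4 (N ! 2) + ut_mult sigma5 (N ! 3)"
    and D2: "D 2 = ut_mult sigma3 (N ! 0) + ut_mult sigma4 (N ! 1) + ut_mult sigma5 (N ! 2)"
    and D3: "D 3 = ut_mult sigma4 (N ! 0) + ut_mult sigma5 (N ! 1)"
    and D4: "D 4 = ut_mult sigma5 (N ! 0)"
    and x: "x \<in> punctured_disc"
  shows "U_q (\<lambda>y. g y * u_q y ^ n) x = eval_ut5 x (ut_rec D n)"
proof -
  define u t where "u = u_q (x ^ 5)" and "t = t_q (x ^ 5)"
  define X where "X = (\<lambda>n. U_q (\<lambda>y. g y * u_q y ^ n) x)"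
  note mult = eval_ut_mult[OF level_10_ring(7)[OF power_punctured_disc[OF x zero_less_numeral[of "num.Bit1 (num.Bit0 num.One)"]]], folded u_def t_def]
  have N': "U_q (\<lambda>y. g y * (1 / u_q y) ^ 1) x = eval_ut u t (N ! 0)" "U_q (\<lambda>y. g y * (1 / u_q y) ^ 2) x = eval_ut u t (N ! 1)"
    "U_q (\<lambda>y. g y * (1 / u_q y) ^ 3) x = eval_ut u t (N ! 2)" "U_q (\<lambda>y. g y * (1 / u_q y) ^ 4) x = eval_ut u t (N ! 3)"
    unfolding u_def t_def by (rule N[OF x])+
  have low: "U_q (\<lambda>y. g y * u_q y ^ n * (1 / u_q y) ^ k) x = X (n - k)" if "k \<le> n" for n k
    unfolding X_def
  proof (rule U_q_cong[OF x])
    fix y assume "y \<in> punctured_disc"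
    thus "g y * u_q y ^ n * (1 / u_q y) ^ k = g y * u_q y ^ (n - k)"
      using u_q_nonzero[of y] that by (simp add: power_diff power_divide)
  qed
  have high: "U_q (\<lambda>y. g y * u_q y ^ n * (1 / u_q y) ^ k) x = U_q (\<lambda>y. g y * (1 / u_q y) ^ (k - n)) x" if "n \<le> k" for n k
  proof (rule U_q_cong[OF x])
    fix y assume "y \<in> punctured_disc"
    thus "g y * u_q y ^ n * (1 / u_q y) ^ k = g y * (1 / u_q y) ^ (k - n)"
      using u_q_nonzero[of y] that by (simp add: power_diff power_divide)
  qed
  have rec: "X n = eval_mult u t sigma1 * U_q (\<lambda>y. g y * u_q y ^ n * (1 / u_q y) ^ 1) x + eval_mult u t sigma2 * U_q (\<lambda>y. g y * u_q y ^ n * (1 / u_q y) ^ 2) x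
     + eval_mult u t sigma3 * U_q (\<lambda>y. g y * u_q y ^ n * (1 / u_q y) ^ 3) x + eval_mult u t sigma4 * U_q (\<lambda>y. g y * u_q y ^ n * (1 / u_q y) ^ 4) x
     + eval_mult u t sigma5 * U_q (\<lambda>y. g y * u_q y ^ n * (1 / u_q y) ^ 5) x" for n
    unfolding X_def u_def t_def by (rule U_q_u_expand[OF x])
  have "X n = eval_ut u t (ut_rec D n)" for n
  proof (induction n rule: less_induct)
    case (less n)
    have "n = 0 \<or> n = 1 \<or> n = 2 \<or> n = 3 \<or> n = 4 \<or> n = (n - 5) + 5" by linarith
    then consider "n = 0" | "n = 1" | "n = 2" | "n = 3" | "n = 4" | k where "n = k + 5" by blast
    thus ?case
    proof cases
      case 1
      thus ?thesis using D0[OF x] by (simp add: X_def u_def t_def)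
    next
      case 2
      have X: "X 1 = eval_mult u t sigma1 * X 0 + eval_mult u t sigma2 * eval_ut u t (N ! 0) + eval_mult u t sigma3 * eval_ut u t (N ! 1)
         + eval_mult u t sigma4 * eval_ut u t (N ! 2) + eval_mult u t sigma5 * eval_ut u t (N ! 3)"
        using rec[of 1] low[of 1 1] high[of 1 2] high[of 1 3] high[of 1 4] high[of 1 5] N' by simp
      have i0: "X (0) = eval_ut u t (ut_rec D (0))" by (rule less.IH) (simp add: 2)
      show ?thesis unfolding 2 ut_rec_numeral(1) eval_ut_add mult D1
        by (simp only: X i0 add.assoc)
    next
      case 3
      have X: "X 2 = eval_mult u t sigma1 * X 1 + eval_mult u t sigma2 * X 0 + eval_mult u t sigma3 * eval_ut u t (N ! 0)
         + eval_mult u t sigma4 * eval_ut u t (N ! 1) + eval_mult u t sigma5 * eval_ut u t (N ! 2)"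
        using rec[of 2] low[of 1 2] low[of 2 2] high[of 2 3] high[of 2 4] high[of 2 5] N' by simp
      have i0: "X (0) = eval_ut u t (ut_rec D (0))" by (rule less.IH) (simp add: 3)
      have i1: "X (1) = eval_ut u t (ut_rec D (1))" by (rule less.IH) (simp add: 3)
      show ?thesis unfolding 3 ut_rec_numeral(2) eval_ut_add mult D2
        by (simp only: X i0 i1 add.assoc)
    next
      case 4
      have X: "X 3 = eval_mult u t sigma1 * X 2 + eval_mult u t sigma2 * X 1 + eval_mult u t sigma3 * X 0
         + eval_mult u t sigma4 * eval_ut u t (N ! 0) + eval_mult u t sigma5 * eval_ut u t (N ! 1)"
        using rec[of 3] low[of 1 3] low[of 2 3] low[of 3 3] high[of 3 4] high[of 3 5] N' by simp
      have i0: "X (0) = eval_ut u t (ut_rec D (0))" by (rule less.IH) (simp add: 4)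
      have i1: "X (1) = eval_ut u t (ut_rec D (1))" by (rule less.IH) (simp add: 4)
      have i2: "X (2) = eval_ut u t (ut_rec D (2))" by (rule less.IH) (simp add: 4)
      show ?thesis unfolding 4 ut_rec_numeral(3) eval_ut_add mult D3
        by (simp only: X i0 i1 i2 add.assoc)
    next
      case 5
      have X: "X 4 = eval_mult u t sigma1 * X 3 + eval_mult u t sigma2 * X 2 + eval_mult u t sigma3 * X 1
         + eval_mult u t sigma4 * X 0 + eval_mult u t sigma5 * eval_ut u t (N ! 0)"
        using rec[of 4] low[of 1 4] low[of 2 4] low[of 3 4] low[of 4 4] high[of 4 5] N' by simp
      have i0: "X (0) = eval_ut u t (ut_rec D (0))" by (rule less.IH) (simp add: 5)
      have i1: "X (1) = eval_ut u t (ut_rec D (1))" by (rule less.IH) (simp add: 5)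
      have i2: "X (2) = eval_ut u t (ut_rec D (2))" by (rule less.IH) (simp add: 5)
      have i3: "X (3) = eval_ut u t (ut_rec D (3))" by (rule less.IH) (simp add: 5)
      show ?thesis unfolding 5 ut_rec_numeral(4) eval_ut_add mult D4
        by (simp only: X i0 i1 i2 i3 add.assoc)
    next
      case (6 k)
      have X: "X (k + 5) = eval_mult u t sigma1 * X (k + 4) + eval_mult u t sigma2 * X (k + 3) + eval_mult u t sigma3 * X (k + 2)
         + eval_mult u t sigma4 * X (k + 1) + eval_mult u t sigma5 * X k"
        using rec[of "k + 5"] low[of 1 "k + 5"] low[of 2 "k + 5"] low[of 3 "k + 5"] low[of 4 "k + 5"] low[of 5 "k + 5"] by (simp add: add.commute[of k])
      have i0: "X (k) = eval_ut u t (ut_rec D (k))" by (rule less.IH) (simp add: 6)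
      have i1: "X (k + 1) = eval_ut u t (ut_rec D (k + 1))" by (rule less.IH) (simp add: 6)
      have i2: "X (k + 2) = eval_ut u t (ut_rec D (k + 2))" by (rule less.IH) (simp add: 6)
      have i3: "X (k + 3) = eval_ut u t (ut_rec D (k + 3))" by (rule less.IH) (simp add: 6)
      have i4: "X (k + 4) = eval_ut u t (ut_rec D (k + 4))" by (rule less.IH) (simp add: 6)
      show ?thesis unfolding 6 ut_rec_numeral(5) eval_ut_add mult
        by (simp only: X i0 i1 i2 i3 i4 add.assoc)
    qed
  qed
  thus ?thesis by (simp add: X_def u_def t_def)
qed

definition D1_data :: "ut_poly list" where
  "D1_data = [([:1:], 0),
   ([:0, - 900, - 91700, - 2510000, - 24812500, - 80000000:], [:0, - 24, - 8500, - 348000, - 4287500, - 15937500:]),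
   ([:0, - 381, - 57900, - 1755000, - 18150000, - 60000000:], [:0, - 3, - 5295, - 244125, - 3150000, - 12000000:]),
   ([:0, - 64, - 12450, - 410250, - 4425000, - 15000000:], [:0, 0, - 1080, - 56250, - 765000, - 3000000:]),
   ([:0, - 4, - 905, - 32000, - 359375, - 1250000:], [:0, 0, - 75, - 4325, - 61875, - 250000:])]"

definition Dz_data :: "ut_poly list" where
  "Dz_data = [([:0, - 60, - 1125, - 7500, - 15625:], [:0, 11, 475, 7000, 40625, 78125:]),
   ([:0, - 420, - 73200, - 2288125, - 24000000, - 80000000:], [:0, 6, - 6485, - 316375, - 4159375, - 16000000:]),
   ([:0, - 225, - 47425, - 1605000, - 17550000, - 60000000:], [:0, 1, - 4035, - 219000, - 3030000, - 12000000:]),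
   ([:0, - 44, - 10400, - 375750, - 4275000, - 15000000:], [:0, 0, - 850, - 50550, - 735000, - 3000000:]),
   ([:0, - 3, - 770, - 29375, - 346875, - 1250000:], [:0, 0, - 61, - 3900, - 59375, - 250000:])]"

definition DA_data :: "ut_poly list" where
  "DA_data = [([:0, 8672, 3277600, 295664000, 10852800000, 195776000000, 1840000000000, 8640000000000, 16000000000000:], [:0, 149, 193824, 28016000, 1343680000, 28940800000, 309120000000, 1600000000000, 3200000000000:]),
   ([:0, 3174, 2238265, 244077750, 9744400625, 184024000000, 1779600000000, 8520000000000, 16000000000000:], [:0, 28, 111573, 22049150, 1185037125, 26996796875, 298000000000, 1576000000000, 3200000000000:]),
   ([:0, 628, 640405, 78069700, 3312550000, 65022000000, 645600000000, 3150000000000, 6000000000000:], [:0, 1, 29111, 6827460, 396926000, 9471600000, 107760000000, 582000000000, 1200000000000:]),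
   ([:0, 78, 87158, 11356450, 504597500, 10235750000, 104125000000, 517500000000, 1000000000000:], [:0, 0, 3804, 970670, 59721500, 1481350000, 17325000000, 95500000000, 200000000000:]),
   ([:0, 4, 4619, 630000, 29028125, 605687500, 6300000000, 31875000000, 62500000000:], [:0, 0, 197, 52935, 3400125, 87137500, 1045000000, 5875000000, 12500000000:])]"

definition DAt_data :: "ut_poly list" where
  "DAt_data = [([:1, 256, 6080, 32000:], [:0, 23, 960, 6400:]),
   ([:0, - 86, - 20430, - 586250, - 5438750, - 16000000:], [:0, - 2, - 2042, - 85550, - 965000, - 3206250:]),
   ([:0, - 118, - 16715, - 447175, - 4080000, - 12000000:], [:0, - 1, - 1621, - 64550, - 720125, - 2400000:]),
   ([:0, - 26, - 4096, - 111500, - 1020000, - 3000000:], [:0, 0, - 388, - 16060, - 180000, - 600000:]),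
   ([:0, - 2, - 332, - 9225, - 85000, - 250000:], [:0, 0, - 31, - 1325, - 15000, - 50000:])]"

lemma U_q_u_power_1:
  assumes x: "x \<in> punctured_disc"
  shows "U_q (\<lambda>y. 1 * u_q y ^ n) x = eval_ut5 x (ut_rec ((!) D1_data) n)"
proof (rule U_q_ut_rec[OF U_q_neg_1 _ _ _ _ _ x])
  fix x :: complex assume x: "x \<in> punctured_disc"
  show "U_q (\<lambda>y. 1) x = eval_ut5 x (D1_data ! 0)"
    by (simp add: U_q_def D1_data_def eval_ut_def)
qed (simp_all add: N1_data_def D1_data_def ut_mult_def sigma2_def sigma3_def sigma4_def sigma5_def)

text \<open>The initial value is obtained from \<open>U_q_u_expand\<close> at exponent 0, which
  involves five negative powers; hence the fifth entry of \<open>Nz_data\<close>, and likewise of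
  \<open>NA_data\<close>.\<close>

lemma U_q_u_power_z:
  assumes x: "x \<in> punctured_disc"
  shows "U_q (\<lambda>y. (u_q y * t_q y) * u_q y ^ n) x = eval_ut5 x (ut_rec ((!) Dz_data) n)"
proof (rule U_q_ut_rec[OF U_q_neg_z(1-4) _ _ _ _ _ x])
  fix x :: complex assume x: "x \<in> punctured_disc"
  have "U_q (\<lambda>y. (u_q y * t_q y)) x = eval_ut5 x (ut_mult sigma1 (Nz_data ! 0) + ut_mult sigma2 (Nz_data ! 1) + ut_mult sigma3 (Nz_data ! 2) + ut_mult sigma4 (Nz_data ! 3) + ut_mult sigma5 (Nz_data ! 4))"
    unfolding eval_ut_add eval_ut_mult[OF level_10_ring(7)[OF power_punctured_disc[OF x zero_less_numeral]]] U_q_neg_z[OF x, symmetric] by (rule U_q_u_expand[OF x])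
  also have "ut_mult sigma1 (Nz_data ! 0) + ut_mult sigma2 (Nz_data ! 1) + ut_mult sigma3 (Nz_data ! 2) + ut_mult sigma4 (Nz_data ! 3) + ut_mult sigma5 (Nz_data ! 4) = Dz_data ! 0"
    by (simp add: Nz_data_def Dz_data_def ut_mult_def sigma1_def sigma2_def sigma3_def sigma4_def sigma5_def)
  finally show "U_q (\<lambda>y. (u_q y * t_q y)) x = eval_ut5 x (Dz_data ! 0)" .
qed (simp_all add: Nz_data_def Dz_data_def ut_mult_def sigma2_def sigma3_def sigma4_def sigma5_def)

lemma U_q_u_power_A:
  assumes x: "x \<in> punctured_disc"
  shows "U_q (\<lambda>y. A_q y * u_q y ^ n) x = eval_ut5 x (ut_rec ((!) DA_data) n)"
proof (rule U_q_ut_rec[OF U_q_neg_A(1-4) _ _ _ _ _ x])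
  fix x :: complex assume x: "x \<in> punctured_disc"
  have "U_q (\<lambda>y. A_q y) x = eval_ut5 x (ut_mult sigma1 (NA_data ! 0) + ut_mult sigma2 (NA_data ! 1) + ut_mult sigma3 (NA_data ! 2) + ut_mult sigma4 (NA_data ! 3) + ut_mult sigma5 (NA_data ! 4))"
    unfolding eval_ut_add eval_ut_mult[OF level_10_ring(7)[OF power_punctured_disc[OF x zero_less_numeral]]] U_q_neg_A[OF x, symmetric] by (rule U_q_u_expand[OF x])
  also have "ut_mult sigma1 (NA_data ! 0) + ut_mult sigma2 (NA_data ! 1) + ut_mult sigma3 (NA_data ! 2) + ut_mult sigma4 (NA_data ! 3) + ut_mult sigma5 (NA_data ! 4) = DA_data ! 0"
    by (simp add: NA_data_def DA_data_def ut_mult_def sigma1_def sigma2_def sigma3_def sigma4_def sigma5_def)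
  finally show "U_q (\<lambda>y. A_q y) x = eval_ut5 x (DA_data ! 0)" .
qed (simp_all add: NA_data_def DA_data_def ut_mult_def sigma2_def sigma3_def sigma4_def sigma5_def)

lemma U_q_u_power_At:
  assumes x: "x \<in> punctured_disc"
  shows "U_q (\<lambda>y. (A_q y * t_q y) * u_q y ^ n) x = eval_ut5 x (ut_rec ((!) DAt_data) n)"
proof (rule U_q_ut_rec[OF U_q_neg_At _ _ _ _ _ x])
  fix x :: complex assume x: "x \<in> punctured_disc"
  show "U_q (\<lambda>y. (A_q y * t_q y)) x = eval_ut5 x (DAt_data ! 0)"
    using U_q_W_base(3)[OF x, of 0] by (simp add: DAt_data_def)
qed (simp_all add: NAt_data_def DAt_data_def ut_mult_def sigma2_def sigma3_def sigma4_def sigma5_def)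

section \<open>Divisibility by powers of \<open>5\<close>\<close>

definition dvd_coeffs :: "(nat \<Rightarrow> nat) \<Rightarrow> int poly \<Rightarrow> bool" where
  "dvd_coeffs f p \<longleftrightarrow> (\<forall>j. 5 ^ f j dvd coeff p j)"

lemma dvd_coeffs_0 [simp]: "dvd_coeffs f 0"
  by (simp add: dvd_coeffs_def)

lemma dvd_coeffs_pCons [simp]:
  "dvd_coeffs f (pCons a p) \<longleftrightarrow> 5 ^ f 0 dvd a \<and> dvd_coeffs (\<lambda>j. f (Suc j)) p"
proof
  assume *: "dvd_coeffs f (pCons a p)"
  show "5 ^ f 0 dvd a \<and> dvd_coeffs (\<lambda>j. f (Suc j)) p"
    unfolding dvd_coeffs_def
  proof (intro conjI allI)
    show "5 ^ f 0 dvd a" using *[unfolded dvd_coeffs_def, rule_format, of 0] by simp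
    show "5 ^ f (Suc j) dvd coeff p j" for j using *[unfolded dvd_coeffs_def, rule_format, of "Suc j"] by simp
  qed
qed (auto simp: dvd_coeffs_def coeff_pCons split: nat.splits)

lemma dvd_coeffs_add: "dvd_coeffs f p \<Longrightarrow> dvd_coeffs f q \<Longrightarrow> dvd_coeffs f (p + q)"
  by (simp add: dvd_coeffs_def)

lemma dvd_coeffs_diff: "dvd_coeffs f p \<Longrightarrow> dvd_coeffs f q \<Longrightarrow> dvd_coeffs f (p - q)"
  by (simp add: dvd_coeffs_def)

lemma dvd_coeffs_smult: "dvd_coeffs f p \<Longrightarrow> dvd_coeffs f (smult c p)"
  by (simp add: dvd_coeffs_def)

lemma dvd_coeffs_mono:
  assumes "dvd_coeffs f p" "\<And>j. g j \<le> f j"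
  shows "dvd_coeffs g p"
  using assms by (meson dvd_coeffs_def dvd_trans le_imp_power_dvd)

lemma dvd_coeffs_power_smult:
  assumes "dvd_coeffs f p" "\<And>j. g j \<le> e + f j"
  shows "dvd_coeffs g (smult (5 ^ e) p)"
  unfolding dvd_coeffs_def
proof
  fix j
  have "(5::int) ^ g j dvd 5 ^ (e + f j)" by (rule le_imp_power_dvd[OF assms(2)])
  also have "\<dots> dvd 5 ^ e * coeff p j" using assms(1) by (simp add: dvd_coeffs_def power_add mult_dvd_mono)
  finally show "5 ^ g j dvd coeff (smult (5 ^ e) p) j" by simp
qed

lemma dvd_coeffs_mult:
  assumes "dvd_coeffs f p" "dvd_coeffs g q" "\<And>i j. h (i + j) \<le> f i + g j"
  shows "dvd_coeffs h (p * q)"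
  unfolding dvd_coeffs_def coeff_mult
proof (intro allI dvd_sum)
  fix n i :: nat assume "i \<in> {..n}"
  hence "5 ^ h n dvd (5 ^ (f i + g (n - i)) :: int)"
    using assms(3)[of i "n - i"] by (intro le_imp_power_dvd) simp
  also have "\<dots> dvd coeff p i * coeff q (n - i)"
    unfolding power_add using assms(1,2) by (intro mult_dvd_mono) (auto simp: dvd_coeffs_def)
  finally show "5 ^ h n dvd coeff p i * coeff q (n - i)" .
qed

text \<open>The number c is the 5-adic loss caused by a multiplier s + u s' t. The part s' is
  bounded both plain and shifted by u, because it enters \<open>ut_mult\<close> in both
  ways.\<close>

definition mult_bounded :: "nat \<Rightarrow> int poly \<times> int poly \<Rightarrow> bool" where
  "mult_bounded c S \<longleftrightarrow> dvd_coeffs (\<lambda>j. j - c) (fst S) \<and> dvd_coeffs (\<lambda>j. j - c) (snd S) \<and>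
     dvd_coeffs (\<lambda>j. j - c) (pCons 0 (snd S)) \<and> degree (fst S) \<le> 5 \<and> degree (snd S) \<le> 4 \<and> coeff (fst S) 0 = 0"

definition ut_bounded :: "nat \<Rightarrow> nat \<Rightarrow> ut_poly \<Rightarrow> bool" where
  "ut_bounded m n P \<longleftrightarrow> dvd_coeffs (\<lambda>j. j - m) (fst P) \<and> dvd_coeffs (\<lambda>j. j - m) (snd P) \<and>
     degree (fst P) \<le> n \<and> degree (snd P) \<le> n \<and> coeff (snd P) 0 = 0"

text \<open>Losses add under multiplication, since i + j - (c + m) <= (i - c) + (j - m) holds for
  truncated subtraction.\<close>

lemma ut_bounded_mult:
  assumes S: "mult_bounded c S" and P: "ut_bounded m n P" and mn: "c + m \<le> m'" "n + 5 \<le> n'"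
  shows "ut_bounded m' n' (ut_mult S P) \<and> coeff (fst (ut_mult S P)) 0 = 0"
proof -
  have dv: "dvd_coeffs (\<lambda>j. j - m') (a * b)" if "dvd_coeffs (\<lambda>j. j - c) a" "dvd_coeffs (\<lambda>j. j - m) b" for a b
    by (rule dvd_coeffs_mult[OF that]) (use mn in linarith)
  have deg: "degree (a * b) \<le> n'" if "degree a \<le> 5" "degree b \<le> n" for a b :: "int poly"
    using degree_mult_le[of a b] that mn by linarith
  have pC: "pCons 0 (snd S * r) = pCons 0 (snd S) * r" for r by simp
  have d5: "degree (pCons 0 (snd S)) \<le> 5" "degree (snd S) \<le> 5" using S by (auto simp: mult_bounded_def degree_pCons_eq_if)
  have r: "degree (fst P - smult 5 (snd P)) \<le> n" "dvd_coeffs (\<lambda>j. j - m) (fst P - smult 5 (snd P))"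
    using P by (auto simp: ut_bounded_def intro!: degree_diff_le dvd_coeffs_diff dvd_coeffs_smult order_trans[OF degree_smult_le])
  show ?thesis
    unfolding ut_bounded_def ut_mult_def fst_conv snd_conv pC
  proof (intro conjI)
    show "dvd_coeffs (\<lambda>j. j - m') (fst S * fst P + snd S * snd P)"
      "dvd_coeffs (\<lambda>j. j - m') (fst S * snd P + pCons 0 (snd S) * (fst P - smult 5 (snd P)))"
      using S P r by (auto simp: mult_bounded_def ut_bounded_def simp del: mult_pCons_left intro!: dvd_coeffs_add dv)
    show "degree (fst S * fst P + snd S * snd P) \<le> n'"
      "degree (fst S * snd P + pCons 0 (snd S) * (fst P - smult 5 (snd P))) \<le> n'"
      using S P r d5 by (auto simp: mult_bounded_def ut_bounded_def simp del: mult_pCons_left intro!: degree_add_le deg)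
    show "coeff (fst S * snd P + pCons 0 (snd S) * (fst P - smult 5 (snd P))) 0 = 0"
      "coeff (fst S * fst P + snd S * snd P) 0 = 0"
      using S P by (simp_all add: mult_bounded_def ut_bounded_def coeff_mult_0)
  qed
qed

lemma ut_bounded_add: "ut_bounded m n P \<Longrightarrow> ut_bounded m n Q \<Longrightarrow> ut_bounded m n (P + Q)"
  by (auto simp: ut_bounded_def intro!: dvd_coeffs_add degree_add_le)

lemma ut_bounded_mono: "ut_bounded m n P \<Longrightarrow> m \<le> m' \<Longrightarrow> n \<le> n' \<Longrightarrow> ut_bounded m' n' P"
  by (auto simp: ut_bounded_def elim!: dvd_coeffs_mono)

text \<open>Only \<open>sigma5\<close> causes a loss, as its coefficient of u is 1. It reaches back
  five steps, so the recurrence loses one power of 5 per five steps; this is the term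
  \<open>n div 5\<close> in \<open>ut_rec_bounded\<close>.\<close>

lemma mult_bounded_sigma:
  "mult_bounded 0 sigma1" "mult_bounded 0 sigma2" "mult_bounded 0 sigma3" "mult_bounded 0 sigma4" "mult_bounded 1 sigma5"
  by (simp_all add: mult_bounded_def sigma1_def sigma2_def sigma3_def sigma4_def sigma5_def)

definition ut_vanishing :: "nat \<Rightarrow> nat \<Rightarrow> ut_poly \<Rightarrow> bool" where
  "ut_vanishing m n P \<longleftrightarrow> ut_bounded m n P \<and> coeff (fst P) 0 = 0"

lemma ut_vanishing_mult:
  assumes "mult_bounded c S" "ut_bounded m n P" "c + m \<le> m'" "n + 5 \<le> n'"
  shows "ut_vanishing m' n' (ut_mult S P)"
  using ut_bounded_mult[OF assms] by (simp add: ut_vanishing_def)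

lemma ut_vanishing_add: "ut_vanishing m n P \<Longrightarrow> ut_vanishing m n Q \<Longrightarrow> ut_vanishing m n (P + Q)"
  by (simp add: ut_vanishing_def ut_bounded_add)

text \<open>The offset 2 is the loss of the initial data, and c is the degree of the starting value;
  every sigma raises the degree by at most 5.\<close>

lemma ut_rec_bounded:
  assumes D0: "ut_bounded 2 c (D 0)"
    and D: "\<And>k. 0 < k \<Longrightarrow> k < 5 \<Longrightarrow> ut_vanishing 2 (5 * k + c) (D k)"
  shows "ut_bounded (n div 5 + 2) (5 * n + c) (ut_rec D n)"
    and "n > 0 \<Longrightarrow> ut_vanishing (n div 5 + 2) (5 * n + c) (ut_rec D n)"
proof -
  have "ut_bounded (n div 5 + 2) (5 * n + c) (ut_rec D n) \<and> (n > 0 \<longrightarrow> ut_vanishing (n div 5 + 2) (5 * n + c) (ut_rec D n))"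
  proof (induction n rule: less_induct)
    case (less n)
    have IH: "ut_bounded (k div 5 + 2) (5 * k + c) (ut_rec D k)" if "k < n" for k using less that by blast
    have *: "ut_vanishing (n div 5 + 2) (5 * n + c) (ut_mult S (ut_rec D k))"
      if "mult_bounded 0 S" "k < n" for S k
      by (rule ut_vanishing_mult[OF that(1) IH[OF that(2)]]) (use that(2) div_le_mono[of k n 5] in auto)
    have Dn: "ut_vanishing (n div 5 + 2) (5 * n + c) (D n)" if "0 < n" "n < 5"
      using D[OF that] that by (simp add: numeral_2_eq_2)
    have "n = 0 \<or> n = 1 \<or> n = 2 \<or> n = 3 \<or> n = 4 \<or> n = (n - 5) + 5" by linarith
    then consider "n = 0" | "n = 1" | "n = 2" | "n = 3" | "n = 4" | k where "n = k + 5" by blast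
    hence "n = 0 \<or> ut_vanishing (n div 5 + 2) (5 * n + c) (ut_rec D n)"
    proof cases
      case 2
      have eq: "ut_rec D n = ut_mult sigma1 (ut_rec D 0) + D n"
        unfolding 2 by (rule ut_rec_numeral)
      show ?thesis unfolding eq
        by (intro disjI2 ut_vanishing_add * Dn mult_bounded_sigma) (simp_all add: 2)
    next
      case 3
      have eq: "ut_rec D n = ut_mult sigma1 (ut_rec D 1) + ut_mult sigma2 (ut_rec D 0) + D n"
        unfolding 3 by (rule ut_rec_numeral)
      show ?thesis unfolding eq
        by (intro disjI2 ut_vanishing_add * Dn mult_bounded_sigma) (simp_all add: 3)
    next
      case 4
      have eq: "ut_rec D n = ut_mult sigma1 (ut_rec D 2) + ut_mult sigma2 (ut_rec D 1) + ut_mult sigma3 (ut_rec D 0) + D n"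
        unfolding 4 by (rule ut_rec_numeral)
      show ?thesis unfolding eq
        by (intro disjI2 ut_vanishing_add * Dn mult_bounded_sigma) (simp_all add: 4)
    next
      case 5
      have eq: "ut_rec D n = ut_mult sigma1 (ut_rec D 3) + ut_mult sigma2 (ut_rec D 2) + ut_mult sigma3 (ut_rec D 1) + ut_mult sigma4 (ut_rec D 0) + D n"
        unfolding 5 by (rule ut_rec_numeral)
      show ?thesis unfolding eq
        by (intro disjI2 ut_vanishing_add * Dn mult_bounded_sigma) (simp_all add: 5)
    next
      case (6 k)
      have eq: "ut_rec D n = ut_mult sigma1 (ut_rec D (k + 4)) + ut_mult sigma2 (ut_rec D (k + 3)) + ut_mult sigma3 (ut_rec D (k + 2))
          + ut_mult sigma4 (ut_rec D (k + 1)) + ut_mult sigma5 (ut_rec D k)"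
        unfolding 6 by (rule ut_rec_numeral)
      have "ut_vanishing (n div 5 + 2) (5 * n + c) (ut_mult sigma5 (ut_rec D k))"
        by (rule ut_vanishing_mult[OF mult_bounded_sigma(5) IH[of k]]) (simp_all add: 6)
      thus ?thesis unfolding eq
        by (intro disjI2 ut_vanishing_add *[of sigma1] *[of sigma2] *[of sigma3] *[of sigma4] mult_bounded_sigma) (simp_all add: 6)
    qed simp
    thus ?case using D0 by (auto simp: ut_vanishing_def numeral_2_eq_2)
  qed
  thus "ut_bounded (n div 5 + 2) (5 * n + c) (ut_rec D n)"
    "n > 0 \<Longrightarrow> ut_vanishing (n div 5 + 2) (5 * n + c) (ut_rec D n)" by blast+
qed

lemma data_bounded:
  "ut_bounded 2 0 (D1_data ! 0)" "\<And>k. 0 < k \<Longrightarrow> k < 5 \<Longrightarrow> ut_vanishing 2 (5 * k + 0) (D1_data ! k)"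
  "ut_bounded 2 5 (Dz_data ! 0)" "coeff (fst (Dz_data ! 0)) 0 = 0" "\<And>k. 0 < k \<Longrightarrow> k < 5 \<Longrightarrow> ut_vanishing 2 (5 * k + 5) (Dz_data ! k)"
  "ut_bounded 2 8 (DA_data ! 0)" "\<And>k. 0 < k \<Longrightarrow> k < 5 \<Longrightarrow> ut_vanishing 2 (5 * k + 8) (DA_data ! k)"
  "ut_bounded 2 8 (DAt_data ! 0)" "\<And>k. 0 < k \<Longrightarrow> k < 5 \<Longrightarrow> ut_vanishing 2 (5 * k + 8) (DAt_data ! k)"
proof -
  have c: "k = 1 \<or> k = 2 \<or> k = 3 \<or> k = 4" if "0 < k" "k < 5" for k :: nat using that by linarith
  show "ut_bounded 2 0 (D1_data ! 0)" "ut_bounded 2 5 (Dz_data ! 0)" "coeff (fst (Dz_data ! 0)) 0 = 0"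
    "ut_bounded 2 8 (DA_data ! 0)" "ut_bounded 2 8 (DAt_data ! 0)"
    by (simp_all add: ut_bounded_def D1_data_def Dz_data_def DA_data_def DAt_data_def)
  show "ut_vanishing 2 (5 * k + 0) (D1_data ! k)" "ut_vanishing 2 (5 * k + 5) (Dz_data ! k)"
    "ut_vanishing 2 (5 * k + 8) (DA_data ! k)" "ut_vanishing 2 (5 * k + 8) (DAt_data ! k)" if "0 < k" "k < 5" for k
    using c[OF that] by (elim disjE; simp add: ut_vanishing_def ut_bounded_def D1_data_def Dz_data_def DA_data_def DAt_data_def)+
qed

section \<open>Leading forms and 5-adic weights\<close>

definition ut_form :: "ut_poly \<Rightarrow> (nat \<Rightarrow> nat) \<Rightarrow> (nat \<Rightarrow> nat) \<Rightarrow> ut_poly \<Rightarrow> bool" where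
  "ut_form v f g P \<longleftrightarrow> (\<exists>a R. P = ut_scale a v + R \<and> dvd_coeffs f (fst R) \<and> dvd_coeffs g (snd R))"

lemma ut_formI: "P = ut_scale a v + R \<Longrightarrow> dvd_coeffs f (fst R) \<Longrightarrow> dvd_coeffs g (snd R) \<Longrightarrow> ut_form v f g P"
  unfolding ut_form_def by blast

lemma ut_form_dvd: "dvd_coeffs f (fst P) \<Longrightarrow> dvd_coeffs g (snd P) \<Longrightarrow> ut_form v f g P"
  by (rule ut_formI[of _ 0]) (auto simp: ut_scale_def simp flip: zero_prod_def)

lemma ut_form_add:
  assumes "ut_form v f g P" "ut_form v f g Q"
  shows "ut_form v f g (P + Q)"
proof -
  obtain a R b S where "P = ut_scale a v + R" "dvd_coeffs f (fst R)" "dvd_coeffs g (snd R)"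
    "Q = ut_scale b v + S" "dvd_coeffs f (fst S)" "dvd_coeffs g (snd S)"
    using assms unfolding ut_form_def by blast
  thus ?thesis
    by (intro ut_formI[of _ "a + b" _ "R + S"]) (auto simp: ut_scale_def smult_add_left algebra_simps intro: dvd_coeffs_add)
qed

lemma ut_form_scale:
  assumes "ut_form v f g P"
  shows "ut_form v f g (ut_scale c P)"
proof -
  obtain a R where "P = ut_scale a v + R" "dvd_coeffs f (fst R)" "dvd_coeffs g (snd R)"
    using assms unfolding ut_form_def by blast
  thus ?thesis
    by (intro ut_formI[of _ "c * a" _ "ut_scale c R"]) (auto simp: ut_scale_def smult_add_right intro: dvd_coeffs_smult)
qed

lemma ut_form_sum:
  "finite A \<Longrightarrow> (\<And>i. i \<in> A \<Longrightarrow> ut_form v f g (F i)) \<Longrightarrow> ut_form v f g (\<Sum>i\<in>A. F i)"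
  by (induction A rule: finite_induct) (auto intro: ut_form_add ut_form_dvd)

text \<open>The linear map with u^i -> \<open>V i\<close> and u^i t -> \<open>W i\<close>. Starting
  at i = 1 is correct for the functions L_n with n >= 1, whose representations have no constant and
  no bare t term.\<close>

definition ut_step :: "(nat \<Rightarrow> ut_poly) \<Rightarrow> (nat \<Rightarrow> ut_poly) \<Rightarrow> nat \<Rightarrow> ut_poly \<Rightarrow> ut_poly" where
  "ut_step V W N P = (\<Sum>i\<in>{1..N}. ut_scale (coeff (fst P) i) (V i) + ut_scale (coeff (snd P) i) (W i))"

lemma ut_step_add: "ut_step V W N (P + Q) = ut_step V W N P + ut_step V W N Q"
  unfolding ut_step_def sum.distrib[symmetric]
  by (intro sum.cong refl) (auto simp: ut_scale_def smult_add_left algebra_simps)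

lemma ut_scale_add: "ut_scale c (P + Q) = ut_scale c P + ut_scale c Q"
  by (simp add: ut_scale_def smult_add_right)

lemma ut_scale_sum: "ut_scale c (\<Sum>i\<in>A. F i) = (\<Sum>i\<in>A. ut_scale c (F i))"
proof -
  have "ut_scale c 0 = 0" by (simp add: ut_scale_def zero_prod_def)
  thus ?thesis by (induction A rule: infinite_finite_induct) (simp_all add: ut_scale_add)
qed

lemma ut_step_scale: "ut_step V W N (ut_scale c P) = ut_scale c (ut_step V W N P)"
  unfolding ut_step_def ut_scale_sum
  by (intro sum.cong refl) (auto simp: ut_scale_def smult_add_right)

text \<open>By linearity it suffices to control the image of the leading form and those of the
  generators 5^(f i) u^i and 5^(g i) u^i t of the remainder. Multiples of v' absorb what is not
  divisible enough in these images.\<close>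

lemma ut_step_form:
  assumes P: "ut_form v f g P"
    and v: "ut_form v' f' g' (ut_step V W N v)"
    and V: "\<And>i. 1 \<le> i \<Longrightarrow> ut_form v' f' g' (ut_scale (5 ^ f i) (V i))"
    and W: "\<And>i. 1 \<le> i \<Longrightarrow> ut_form v' f' g' (ut_scale (5 ^ g i) (W i))"
  shows "ut_form v' f' g' (ut_step V W N P)"
proof -
  obtain a R where R: "P = ut_scale a v + R" "dvd_coeffs f (fst R)" "dvd_coeffs g (snd R)"
    using P unfolding ut_form_def by blast
  have scale: "ut_form v' f' g' (ut_scale c Q)" if dv: "5 ^ e dvd c" and form: "ut_form v' f' g' (ut_scale (5 ^ e) Q)" for c e Q
  proof -
    obtain k where "c = 5 ^ e * k" using dv by (elim dvdE)
    hence "ut_scale c Q = ut_scale k (ut_scale (5 ^ e) Q)" by (simp add: ut_scale_def mult.commute)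
    thus ?thesis using ut_form_scale[OF form] by simp
  qed
  have "ut_form v' f' g' (ut_step V W N R)"
    unfolding ut_step_def using R V W
    by (intro ut_form_sum ut_form_add) (auto simp: dvd_coeffs_def intro: scale)
  thus ?thesis unfolding R(1) ut_step_add ut_step_scale
    by (intro ut_form_add ut_form_scale v)
qed

lemma ut_step_quadratic:
  assumes "N \<ge> 2" "degree (fst P) \<le> 2" "degree (snd P) \<le> 2"
  shows "ut_step V W N P = ut_scale (coeff (fst P) 1) (V 1) + ut_scale (coeff (snd P) 1) (W 1)
     + ut_scale (coeff (fst P) 2) (V 2) + ut_scale (coeff (snd P) 2) (W 2)"
proof -
  have "ut_step V W N P = (\<Sum>i\<in>{1, 2}. ut_scale (coeff (fst P) i) (V i) + ut_scale (coeff (snd P) i) (W i))"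
    unfolding ut_step_def
  proof (rule sum.mono_neutral_right)
    show "\<forall>i\<in>{1..N} - {1, 2}. ut_scale (coeff (fst P) i) (V i) + ut_scale (coeff (snd P) i) (W i) = 0"
    proof
      fix i assume "i \<in> {1..N} - {1, 2}"
      hence "i > 2" by auto
      hence "coeff (fst P) i = 0" "coeff (snd P) i = 0" using assms by (auto intro!: coeff_eq_0)
      thus "ut_scale (coeff (fst P) i) (V i) + ut_scale (coeff (snd P) i) (W i) = 0" by (simp add: ut_scale_def zero_prod_def)
    qed
  qed (use assms in auto)
  thus ?thesis by (simp add: add.assoc)
qed

text \<open>
  The \<open>5\<close>-adic weights of the theorem: the coefficients of \<open>u\<^sup>i\<close> and \<open>u\<^sup>i t\<close> with \<open>i \<ge> 3\<close> are divisible
  by \<open>5 ^ (e + \<lfloor>5 i / 6\<rfloor>)\<close>, those with \<open>i \<le> 2\<close>, up to a leading form, by \<open>5 ^ (e + 1)\<close>.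
\<close>

definition weight :: "nat \<Rightarrow> nat \<Rightarrow> nat" where
  "weight e j = (if j = 0 then 0 else if j < 3 then e + 1 else e + 5 * j div 6)"

text \<open>In L_n with n = 3 modulo 4 the coefficient of u^3 t has one factor 5 less than the
  pattern predicts, 5^3 instead of 5^(2 + 2). The cause is the entry 381471625 in
  \<open>form2_A\<close>, divisible by 125 but not by 625.\<close>

definition weight3 :: "nat \<Rightarrow> nat" where
  "weight3 j = (if j = 3 then 3 else weight 2 j)"

text \<open>The reason for the exponent floor(5 i / 6): for i >= 3 it is at least the loss i div 5 +
  2, with equality at i = 3, and it satisfies 1 + floor(5 j / 6) <= j for j > 0, which yields the
  gain of one factor 5.\<close>

lemma weight_Suc_le:
  assumes "i \<ge> 3"
  shows "weight (Suc e) j \<le> weight e i + (j - (i div 5 + 2))"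
proof -
  have "i div 5 + 2 \<le> 5 * i div 6" using assms by linarith
  moreover have "j > 0 \<Longrightarrow> 1 + 5 * j div 6 \<le> j" by linarith
  ultimately show ?thesis using assms unfolding weight_def by (auto split: if_splits)
qed

lemma weight_le_Suc: "weight e j \<le> weight (Suc e) j"
  by (auto simp: weight_def)

lemma weight_le_low: "weight e j \<le> e + 1 + (j - 2)"
  by (auto simp: weight_def)

lemma weight3_le: "weight3 j \<le> weight 2 j"
  by (auto simp: weight3_def weight_def)

lemma ut_form_weight:
  assumes P: "ut_bounded m n P" and f: "\<And>j. f j \<le> e + (j - m)" and g: "\<And>j. g j \<le> e + (j - m)"
  shows "ut_form v f g (ut_scale (5 ^ e) P)"
  using P by (intro ut_form_dvd) (auto simp: ut_scale_def ut_bounded_def intro!: dvd_coeffs_power_smult[OF _ f] dvd_coeffs_power_smult[OF _ g])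

text \<open>The leading forms of L_n for n = 1, 2, 3, 4 modulo 4. The factors 5, 5 and 25 in the
  last three are measured against the prefactor 5^(2 beta) common to all four formulas.\<close>

definition form1 :: ut_poly where "form1 = ([:0, 3:], [:0, 1, 1:])"
definition form2 :: ut_poly where "form2 = (0, [:0, 5, - 5:])"
definition form3 :: ut_poly where "form3 = ([:0, 35, - 75:], [:0, - 5, 20:])"
definition form4 :: ut_poly where "form4 = ([:0, 25:], [:0, 0, - 25:])"

text \<open>
  These represent \<open>U\<^sub>5(u\<^sup>i)\<close>, \<open>U\<^sub>5(u\<^sup>i t)\<close>, \<open>U\<^sub>5(A u\<^sup>i)\<close> and \<open>U\<^sub>5(A u\<^sup>i t)\<close>; in \<open>W_U\<close> only \<open>i \<ge> 1\<close> is meaningful.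
\<close>

definition V_U :: "nat \<Rightarrow> ut_poly" where "V_U = ut_rec ((!) D1_data)"
definition W_U :: "nat \<Rightarrow> ut_poly" where "W_U i = ut_rec ((!) Dz_data) (i - 1)"
definition V_A :: "nat \<Rightarrow> ut_poly" where "V_A = ut_rec ((!) DA_data)"
definition W_A :: "nat \<Rightarrow> ut_poly" where "W_A = ut_rec ((!) DAt_data)"

lemma V_W_bounded:
  "ut_bounded (i div 5 + 2) (5 * i) (V_U i)" "i \<ge> 1 \<Longrightarrow> ut_bounded (i div 5 + 2) (5 * i) (W_U i)"
  "ut_bounded (i div 5 + 2) (5 * i + 8) (V_A i)" "ut_bounded (i div 5 + 2) (5 * i + 8) (W_A i)"
  and V_W_coeff_0: "i \<ge> 1 \<Longrightarrow> coeff (fst (V_U i)) 0 = 0" "i \<ge> 1 \<Longrightarrow> coeff (fst (W_U i)) 0 = 0"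
  "i \<ge> 1 \<Longrightarrow> coeff (fst (V_A i)) 0 = 0" "i \<ge> 1 \<Longrightarrow> coeff (fst (W_A i)) 0 = 0"
proof -
  note D = data_bounded
  note b1 = ut_rec_bounded[of 0 "(!) D1_data", OF D(1,2)]
  note bz = ut_rec_bounded[of 5 "(!) Dz_data", OF D(3,5)]
  note bA = ut_rec_bounded[of 8 "(!) DA_data", OF D(6,7)]
  note bAt = ut_rec_bounded[of 8 "(!) DAt_data", OF D(8,9)]
  show "ut_bounded (i div 5 + 2) (5 * i) (V_U i)" using b1(1)[of i] by (simp add: V_U_def)
  show "ut_bounded (i div 5 + 2) (5 * i + 8) (V_A i)" "ut_bounded (i div 5 + 2) (5 * i + 8) (W_A i)"
    using bA(1)[of i] bAt(1)[of i] by (simp_all add: V_A_def W_A_def)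
  show "ut_bounded (i div 5 + 2) (5 * i) (W_U i)" if "i \<ge> 1"
    unfolding W_U_def by (rule ut_bounded_mono[OF bz(1)]) (use that in \<open>auto simp: div_le_mono\<close>)
  show "coeff (fst (V_U i)) 0 = 0" "coeff (fst (V_A i)) 0 = 0" "coeff (fst (W_A i)) 0 = 0" if "i \<ge> 1"
    using b1(2)[of i] bA(2)[of i] bAt(2)[of i] that by (auto simp: V_U_def V_A_def W_A_def ut_vanishing_def)
  show "coeff (fst (W_U i)) 0 = 0" if "i \<ge> 1"
    using bz(2)[of "i - 1"] D(4) by (cases "i = 1") (use that in \<open>auto simp: W_U_def ut_vanishing_def\<close>)
qed

text \<open>For i >= 3 the general bound gains a factor 5 for either operator, and the result lies
  in the remainder part without any multiple of v.\<close>

lemma form_weight_tail: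
  assumes i: "i \<ge> 3" and P: "ut_bounded (i div 5 + 2) n P" and f: "\<And>j. f j \<le> weight (Suc e) j" and g: "\<And>j. g j \<le> weight (Suc e) j"
  shows "ut_form v f g (ut_scale (5 ^ weight e i) P)"
  by (rule ut_form_weight[OF P]; rule order_trans[OF f weight_Suc_le[OF i]] order_trans[OF g weight_Suc_le[OF i]])

text \<open>For i = 1, 2 the general bound only reproduces the weight. This is enough for
  \<open>U5\<close> alone; after multiplication by \<open>A\<close> a gain is required, and explicit
  values are consulted instead.\<close>

lemma form_weight_low:
  assumes i: "1 \<le> i" "i < 3" and P: "ut_bounded (i div 5 + 2) n P"
  shows "ut_form v (weight e) (weight e) (ut_scale (5 ^ weight e i) P)"
proof -
  have "i div 5 = 0" using i by simp
  with P have P': "ut_bounded 2 n P" by (simp add: numeral_2_eq_2)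
  have "weight e i = e + 1" using i by (simp add: weight_def)
  thus ?thesis using ut_form_weight[OF P', of "weight e" "e + 1" "weight e"] weight_le_low[of e] by simp
qed

section \<open>Explicit images for exponents up to 2\<close>

lemma V_U_values: "V_U 1 = ([:0, 225, 22925, 627500, 6203125, 20000000:], [:0, 6, 2125, 87000, 1071875, 3984375:])" (is ?A)
  "V_U 2 = ([:0, 434, 419225, 80549375, 5964815625, 218712812500, 4453046875000, 52720595703125, 360601318359375, 1320001220703125, 2000000000000000:], [:0, 2, 16130, 5682000, 583665625, 26505718750, 629326562500, 8375156250000, 62836767578125, 247993164062500, 399993896484375:])" (is ?B)
proof -
  show 1: ?A
    unfolding V_U_def ut_rec_numeral by (simp add: D1_data_def ut_mult_def sigma1_def)
  show ?B
    unfolding V_U_def ut_rec_numeral(2) 1[unfolded V_U_def] by (simp add: D1_data_def ut_mult_def sigma1_def sigma2_def)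
qed

lemma W_U_values: "W_U 1 = ([:0, - 60, - 1125, - 7500, - 15625:], [:0, 11, 475, 7000, 40625, 78125:])" (is ?A)
  "W_U 2 = ([:0, - 90, - 9575, - 389375, - 8468750, - 104062500, - 734375000, - 2978515625, - 6591796875, - 6103515625:], [:0, 6, 2440, 152000, 4187500, 66609375, 667187500, 4218750000, 16162109375, 34179687500, 30517578125:])" (is ?B)
proof -
  show 1: ?A
    unfolding W_U_def by (simp add: Dz_data_def)
  show ?B
    unfolding W_U_def by (simp add: Dz_data_def ut_mult_def sigma1_def)
qed

lemma V_A_values: "V_A 0 = ([:0, 8672, 3277600, 295664000, 10852800000, 195776000000, 1840000000000, 8640000000000, 16000000000000:], [:0, 149, 193824, 28016000, 1343680000, 28940800000, 309120000000, 1600000000000, 3200000000000:])" (is ?A)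
  "V_A 1 = ([:0, 7644, 19392110, 7890080750, 1168362087500, 85209875359375, 3551479600000000, 91749032000000000, 1534502400000000000, 16902000000000000000, 121713600000000000000, 551200000000000000000, 1424000000000000000000, 1600000000000000000000:], [:0, 28, 517008, 410659050, 88030965625, 8186499490625, 406471523203125, 12000545600000000, 223135360000000000, 2679792000000000000, 20742080000000000000, 99872000000000000000, 272000000000000000000, 320000000000000000000:])" (is ?B)
  "V_A 2 = ([:0, 2213, 32838410, 45424873625, 19218691600000, 3711979441765625, 397914022469531250, 26478069076474609375, 1172753998329394531250, 36174571382399658203125, 800131993455999755859375, 12914193040000000000000000, 153270802400000000000000000, 1335232640000000000000000000, 8429832000000000000000000000, 37504960000000000000000000000, 111440000000000000000000000000, 198400000000000000000000000000, 160000000000000000000000000000:], [:0, 1, 419981, 1394567975, 939986728125, 245455242090625, 32647890206421875, 2559835121300781250, 129128836223105468750, 4429647038721093750000, 107077436156801757812500, 1863895822720001220703125, 23612522080000000000000000, 217763392000000000000000000, 1445697600000000000000000000, 6726208000000000000000000000, 20803200000000000000000000000, 38400000000000000000000000000, 32000000000000000000000000000:])" (is ?C)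
proof -
  show 0: ?A
    unfolding V_A_def by (simp add: DA_data_def)
  show 1: ?B
    unfolding V_A_def ut_rec_numeral(1) 0[unfolded V_A_def] by (simp add: DA_data_def ut_mult_def sigma1_def)
  show ?C
    unfolding V_A_def ut_rec_numeral(2) 0[unfolded V_A_def] 1[unfolded V_A_def] by (simp add: DA_data_def ut_mult_def sigma1_def sigma2_def)
qed

lemma W_A_values: "W_A 1 = ([:0, 1729, 655370, 59132250, 2170562500, 39155203125, 368000000000, 1728000000000, 3200000000000:], [:0, 28, 38688, 5602350, 268731875, 5788146875, 61823984375, 320000000000, 640000000000:])" (is ?A)
  "W_A 2 = ([:0, 1472, 3853385, 1575693125, 233586412500, 17040418500000, 710281272343750, 18349737626953125, 306900353027343750, 3380400001708984375, 24342720001220703125, 110240000000000000000, 284800000000000000000, 320000000000000000000:], [:0, 4, 101684, 81896675, 17595116250, 1637062768750, 81291771250000, 2400095896093750, 44627044472656250, 535958394531250000, 4148415991210937500, 19974399993896484375, 54400000000000000000, 64000000000000000000:])" (is ?B)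
proof -
  show 1: ?A
    unfolding W_A_def ut_rec_numeral(1) by (simp add: DAt_data_def ut_mult_def sigma1_def)
  show ?B
    unfolding W_A_def ut_rec_numeral(2) 1[unfolded W_A_def] by (simp add: DAt_data_def ut_mult_def sigma1_def sigma2_def)
qed

text \<open>The argument is the image of \<open>form1\<close>. Here and below the integer witness is
  fixed by a congruence between low coefficients; here that of u t is 18 + 11 + 6 = 35 = 2 * 5 + 25.
  The second witness is the remainder.\<close>

lemma form1_U: "ut_form form2 (weight 1) (weight 1) (ut_scale 3 (V_U 1) + W_U 1 + W_U 2)"
  unfolding V_U_values W_U_values
  by (rule ut_formI[of _ "2" _ "([:0, 525, 58075, 1485625, 10125000, - 44062500, - 734375000, - 2978515625, - 6591796875, - 6103515625:], [:0, 25, 9300, 420000, 7443750, 78640625, 667187500, 4218750000, 16162109375, 34179687500, 30517578125:])"]) (simp_all add: ut_scale_def form1_def form2_def form3_def form4_def weight_def weight3_def)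

lemma form3_U: "ut_form form4 (weight 2) (weight 2) (ut_scale 35 (V_U 1) + ut_scale (- 5) (W_U 1) + ut_scale (- 75) (V_U 2) + ut_scale 20 (W_U 2))"
  unfolding V_U_values W_U_values
  by (rule ut_formI[of _ "3" _ "([:0, - 26250, - 30825375, - 6026990625, - 447313359375, - 16404842187500, - 333993203125000, - 3954104248046875, - 27045230712890625, - 99000213623046875, - 150000000000000000:], [:0, 125, - 1088875, - 420100000, - 43653859375, - 1986457656250, - 47186148437500, - 628052343750000, - 4712434326171875, - 18598803710937500, - 29998931884765625:])"]) (simp_all add: ut_scale_def form1_def form2_def form3_def form4_def weight_def weight3_def)

lemma form2_A: "ut_form form3 (weight 2) (weight3) (ut_scale 5 (W_A 1) + ut_scale (- 5) (W_A 2))"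
  unfolding W_A_values
  by (rule ut_formI[of _ "1" _ "([:0, 1250, - 15990000, - 7582804375, - 1157079250000, - 85006316484375, - 3549566361718750, - 91740048134765625, - 1534485765136718750, - 16902000008544921875, - 121713600006103515625, - 551200000000000000000, - 1424000000000000000000, - 1600000000000000000000:], [:0, 125, - 315000, - 381471625, - 86631921875, - 8156373109375, - 406149736328125, - 11998879480468750, - 223132022363281250, - 2679791972656250000, - 20742079956054687500, - 99871999969482421875, - 272000000000000000000, - 320000000000000000000:])"]) (simp_all add: ut_scale_def form1_def form2_def form3_def form4_def weight_def weight3_def)

text \<open>This closes the cycle: the image of \<open>form4\<close> is again governed by
  \<open>form1\<close>, with the factor 25.\<close>

lemma form4_A: "ut_form (ut_scale 25 form1) (weight 3) (weight 3) (ut_scale 25 (V_A 1) + ut_scale (- 25) (W_A 2))"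
  unfolding V_A_values W_A_values
  by (rule ut_formI[of _ "24" _ "([:0, 152500, 388468125, 157859690625, 23369391875000, 1704236421484375, 71029958191406250, 1834982359326171875, 30690051174316406250, 338039999957275390625, 2434271999969482421875, 11024000000000000000000, 28480000000000000000000, 32000000000000000000000:], [:0, 0, 10382500, 8219059375, 1760896234375, 163735918046875, 8129493798828125, 240011242597656250, 4462707888183593750, 53595840136718750000, 414841600219726562500, 1997440000152587890625, 5440000000000000000000, 6400000000000000000000:])"]) (simp_all add: ut_scale_def form1_def form2_def form3_def form4_def weight_def weight3_def)

text \<open>Start of the induction, since \<open>V_A 0\<close> represents L_1, the image of
  \<open>A\<close> under \<open>U5\<close>.\<close>

lemma form_V_A_0: "ut_form form1 (weight 1) (weight 1) (V_A 0)"
  unfolding V_A_values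
  by (rule ut_formI[of _ "24" _ "([:0, 8600, 3277600, 295664000, 10852800000, 195776000000, 1840000000000, 8640000000000, 16000000000000:], [:0, 125, 193800, 28016000, 1343680000, 28940800000, 309120000000, 1600000000000, 3200000000000:])"]) (simp_all add: ut_scale_def form1_def form2_def form3_def form4_def weight_def weight3_def)

text \<open>In an \<open>A\<close> step the terms with i = 1, 2 should gain a factor 5, but for
  instance 25 * 28, the coefficient of u t here, is not divisible by 125. In this lemma and the next
  seven the gain is obtained modulo the leading form of the target.\<close>

lemma form3_V_A_1: "ut_form form3 (weight 2) (weight3) (ut_scale 25 (V_A 1))"
  unfolding V_A_values
  by (rule ut_formI[of _ "10" _ "([:0, 190750, 484803500, 197252018750, 29209052187500, 2130246883984375, 88786990000000000, 2293725800000000000, 38362560000000000000, 422550000000000000000, 3042840000000000000000, 13780000000000000000000, 35600000000000000000000, 40000000000000000000000:], [:0, 750, 12925000, 10266476250, 2200774140625, 204662487265625, 10161788080078125, 300013640000000000, 5578384000000000000, 66994800000000000000, 518552000000000000000, 2496800000000000000000, 6800000000000000000000, 8000000000000000000000:])"]) (simp_all add: ut_scale_def form1_def form2_def form3_def form4_def weight_def weight3_def)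

lemma form5_V_A_1: "ut_form (ut_scale 25 form1) (weight 3) (weight 3) (ut_scale 125 (V_A 1))"
  unfolding V_A_values
  by (rule ut_formI[of _ "15" _ "([:0, 954375, 2424013750, 986260093750, 146045260937500, 10651234419921875, 443934950000000000, 11468629000000000000, 191812800000000000000, 2112750000000000000000, 15214200000000000000000, 68900000000000000000000, 178000000000000000000000, 200000000000000000000000:], [:0, 3125, 64625625, 51332381250, 11003870703125, 1023312436328125, 50808940400390625, 1500068200000000000, 27891920000000000000, 334974000000000000000, 2592760000000000000000, 12484000000000000000000, 34000000000000000000000, 40000000000000000000000:])"]) (simp_all add: ut_scale_def form1_def form2_def form3_def form4_def weight_def weight3_def)

lemma form3_V_A_2: "ut_form form3 (weight 2) (weight3) (ut_scale 25 (V_A 2))"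
  unfolding V_A_values
  by (rule ut_formI[of _ "20" _ "([:0, 54625, 820961750, 1135621840625, 480467290000000, 92799486044140625, 9947850561738281250, 661951726911865234375, 29318849958234863281250, 904364284559991455078125, 20003299836399993896484375, 322854826000000000000000000, 3831770060000000000000000000, 33380816000000000000000000000, 210745800000000000000000000000, 937624000000000000000000000000, 2786000000000000000000000000000, 4960000000000000000000000000000, 4000000000000000000000000000000:], [:0, 125, 10499125, 34864199375, 23499668203125, 6136381052265625, 816197255160546875, 63995878032519531250, 3228220905577636718750, 110741175968027343750000, 2676935903920043945312500, 46597395568000030517578125, 590313052000000000000000000, 5444084800000000000000000000, 36142440000000000000000000000, 168155200000000000000000000000, 520080000000000000000000000000, 960000000000000000000000000000, 800000000000000000000000000000:])"]) (simp_all add: ut_scale_def form1_def form2_def form3_def form4_def weight_def weight3_def)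

lemma form5_V_A_2: "ut_form (ut_scale 25 form1) (weight 3) (weight 3) (ut_scale 125 (V_A 2))"
  unfolding V_A_values
  by (rule ut_formI[of _ "5" _ "([:0, 276250, 4104801250, 5678109203125, 2402336450000000, 463997430220703125, 49739252808691406250, 3309758634559326171875, 146594249791174316406250, 4521821422799957275390625, 100016499181999969482421875, 1614274130000000000000000000, 19158850300000000000000000000, 166904080000000000000000000000, 1053729000000000000000000000000, 4688120000000000000000000000000, 13930000000000000000000000000000, 24800000000000000000000000000000, 20000000000000000000000000000000:], [:0, 0, 52497500, 174320996875, 117498341015625, 30681905261328125, 4080986275802734375, 319979390162597656250, 16141104527888183593750, 553705879840136718750000, 13384679519600219726562500, 232986977840000152587890625, 2951565260000000000000000000, 27220424000000000000000000000, 180712200000000000000000000000, 840776000000000000000000000000, 2600400000000000000000000000000, 4800000000000000000000000000000, 4000000000000000000000000000000:])"]) (simp_all add: ut_scale_def form1_def form2_def form3_def form4_def weight_def weight3_def)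

lemma form3_W_A_1: "ut_form form3 (weight 2) (weight3) (ut_scale 25 (W_A 1))"
  unfolding W_A_values
  by (rule ut_formI[of _ "10" _ "([:0, 42875, 16385000, 1478306250, 54264062500, 978880078125, 9200000000000, 43200000000000, 80000000000000:], [:0, 750, 967000, 140058750, 6718296875, 144703671875, 1545599609375, 8000000000000, 16000000000000:])"]) (simp_all add: ut_scale_def form1_def form2_def form3_def form4_def weight_def weight3_def)

lemma form5_W_A_1: "ut_form (ut_scale 25 form1) (weight 3) (weight 3) (ut_scale 125 (W_A 1))"
  unfolding W_A_values
  by (rule ut_formI[of _ "15" _ "([:0, 215000, 81921250, 7391531250, 271320312500, 4894400390625, 46000000000000, 216000000000000, 400000000000000:], [:0, 3125, 4835625, 700293750, 33591484375, 723518359375, 7727998046875, 40000000000000, 80000000000000:])"]) (simp_all add: ut_scale_def form1_def form2_def form3_def form4_def weight_def weight3_def)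

lemma form3_W_A_2: "ut_form form3 (weight 2) (weight3) (ut_scale 25 (W_A 2))"
  unfolding W_A_values
  by (rule ut_formI[of _ "5" _ "([:0, 36625, 96335000, 39392328125, 5839660312500, 426010462500000, 17757031808593750, 458743440673828125, 7672508825683593750, 84510000042724609375, 608568000030517578125, 2756000000000000000000, 7120000000000000000000, 8000000000000000000000:], [:0, 125, 2542000, 2047416875, 439877906250, 40926569218750, 2032294281250000, 60002397402343750, 1115676111816406250, 13398959863281250000, 103710399780273437500, 499359999847412109375, 1360000000000000000000, 1600000000000000000000:])"]) (simp_all add: ut_scale_def form1_def form2_def form3_def form4_def weight_def weight3_def)

lemma form5_W_A_2: "ut_form (ut_scale 25 form1) (weight 3) (weight 3) (ut_scale 125 (W_A 2))"
  unfolding W_A_values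
  by (rule ut_formI[of _ "20" _ "([:0, 182500, 481673125, 196961640625, 29198301562500, 2130052312500000, 88785159042968750, 2293717203369140625, 38362544128417968750, 422550000213623046875, 3042840000152587890625, 13780000000000000000000, 35600000000000000000000, 40000000000000000000000:], [:0, 0, 12710000, 10237084375, 2199389531250, 204632846093750, 10161471406250000, 300011987011718750, 5578380559082031250, 66994799316406250000, 518551998901367187500, 2496799999237060546875, 6800000000000000000000, 8000000000000000000000:])"]) (simp_all add: ut_scale_def form1_def form2_def form3_def form4_def weight_def weight3_def)

section \<open>The four steps of one period\<close>

lemma form1_step:
  assumes "ut_form form1 (weight 1) (weight 1) P" "N \<ge> 2"
  shows "ut_form form2 (weight 1) (weight 1) (ut_step V_U W_U N P)"
proof (rule ut_step_form[OF assms(1)])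
  have "ut_step V_U W_U N form1 = ut_scale 3 (V_U 1) + W_U 1 + W_U 2"
    using ut_step_quadratic[OF assms(2), of form1 V_U W_U] by (simp add: form1_def ut_scale_def eval_nat_numeral flip: zero_prod_def)
  thus "ut_form form2 (weight 1) (weight 1) (ut_step V_U W_U N form1)"
    using form1_U by simp
  fix i :: nat assume i: "1 \<le> i"
  show "ut_form form2 (weight 1) (weight 1) (ut_scale (5 ^ weight 1 i) (V_U i))"
    using form_weight_tail[OF _ V_W_bounded(1) weight_le_Suc weight_le_Suc] form_weight_low[OF i _ V_W_bounded(1)] by (cases "i < 3") auto
  show "ut_form form2 (weight 1) (weight 1) (ut_scale (5 ^ weight 1 i) (W_U i))"
    using form_weight_tail[OF _ V_W_bounded(2)[OF i] weight_le_Suc weight_le_Suc] form_weight_low[OF i _ V_W_bounded(2)[OF i]] by (cases "i < 3") auto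
qed

text \<open>An \<open>A\<close> step: the remainder passes from weight 1 to weight 2 while the
  factor 5 of the leading form stays. In the steps without \<open>A\<close>,
  \<open>form1_step\<close> and \<open>form3_step\<close>, it is the leading form that
  gains.\<close>

lemma form2_step:
  assumes "ut_form form2 (weight 1) (weight 1) P" "N \<ge> 2"
  shows "ut_form form3 (weight 2) weight3 (ut_step V_A W_A N P)"
proof (rule ut_step_form[OF assms(1)])
  have "ut_step V_A W_A N form2 = ut_scale 5 (W_A 1) + ut_scale (- 5) (W_A 2)"
    using ut_step_quadratic[OF assms(2), of form2 V_A W_A] by (simp add: form2_def ut_scale_def eval_nat_numeral flip: zero_prod_def)
  thus "ut_form form3 (weight 2) weight3 (ut_step V_A W_A N form2)"
    using form2_A by simp
  fix i :: nat assume i: "1 \<le> i"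
  have w: "weight 2 j \<le> weight (Suc 1) j" "weight3 j \<le> weight (Suc 1) j" for j
    using weight3_le[of j] by (simp_all add: numeral_2_eq_2)
  consider "i = 1" | "i = 2" | "i \<ge> 3" using i by linarith
  thus "ut_form form3 (weight 2) weight3 (ut_scale (5 ^ weight 1 i) (V_A i))"
  proof cases
    case 3 thus ?thesis using form_weight_tail[OF _ V_W_bounded(3) w] by blast
  qed (use form3_V_A_1 form3_V_A_2 in \<open>simp_all add: weight_def\<close>)
  consider "i = 1" | "i = 2" | "i \<ge> 3" using i by linarith
  thus "ut_form form3 (weight 2) weight3 (ut_scale (5 ^ weight 1 i) (W_A i))"
  proof cases
    case 3 thus ?thesis using form_weight_tail[OF _ V_W_bounded(4) w] by blast
  qed (use form3_W_A_1 form3_W_A_2 in \<open>simp_all add: weight_def\<close>)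
qed

lemma form3_step:
  assumes "ut_form form3 (weight 2) weight3 P" "N \<ge> 2"
  shows "ut_form form4 (weight 2) (weight 2) (ut_step V_U W_U N P)"
proof (rule ut_step_form[OF assms(1)])
  have "ut_step V_U W_U N form3 = ut_scale 35 (V_U 1) + ut_scale (- 5) (W_U 1) + ut_scale (- 75) (V_U 2) + ut_scale 20 (W_U 2)"
    using ut_step_quadratic[OF assms(2), of form3 V_U W_U] by (simp add: form3_def ut_scale_def eval_nat_numeral)
  thus "ut_form form4 (weight 2) (weight 2) (ut_step V_U W_U N form3)"
    using form3_U by simp
  fix i :: nat assume i: "1 \<le> i"
  show "ut_form form4 (weight 2) (weight 2) (ut_scale (5 ^ weight 2 i) (V_U i))"
    using form_weight_tail[OF _ V_W_bounded(1) weight_le_Suc weight_le_Suc] form_weight_low[OF i _ V_W_bounded(1)] by (cases "i < 3") auto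
  have *: "ut_form form4 (weight 2) (weight 2) (ut_scale (5 ^ weight 2 i) (W_U i))"
    using form_weight_tail[OF _ V_W_bounded(2)[OF i] weight_le_Suc weight_le_Suc] form_weight_low[OF i _ V_W_bounded(2)[OF i]] by (cases "i < 3") auto
  show "ut_form form4 (weight 2) (weight 2) (ut_scale (5 ^ weight3 i) (W_U i))"
  proof (cases "i = 3")
    case True
    \<comment> \<open>The exceptional term brings only 5^3. That suffices because the loss of
      \<open>W_U 3\<close> is 2 and \<open>weight 2 j\<close> is at most 3 + (j - 2), so the
      exception does not reach the next function.\<close>
    have "ut_bounded 2 15 (W_U 3)" using V_W_bounded(2)[of 3] by (simp add: numeral_2_eq_2)
    hence "ut_form form4 (weight 2) (weight 2) (ut_scale (5 ^ 3) (W_U 3))"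
      using weight_le_low[of 2] by (intro ut_form_weight) (auto simp: eval_nat_numeral)
    thus ?thesis by (simp add: True weight3_def)
  qed (use * in \<open>simp add: weight3_def\<close>)
qed

lemma form4_step:
  assumes "ut_form form4 (weight 2) (weight 2) P" "N \<ge> 2"
  shows "ut_form (ut_scale 25 form1) (weight 3) (weight 3) (ut_step V_A W_A N P)"
proof (rule ut_step_form[OF assms(1)])
  have "ut_step V_A W_A N form4 = ut_scale 25 (V_A 1) + ut_scale (- 25) (W_A 2)"
    using ut_step_quadratic[OF assms(2), of form4 V_A W_A] by (simp add: form4_def ut_scale_def eval_nat_numeral flip: zero_prod_def)
  thus "ut_form (ut_scale 25 form1) (weight 3) (weight 3) (ut_step V_A W_A N form4)"
    using form4_A by simp
  fix i :: nat assume i: "1 \<le> i"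
  have w: "weight 3 j \<le> weight (Suc 2) j" for j by (simp add: numeral_3_eq_3 numeral_2_eq_2)
  consider "i = 1" | "i = 2" | "i \<ge> 3" using i by linarith
  thus "ut_form (ut_scale 25 form1) (weight 3) (weight 3) (ut_scale (5 ^ weight 2 i) (V_A i))"
  proof cases
    case 3 thus ?thesis using form_weight_tail[OF _ V_W_bounded(3) w w] by blast
  qed (use form5_V_A_1 form5_V_A_2 in \<open>simp_all add: weight_def\<close>)
  consider "i = 1" | "i = 2" | "i \<ge> 3" using i by linarith
  thus "ut_form (ut_scale 25 form1) (weight 3) (weight 3) (ut_scale (5 ^ weight 2 i) (W_A i))"
  proof cases
    case 3 thus ?thesis using form_weight_tail[OF _ V_W_bounded(4) w w] by blast
  qed (use form5_W_A_1 form5_W_A_2 in \<open>simp_all add: weight_def\<close>)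
qed

section \<open>Degree bounds and transfer to the average \<open>U_q\<close>\<close>

definition ut_degree_le :: "nat \<Rightarrow> ut_poly \<Rightarrow> bool" where
  "ut_degree_le n P \<longleftrightarrow> degree (fst P) \<le> n \<and> degree (snd P) \<le> n \<and> coeff (fst P) 0 = 0 \<and> coeff (snd P) 0 = 0"

lemma ut_degree_le_step:
  assumes V: "\<And>i. 1 \<le> i \<Longrightarrow> ut_bounded (i div 5 + 2) (5 * i + c) (V i) \<and> coeff (fst (V i)) 0 = 0"
    and W: "\<And>i. 1 \<le> i \<Longrightarrow> ut_bounded (i div 5 + 2) (5 * i + c) (W i) \<and> coeff (fst (W i)) 0 = 0"
  shows "ut_degree_le (5 * N + c) (ut_step V W N P)"
proof -
  have add: "ut_degree_le n (P + Q)" if "ut_degree_le n P" "ut_degree_le n Q" for n P Q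
    using that by (auto simp: ut_degree_le_def intro: degree_add_le)
  have scale: "ut_degree_le n (ut_scale a P)" if "ut_degree_le n P" for n P a
    using that by (auto simp: ut_degree_le_def ut_scale_def intro: order_trans[OF degree_smult_le])
  have sum: "ut_degree_le n (\<Sum>i\<in>A. F i)" if "\<And>i. i \<in> A \<Longrightarrow> ut_degree_le n (F i)" "finite A" for n A and F :: "nat \<Rightarrow> ut_poly"
    using that(2,1) by (induction A rule: finite_induct) (simp add: ut_degree_le_def, simp add: add)
  have "ut_degree_le (5 * N + c) (V i)" "ut_degree_le (5 * N + c) (W i)" if "i \<in> {1..N}" for i
    using V[of i] W[of i] that by (auto simp: ut_degree_le_def ut_bounded_def)
  thus ?thesis unfolding ut_step_def by (intro sum add scale) auto
qed

lemma eval_int_sum: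
  assumes "degree p \<le> n" "coeff p 0 = 0"
  shows "eval_int p u = (\<Sum>i\<in>{1..n}. of_int (coeff p i) * u ^ i)"
proof -
  have "eval_int p u = (\<Sum>i\<le>degree (map_poly complex_of_int p). of_int (coeff p i) * u ^ i)"
    by (simp add: eval_int_def poly_altdef coeff_map_poly)
  also have "\<dots> = (\<Sum>i\<in>{1..n}. of_int (coeff p i) * u ^ i)"
  proof (rule sum.mono_neutral_cong)
    show "of_int (coeff p i) * u ^ i = 0" if "i \<in> {..degree (map_poly complex_of_int p)} - {1..n}" for i
      using that assms coeff_eq_0[of p i] by (cases "i = 0") auto
    show "of_int (coeff p i) * u ^ i = 0" if "i \<in> {1..n} - {..degree (map_poly complex_of_int p)}" for i
      using that coeff_eq_0[of "map_poly complex_of_int p" i] by (auto simp: coeff_map_poly)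
  qed auto
  finally show ?thesis .
qed

lemma U_q_sum: "finite A \<Longrightarrow> U_q (\<lambda>y. \<Sum>i\<in>A. F i y) x = (\<Sum>i\<in>A. U_q (F i) x)"
proof (induction A rule: finite_induct)
  case empty
  show ?case by (simp add: U_q_def)
qed (simp add: U_q_add)

lemma eval_ut_sum: "eval_ut u t (\<Sum>i\<in>A. F i) = (\<Sum>i\<in>A. eval_ut u t (F i))"
  by (induction A rule: infinite_finite_induct) (simp_all add: eval_ut_def[of u t 0])

lemma U_q_ut_step:
  assumes P: "ut_degree_le N P"
    and V: "\<And>i. 1 \<le> i \<Longrightarrow> U_q (\<lambda>y. h y * u_q y ^ i) x = eval_ut u t (V i)"
    and W: "\<And>i. 1 \<le> i \<Longrightarrow> U_q (\<lambda>y. h y * (u_q y ^ i * t_q y)) x = eval_ut u t (W i)"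
  shows "U_q (\<lambda>y. h y * eval_ut (u_q y) (t_q y) P) x = eval_ut u t (ut_step V W N P)"
proof -
  have "(\<lambda>y. h y * eval_ut (u_q y) (t_q y) P) = (\<lambda>y. \<Sum>i\<in>{1..N}. of_int (coeff (fst P) i) * (h y * u_q y ^ i)
      + of_int (coeff (snd P) i) * (h y * (u_q y ^ i * t_q y)))"
  proof
    fix y
    have "eval_int (fst P) (u_q y) = (\<Sum>i\<in>{1..N}. of_int (coeff (fst P) i) * u_q y ^ i)"
      "eval_int (snd P) (u_q y) = (\<Sum>i\<in>{1..N}. of_int (coeff (snd P) i) * u_q y ^ i)"
      by (rule eval_int_sum; use P in \<open>simp add: ut_degree_le_def\<close>)+
    thus "h y * eval_ut (u_q y) (t_q y) P = (\<Sum>i\<in>{1..N}. of_int (coeff (fst P) i) * (h y * u_q y ^ i)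
      + of_int (coeff (snd P) i) * (h y * (u_q y ^ i * t_q y)))"
      by (simp add: eval_ut_def sum_distrib_left sum_distrib_right sum.distrib algebra_simps)
  qed
  hence "U_q (\<lambda>y. h y * eval_ut (u_q y) (t_q y) P) x = (\<Sum>i\<in>{1..N}. of_int (coeff (fst P) i) * U_q (\<lambda>y. h y * u_q y ^ i) x
      + of_int (coeff (snd P) i) * U_q (\<lambda>y. h y * (u_q y ^ i * t_q y)) x)"
    by (simp add: U_q_sum U_q_add U_q_cmult)
  also have "\<dots> = (\<Sum>i\<in>{1..N}. eval_ut u t (ut_scale (coeff (fst P) i) (V i) + ut_scale (coeff (snd P) i) (W i)))"
    by (intro sum.cong refl) (simp add: V W)
  finally show ?thesis by (simp add: ut_step_def eval_ut_sum)
qed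

lemma U_q_step_U:
  assumes "x \<in> punctured_disc" "ut_degree_le N P"
  shows "U_q (\<lambda>y. eval_ut (u_q y) (t_q y) P) x = eval_ut5 x (ut_step V_U W_U N P)"
proof -
  have V: "U_q (\<lambda>y. 1 * u_q y ^ i) x = eval_ut5 x (V_U i)" for i
    using U_q_u_power_1[OF assms(1)] by (simp add: V_U_def)
  have W: "U_q (\<lambda>y. 1 * (u_q y ^ i * t_q y)) x = eval_ut5 x (W_U i)" if "1 \<le> i" for i
  proof -
    obtain k where k: "i = Suc k" using \<open>1 \<le> i\<close> by (cases i) auto
    have "(\<lambda>y. 1 * (u_q y ^ i * t_q y)) = (\<lambda>y. u_q y * t_q y * u_q y ^ k)" by (rule ext) (simp add: k)
    thus ?thesis using U_q_u_power_z[OF assms(1), of k] by (simp add: W_U_def k)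
  qed
  show ?thesis using U_q_ut_step[OF assms(2), of "\<lambda>_. 1", OF V W] by simp
qed

lemma U_q_step_A:
  assumes "x \<in> punctured_disc" "ut_degree_le N P"
  shows "U_q (\<lambda>y. A_q y * eval_ut (u_q y) (t_q y) P) x = eval_ut5 x (ut_step V_A W_A N P)"
proof (rule U_q_ut_step[OF assms(2)])
  show "U_q (\<lambda>y. A_q y * u_q y ^ i) x = eval_ut5 x (V_A i)" for i
    using U_q_u_power_A[OF assms(1)] by (simp add: V_A_def)
  show "U_q (\<lambda>y. A_q y * (u_q y ^ i * t_q y)) x = eval_ut5 x (W_A i)" for i
    using U_q_u_power_At[OF assms(1), of i] by (simp add: W_A_def mult_ac)
qed

section \<open>The functions \<open>L\<^sub>n\<close>\<close>

abbreviation nome :: "complex \<Rightarrow> complex" where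
  "nome \<tau> \<equiv> exp (2 * of_real pi * \<i> * \<tau>)"

lemma nome_punctured_disc: "\<tau> \<in> upper_half_plane \<Longrightarrow> nome \<tau> \<in> punctured_disc"
  by (simp add: upper_half_plane_def norm_exp_eq_Re)

lemma dedekind_eta_multiple:
  "dedekind_eta (of_nat k * \<tau>) = exp (2 * of_real pi * \<i> * \<tau> / 24) ^ k * euler_prod (nome \<tau> ^ k)"
proof -
  have "exp (2 * of_real pi * \<i> * (of_nat k * \<tau>) / 24) = exp (of_nat k * (2 * of_real pi * \<i> * \<tau> / 24))"
    by (simp add: mult_ac)
  moreover have "exp (2 * of_real pi * \<i> * (of_nat k * \<tau>)) = exp (of_nat k * (2 * of_real pi * \<i> * \<tau>))"
    by (simp add: mult_ac)
  ultimately show ?thesis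
    unfolding dedekind_eta_def euler_prod_def q_poch_inf_def exp_of_nat_mult by simp
qed

lemma eta_quotients_nome:
  assumes "\<tau> \<in> upper_half_plane"
  shows "t_fun \<tau> = t_q (nome \<tau>)" "u_fun \<tau> = u_q (nome \<tau>)" "A_fun \<tau> = A_q (nome \<tau>)"
proof -
  \<comment> \<open>A 24th root of the nome: with it all fractional powers of q become integer
    powers of one nonzero number.\<close>
  define r where "r = exp (2 * of_real pi * \<i> * \<tau> / 24)"
  have r: "r \<noteq> 0" by (simp add: r_def)
  have q: "nome \<tau> = r ^ 24" unfolding r_def exp_of_nat_mult[symmetric] by (simp add: mult_ac)
  note e = dedekind_eta_multiple[of _ \<tau>, folded r_def]
  have eta: "dedekind_eta \<tau> = r * euler_prod (nome \<tau>)" "dedekind_eta (2 * \<tau>) = r ^ 2 * euler_prod (nome \<tau> ^ 2)"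
    "dedekind_eta (5 * \<tau>) = r ^ 5 * euler_prod (nome \<tau> ^ 5)" "dedekind_eta (10 * \<tau>) = r ^ 10 * euler_prod (nome \<tau> ^ 10)"
    "dedekind_eta (25 * \<tau>) = r ^ 25 * euler_prod (nome \<tau> ^ 25)" "dedekind_eta (50 * \<tau>) = r ^ 50 * euler_prod (nome \<tau> ^ 50)"
    using e[of 1] e[of 2] e[of 5] e[of 10] e[of 25] e[of 50] by simp_all
  have nz: "nome \<tau> \<noteq> 0" by simp
  define a b c d f g where "a = euler_prod (nome \<tau>)" and "b = euler_prod (nome \<tau> ^ 2)" and "c = euler_prod (nome \<tau> ^ 5)"
    and "d = euler_prod (nome \<tau> ^ 10)" and "f = euler_prod (nome \<tau> ^ 25)" and "g = euler_prod (nome \<tau> ^ 50)"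
  have E: "a \<noteq> 0" "b \<noteq> 0" "c \<noteq> 0" "d \<noteq> 0" "f \<noteq> 0" "g \<noteq> 0"
    using euler_prod_power_nonzero[OF nome_punctured_disc[OF assms]] euler_prod_nonzero[OF punctured_discD(1)[OF nome_punctured_disc[OF assms]]]
    by (simp_all add: a_def b_def c_def d_def f_def g_def)
  note fold = a_def[symmetric] b_def[symmetric] c_def[symmetric] d_def[symmetric] f_def[symmetric] g_def[symmetric]
  show "t_fun \<tau> = t_q (nome \<tau>)"
    unfolding t_fun_def t_q_def eta fold unfolding q using r E
    by (simp add: field_simps power_mult_distrib flip: power_mult power_add power_Suc)
  show "u_fun \<tau> = u_q (nome \<tau>)"
    unfolding u_fun_def u_q_def eta fold unfolding q using r E
    by (simp add: field_simps power_mult_distrib flip: power_mult power_add power_Suc)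
  show "A_fun \<tau> = A_q (nome \<tau>)"
    unfolding A_fun_def A_q_def eta fold unfolding q using r E
    by (simp add: field_simps power_mult_distrib flip: power_mult power_add power_Suc)
qed

lemma U5_nome:
  assumes "\<tau> \<in> upper_half_plane" and f: "\<And>\<sigma>. \<sigma> \<in> upper_half_plane \<Longrightarrow> f \<sigma> = F (nome \<sigma>)"
  shows "U5 f \<tau> = U_q F (nome (\<tau> / 5))" "nome (\<tau> / 5) \<in> punctured_disc" "nome (\<tau> / 5) ^ 5 = nome \<tau>"
proof -
  have "f ((\<tau> + of_nat l) / 5) = F (zeta5 ^ l * nome (\<tau> / 5))" for l
  proof -
    have "(\<tau> + of_nat l) / 5 \<in> upper_half_plane" using assms(1) by (simp add: upper_half_plane_def)
    moreover have "2 * of_real pi * \<i> * ((\<tau> + of_nat l) / 5) = of_nat l * (2 * of_real pi * \<i> / 5) + 2 * of_real pi * \<i> * (\<tau> / 5)"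
      by (simp add: field_simps)
    ultimately show ?thesis by (simp only: f zeta5_def exp_of_nat_mult exp_add)
  qed
  moreover have "{0..4::nat} = {..<5}" by auto
  ultimately show "U5 f \<tau> = U_q F (nome (\<tau> / 5))" unfolding U5_def U_q_def by simp
  show "nome (\<tau> / 5) \<in> punctured_disc"
    using assms(1) by (intro nome_punctured_disc) (simp add: upper_half_plane_def)
  show "nome (\<tau> / 5) ^ 5 = nome \<tau>" unfolding exp_of_nat_mult[symmetric] by (simp add: mult_ac)
qed

lemma L_fun_step_even:
  assumes "even n" "\<And>\<tau>. \<tau> \<in> upper_half_plane \<Longrightarrow> L_fun n \<tau> = c * eval_ut (u_fun \<tau>) (t_fun \<tau>) P" "ut_degree_le N P"
    and \<tau>: "\<tau> \<in> upper_half_plane"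
  shows "L_fun (Suc n) \<tau> = c * eval_ut (u_fun \<tau>) (t_fun \<tau>) (ut_step V_A W_A N P)"
proof -
  have "A_fun \<sigma> * L_fun n \<sigma> = c * (A_q (nome \<sigma>) * eval_ut (u_q (nome \<sigma>)) (t_q (nome \<sigma>)) P)" if "\<sigma> \<in> upper_half_plane" for \<sigma>
    using that by (simp add: assms(2) eta_quotients_nome)
  note U = U5_nome[OF \<tau>, of "\<lambda>\<tau>. A_fun \<tau> * L_fun n \<tau>" "\<lambda>q. c * (A_q q * eval_ut (u_q q) (t_q q) P)", OF this]
  show ?thesis
    using assms(1) U(1) U_q_step_A[OF U(2) assms(3)] U(3) \<tau> by (simp add: U_q_cmult eta_quotients_nome)
qed

lemma L_fun_step_odd:
  assumes "odd n" "\<And>\<tau>. \<tau> \<in> upper_half_plane \<Longrightarrow> L_fun n \<tau> = c * eval_ut (u_fun \<tau>) (t_fun \<tau>) P" "ut_degree_le N P"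
    and \<tau>: "\<tau> \<in> upper_half_plane"
  shows "L_fun (Suc n) \<tau> = c * eval_ut (u_fun \<tau>) (t_fun \<tau>) (ut_step V_U W_U N P)"
proof -
  have "L_fun n \<sigma> = c * eval_ut (u_q (nome \<sigma>)) (t_q (nome \<sigma>)) P" if "\<sigma> \<in> upper_half_plane" for \<sigma>
    using that by (simp add: assms(2) eta_quotients_nome)
  note U = U5_nome[OF \<tau>, of "L_fun n" "\<lambda>q. c * eval_ut (u_q q) (t_q q) P", OF this]
  show ?thesis
    using assms(1) U(1) U_q_step_U[OF U(2) assms(3)] U(3) \<tau> by (simp add: U_q_cmult eta_quotients_nome)
qed

lemma ut_degree_le_step_U: "ut_degree_le (5 * N) (ut_step V_U W_U N P)"
  using ut_degree_le_step[of 0 V_U W_U N P] V_W_bounded V_W_coeff_0 by simp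

lemma ut_degree_le_step_A: "ut_degree_le (5 * N + 8) (ut_step V_A W_A N P)"
  using ut_degree_le_step[of 8 V_A W_A N P] V_W_bounded V_W_coeff_0 by simp

text \<open>For j > 0 one has \<open>weight 3 j = 2 + weight 1 j\<close>, so 25 can be divided out.
  At j = 0 the weights give nothing, and the vanishing constant terms from
  \<open>ut_degree_le\<close> are used.\<close>

lemma ut_form_unscale:
  assumes P: "ut_form (ut_scale 25 form1) (weight 3) (weight 3) P" "ut_degree_le N P" and N: "N \<ge> 2"
  obtains Q where "P = ut_scale 25 Q" "ut_form form1 (weight 1) (weight 1) Q" "ut_degree_le N Q"
proof -
  obtain a R where R: "P = ut_scale a (ut_scale 25 form1) + R" "dvd_coeffs (weight 3) (fst R)" "dvd_coeffs (weight 3) (snd R)"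
    using P(1) unfolding ut_form_def by blast
  have R0: "coeff (fst R) 0 = 0" "coeff (snd R) 0 = 0"
    using P(2) unfolding R(1) by (auto simp: ut_degree_le_def ut_scale_def form1_def)
  have unscale: "\<exists>r'. r = smult 25 r' \<and> dvd_coeffs (weight 1) r'" if r: "dvd_coeffs (weight 3) r" "coeff r 0 = 0" for r
  proof -
    have d: "25 * 5 ^ weight 1 j dvd coeff r j" for j
    proof (cases "j = 0")
      case False
      hence "weight 3 j = 2 + weight 1 j" by (simp add: weight_def)
      hence "(25::int) * 5 ^ weight 1 j = 5 ^ weight 3 j" by (simp add: power_add)
      thus ?thesis using r(1) by (simp add: dvd_coeffs_def)
    qed (use r in simp)
    hence "25 dvd coeff r j" for j by (meson dvd_mult_left)
    hence "[:25:] dvd r" by (simp add: const_poly_dvd_iff)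
    then obtain r' where r': "r = smult 25 r'" by (elim dvdE) simp
    have "5 ^ weight 1 j dvd coeff r' j" for j using d[of j] by (simp add: r')
    thus ?thesis using r' by (auto simp: dvd_coeffs_def)
  qed
  obtain r s where rs: "fst R = smult 25 r" "dvd_coeffs (weight 1) r" "snd R = smult 25 s" "dvd_coeffs (weight 1) s"
    using unscale[OF R(2) R0(1)] unscale[OF R(3) R0(2)] by blast
  define Q where "Q = ut_scale a form1 + (r, s)"
  have PQ: "P = ut_scale 25 Q"
  proof -
    have "R = ut_scale 25 (r, s)" using rs by (simp add: ut_scale_def prod_eq_iff)
    thus ?thesis unfolding R(1) Q_def ut_scale_add by (simp add: ut_scale_def mult.commute)
  qed
  show ?thesis
  proof (rule that[OF PQ])
    show "ut_form form1 (weight 1) (weight 1) Q" unfolding Q_def using rs by (intro ut_formI[OF refl]) auto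
    show "ut_degree_le N Q" using P(2) unfolding PQ by (simp add: ut_degree_le_def ut_scale_def)
  qed
qed

text \<open>A step without \<open>A\<close> multiplies the degree bound by 5, a step with
  \<open>A\<close> also adds 8, the degree of \<open>V_A 0\<close>. Each period moves a factor 25
  into c.\<close>

lemma L_fun_chain:
  assumes "ut_form form1 (weight 1) (weight 1) P1" and k: "k \<ge> 2" and d1: "ut_degree_le k P1"
    and L1: "\<And>\<tau>. \<tau> \<in> upper_half_plane \<Longrightarrow> L_fun (4 * \<beta> + 1) \<tau> = c * eval_ut (u_fun \<tau>) (t_fun \<tau>) P1"
  obtains P2 P3 P4 P5 where
    "ut_form form2 (weight 1) (weight 1) P2" "ut_degree_le (5 * k) P2"
    "\<And>\<tau>. \<tau> \<in> upper_half_plane \<Longrightarrow> L_fun (4 * \<beta> + 2) \<tau> = c * eval_ut (u_fun \<tau>) (t_fun \<tau>) P2"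
    "ut_form form3 (weight 2) weight3 P3" "ut_degree_le (25 * k + 8) P3"
    "\<And>\<tau>. \<tau> \<in> upper_half_plane \<Longrightarrow> L_fun (4 * \<beta> + 3) \<tau> = c * eval_ut (u_fun \<tau>) (t_fun \<tau>) P3"
    "ut_form form4 (weight 2) (weight 2) P4" "ut_degree_le (125 * k + 40) P4"
    "\<And>\<tau>. \<tau> \<in> upper_half_plane \<Longrightarrow> L_fun (4 * \<beta> + 4) \<tau> = c * eval_ut (u_fun \<tau>) (t_fun \<tau>) P4"
    "ut_form form1 (weight 1) (weight 1) P5" "ut_degree_le (625 * k + 208) P5"
    "\<And>\<tau>. \<tau> \<in> upper_half_plane \<Longrightarrow> L_fun (4 * \<beta> + 5) \<tau> = 25 * c * eval_ut (u_fun \<tau>) (t_fun \<tau>) P5"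
proof -
  define P2 where "P2 = ut_step V_U W_U k P1"
  define P3 where "P3 = ut_step V_A W_A (5 * k) P2"
  define P4 where "P4 = ut_step V_U W_U (25 * k + 8) P3"
  define Q where "Q = ut_step V_A W_A (125 * k + 40) P4"
  have f2: "ut_form form2 (weight 1) (weight 1) P2" unfolding P2_def using assms(1) k by (rule form1_step)
  have d2: "ut_degree_le (5 * k) P2" unfolding P2_def by (rule ut_degree_le_step_U)
  have L2: "L_fun (4 * \<beta> + 2) \<tau> = c * eval_ut (u_fun \<tau>) (t_fun \<tau>) P2" if "\<tau> \<in> upper_half_plane" for \<tau>
    using L_fun_step_odd[OF _ L1 d1 that] by (simp add: P2_def)
  have f3: "ut_form form3 (weight 2) weight3 P3" unfolding P3_def using f2 k by (intro form2_step) auto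
  have d3: "ut_degree_le (25 * k + 8) P3" unfolding P3_def using ut_degree_le_step_A[of "5 * k" P2] by simp
  have L3: "L_fun (4 * \<beta> + 3) \<tau> = c * eval_ut (u_fun \<tau>) (t_fun \<tau>) P3" if "\<tau> \<in> upper_half_plane" for \<tau>
  proof -
    have "L_fun (Suc (4 * \<beta> + 2)) \<tau> = c * eval_ut (u_fun \<tau>) (t_fun \<tau>) P3"
      unfolding P3_def by (rule L_fun_step_even[OF _ L2 d2 that]) auto
    moreover have "Suc (4 * \<beta> + 2) = 4 * \<beta> + 3" by simp
    ultimately show ?thesis by (simp only:)
  qed
  have f4: "ut_form form4 (weight 2) (weight 2) P4" unfolding P4_def using f3 k by (intro form3_step) auto
  have d4: "ut_degree_le (125 * k + 40) P4" unfolding P4_def using ut_degree_le_step_U[of "25 * k + 8" P3] by simp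
  have L4: "L_fun (4 * \<beta> + 4) \<tau> = c * eval_ut (u_fun \<tau>) (t_fun \<tau>) P4" if "\<tau> \<in> upper_half_plane" for \<tau>
  proof -
    have "L_fun (Suc (4 * \<beta> + 3)) \<tau> = c * eval_ut (u_fun \<tau>) (t_fun \<tau>) P4"
      unfolding P4_def by (rule L_fun_step_odd[OF _ L3 d3 that]) auto
    moreover have "Suc (4 * \<beta> + 3) = 4 * \<beta> + 4" by simp
    ultimately show ?thesis by (simp only:)
  qed
  have f5: "ut_form (ut_scale 25 form1) (weight 3) (weight 3) Q" unfolding Q_def using f4 k by (intro form4_step) auto
  have d5: "ut_degree_le (625 * k + 208) Q" unfolding Q_def using ut_degree_le_step_A[of "125 * k + 40" P4] by (simp add: add.commute)
  have L5: "L_fun (4 * \<beta> + 5) \<tau> = c * eval_ut (u_fun \<tau>) (t_fun \<tau>) Q" if "\<tau> \<in> upper_half_plane" for \<tau>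
  proof -
    have "L_fun (Suc (4 * \<beta> + 4)) \<tau> = c * eval_ut (u_fun \<tau>) (t_fun \<tau>) Q"
      unfolding Q_def by (rule L_fun_step_even[OF _ L4 d4 that]) auto
    moreover have "Suc (4 * \<beta> + 4) = 4 * \<beta> + 5" by simp
    ultimately show ?thesis by (simp only:)
  qed
  obtain P5 where P5: "Q = ut_scale 25 P5" "ut_form form1 (weight 1) (weight 1) P5" "ut_degree_le (625 * k + 208) P5"
    using ut_form_unscale[OF f5 d5] by auto
  show ?thesis
    by (rule that[OF f2 d2 L2 f3 d3 L3 f4 d4 L4 P5(2,3)]) (simp_all add: L5 P5(1))
qed

text \<open>The upper summation limit (5^(4 beta + 2) - 1) / 3, free of division. Its value 8 for
  beta = 0 is the degree of L_1, and k -> 625 k + 208 is the growth of the degree bound over one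
  period.\<close>

lemma power_5_mod_3: "\<exists>k\<ge>8. (5::nat) ^ (4 * \<beta> + 2) = 3 * k + 1"
proof (induction \<beta>)
  case 0
  show ?case by (rule exI[of _ 8]) simp
next
  case (Suc \<beta>)
  then obtain k where "k \<ge> 8" "(5::nat) ^ (4 * \<beta> + 2) = 3 * k + 1" by blast
  thus ?case by (intro exI[of _ "625 * k + 208"]) (simp add: power_add)
qed

lemma L_fun_form1:
  assumes "(5::nat) ^ (4 * \<beta> + 2) = 3 * k + 1"
  shows "\<exists>P. ut_form form1 (weight 1) (weight 1) P \<and> ut_degree_le k P \<and>
    (\<forall>\<tau>\<in>upper_half_plane. L_fun (4 * \<beta> + 1) \<tau> = 5 ^ (2 * \<beta>) * eval_ut (u_fun \<tau>) (t_fun \<tau>) P)"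
  using assms
proof (induction \<beta> arbitrary: k)
  case 0
  hence k: "k = 8" by simp
  show ?case
  proof (intro exI conjI ballI)
    show "ut_form form1 (weight 1) (weight 1) (V_A 0)" by (rule form_V_A_0)
    show "ut_degree_le k (V_A 0)" unfolding V_A_values k by (simp add: ut_degree_le_def)
    fix \<tau> assume \<tau>: "\<tau> \<in> upper_half_plane"
    note U = U5_nome[OF \<tau>, of "\<lambda>\<tau>. A_fun \<tau> * 1" A_q]
    have "U_q A_q (nome (\<tau> / 5)) = eval_ut (u_fun \<tau>) (t_fun \<tau>) (V_A 0)"
      using U_q_u_power_A[OF U(2), of 0] U(3) \<tau> by (simp add: V_A_def eta_quotients_nome)
    thus "L_fun (4 * 0 + 1) \<tau> = 5 ^ (2 * 0) * eval_ut (u_fun \<tau>) (t_fun \<tau>) (V_A 0)"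
      using U(1) by (simp add: eta_quotients_nome)
  qed
next
  case (Suc \<beta>)
  obtain l where l: "l \<ge> 8" "(5::nat) ^ (4 * \<beta> + 2) = 3 * l + 1" using power_5_mod_3 by blast
  obtain P where P: "ut_form form1 (weight 1) (weight 1) P" "ut_degree_le l P"
    "\<And>\<tau>. \<tau> \<in> upper_half_plane \<Longrightarrow> L_fun (4 * \<beta> + 1) \<tau> = 5 ^ (2 * \<beta>) * eval_ut (u_fun \<tau>) (t_fun \<tau>) P"
    using Suc.IH[OF l(2)] by blast
  have k: "k = 625 * l + 208" using Suc.prems l(2) by (simp add: power_add)
  have l2: "l \<ge> 2" using l by simp
  obtain P5 where "ut_form form1 (weight 1) (weight 1) P5" "ut_degree_le (625 * l + 208) P5"
    "\<And>\<tau>. \<tau> \<in> upper_half_plane \<Longrightarrow> L_fun (4 * \<beta> + 5) \<tau> = 25 * 5 ^ (2 * \<beta>) * eval_ut (u_fun \<tau>) (t_fun \<tau>) P5"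
    using L_fun_chain[OF P(1) l2 P(2,3)] by metis
  thus ?case unfolding k by (intro exI[of _ P5]) (simp add: add.commute)
qed

section \<open>Reading off the coefficients of the theorem\<close>

lemma ut_form_expand:
  assumes P: "ut_form v f g P" "ut_degree_le N P" and v: "ut_degree_le N v"
  obtains r s :: "nat \<Rightarrow> int" where "\<And>u t. eval_ut u t P = of_int (r 0) * eval_ut u t v
    + (\<Sum>i = 1..N. 5 ^ f i * of_int (r i) * u ^ i) + (\<Sum>i = 1..N. 5 ^ g i * of_int (s i) * u ^ i * t)"
proof -
  obtain a R where R: "P = ut_scale a v + R" "dvd_coeffs f (fst R)" "dvd_coeffs g (snd R)"
    using P(1) unfolding ut_form_def by blast
  have R': "R = P + ut_scale (- a) v" unfolding R(1) by (simp add: ut_scale_def prod_eq_iff)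
  have "degree (fst R) \<le> N" "degree (snd R) \<le> N" "coeff (fst R) 0 = 0" "coeff (snd R) 0 = 0"
    using P(2) v unfolding R' ut_degree_le_def
    by (auto simp: ut_scale_def intro!: degree_diff_le order_trans[OF degree_smult_le])
  note eR = eval_int_sum[OF this(1,3)] eval_int_sum[OF this(2,4)]
  have "\<forall>i. \<exists>c. coeff (fst R) i = 5 ^ f i * c" "\<forall>i. \<exists>c. coeff (snd R) i = 5 ^ g i * c"
    using R(2,3) by (auto simp: dvd_coeffs_def dvd_def)
  then obtain r s where rs: "\<And>i. coeff (fst R) i = 5 ^ f i * r i" "\<And>i. coeff (snd R) i = 5 ^ g i * s i" by metis
  \<comment> \<open>Both sums start at index 1, so the value at 0 is free to hold the multiple of
    the leading form.\<close>
  show ?thesis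
  proof (rule that[of "r(0 := a)" s])
    fix u t :: complex
    have "(\<Sum>i = 1..N. 5 ^ f i * of_int (r i) * u ^ i) = (\<Sum>i = 1..N. 5 ^ f i * of_int ((r(0 := a)) i) * u ^ i)"
      by (intro sum.cong) auto
    moreover have "eval_ut u t R = (\<Sum>i = 1..N. 5 ^ f i * of_int (r i) * u ^ i) + (\<Sum>i = 1..N. 5 ^ g i * of_int (s i) * u ^ i * t)"
      unfolding eval_ut_def eR by (simp add: rs sum_distrib_right)
    ultimately show "eval_ut u t P = of_int ((r(0 := a)) 0) * eval_ut u t v
      + (\<Sum>i = 1..N. 5 ^ f i * of_int ((r(0 := a)) i) * u ^ i) + (\<Sum>i = 1..N. 5 ^ g i * of_int (s i) * u ^ i * t)"
      unfolding R(1) by simp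
  qed
qed

lemma sum_weight:
  assumes "N \<ge> 3"
  shows "(\<Sum>i = 1..N. 5 ^ weight e i * of_int (r i) * u ^ i * t) = 5 ^ (e + 1) * of_int (r 1) * u * t + 5 ^ (e + 1) * of_int (r 2) * u ^ 2 * t
     + 5 ^ e * (\<Sum>i = 3..N. 5 ^ (5 * i div 6) * of_int (r i) * u ^ i * t :: complex)"
proof -
  have "{1..N} = insert 1 (insert 2 {3..N})" using assms by auto
  moreover have "(\<Sum>i = 3..N. 5 ^ weight e i * of_int (r i) * u ^ i * t) = 5 ^ e * (\<Sum>i = 3..N. 5 ^ (5 * i div 6) * of_int (r i) * u ^ i * t)"
    unfolding sum_distrib_left by (intro sum.cong) (auto simp: weight_def power_add)
  ultimately show ?thesis by (simp add: weight_def)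
qed

lemma sum_weight3:
  assumes "N \<ge> 4"
  shows "(\<Sum>i = 1..N. 5 ^ weight3 i * of_int (r i) * u ^ i * t) = 5 ^ 3 * of_int (r 1) * u * t + 5 ^ 3 * of_int (r 2) * u ^ 2 * t
     + 5 ^ 3 * of_int (r 3) * u ^ 3 * t + 5 ^ 2 * (\<Sum>i = 4..N. 5 ^ (5 * i div 6) * of_int (r i) * u ^ i * t :: complex)"
proof -
  have "{1..N} = insert 1 (insert 2 (insert 3 {4..N}))" using assms by auto
  moreover have "(\<Sum>i = 4..N. 5 ^ weight3 i * of_int (r i) * u ^ i * t) = 5 ^ 2 * (\<Sum>i = 4..N. 5 ^ (5 * i div 6) * of_int (r i) * u ^ i * t)"
    unfolding sum_distrib_left by (intro sum.cong) (auto simp: weight_def weight3_def power_add)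
  ultimately show ?thesis by (simp add: weight_def weight3_def)
qed

lemma eval_forms:
  "eval_ut u t form1 = 3 * u + u * t + u ^ 2 * t"
  "eval_ut u t form2 = 5 * (u * t - u ^ 2 * t)"
  "eval_ut u t form3 = 5 * (7 * u - u * t + 4 * u ^ 2 * t - 15 * u ^ 2)"
  "eval_ut u t form4 = 25 * (u - u ^ 2 * t)"
  by (simp_all add: eval_ut_def form1_def form2_def form3_def form4_def algebra_simps power2_eq_square)

theorem theorem3p1:
  fixes \<beta> :: nat
  shows "\<exists>(a :: nat \<Rightarrow> nat \<Rightarrow> int) (b :: nat \<Rightarrow> nat \<Rightarrow> int).
          (\<forall>\<tau>\<in>upper_half_plane.
            L_fun (4 * \<beta> + 1) \<tau> =
              5 ^ (2 * \<beta>) * of_int (a (4 * \<beta> + 1) 0) * (3 * u_fun \<tau> + u_fun \<tau> * t_fun \<tau> + u_fun \<tau> ^ 2 * t_fun \<tau>)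
              + 5 ^ (2 * \<beta> + 2) * of_int (a (4 * \<beta> + 1) 1) * u_fun \<tau>
              + 5 ^ (2 * \<beta> + 2) * of_int (a (4 * \<beta> + 1) 2) * u_fun \<tau> ^ 2
              + 5 ^ (2 * \<beta> + 1) * (\<Sum>i = 3..(5 ^ (4 * \<beta> + 2) - 1) div 3. 5 ^ (5 * i div 6) * of_int (a (4 * \<beta> + 1) i) * u_fun \<tau> ^ i)
              + 5 ^ (2 * \<beta> + 2) * of_int (b (4 * \<beta> + 1) 1) * u_fun \<tau> * t_fun \<tau>
              + 5 ^ (2 * \<beta> + 2) * of_int (b (4 * \<beta> + 1) 2) * u_fun \<tau> ^ 2 * t_fun \<tau>
              + 5 ^ (2 * \<beta> + 1) * (\<Sum>i = 3..(5 ^ (4 * \<beta> + 2) - 1) div 3. 5 ^ (5 * i div 6) * of_int (b (4 * \<beta> + 1) i) * u_fun \<tau> ^ i * t_fun \<tau>)) \<and>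
          (\<forall>\<tau>\<in>upper_half_plane.
            L_fun (4 * \<beta> + 2) \<tau> =
              5 ^ (2 * \<beta> + 1) * of_int (a (4 * \<beta> + 2) 0) * (u_fun \<tau> * t_fun \<tau> - u_fun \<tau> ^ 2 * t_fun \<tau>)
              + 5 ^ (2 * \<beta> + 2) * of_int (a (4 * \<beta> + 2) 1) * u_fun \<tau>
              + 5 ^ (2 * \<beta> + 2) * of_int (a (4 * \<beta> + 2) 2) * u_fun \<tau> ^ 2
              + 5 ^ (2 * \<beta> + 1) * (\<Sum>i = 3..(5 ^ (4 * \<beta> + 3) - 5) div 3. 5 ^ (5 * i div 6) * of_int (a (4 * \<beta> + 2) i) * u_fun \<tau> ^ i)
              + 5 ^ (2 * \<beta> + 2) * of_int (b (4 * \<beta> + 2) 1) * u_fun \<tau> * t_fun \<tau>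
              + 5 ^ (2 * \<beta> + 2) * of_int (b (4 * \<beta> + 2) 2) * u_fun \<tau> ^ 2 * t_fun \<tau>
              + 5 ^ (2 * \<beta> + 1) * (\<Sum>i = 3..(5 ^ (4 * \<beta> + 3) - 5) div 3. 5 ^ (5 * i div 6) * of_int (b (4 * \<beta> + 2) i) * u_fun \<tau> ^ i * t_fun \<tau>)) \<and>
          (\<forall>\<tau>\<in>upper_half_plane.
            L_fun (4 * \<beta> + 3) \<tau> =
              5 ^ (2 * \<beta> + 1) * of_int (a (4 * \<beta> + 3) 0) * (7 * u_fun \<tau> - u_fun \<tau> * t_fun \<tau> + 4 * u_fun \<tau> ^ 2 * t_fun \<tau> - 15 * u_fun \<tau> ^ 2)
              + 5 ^ (2 * \<beta> + 3) * of_int (a (4 * \<beta> + 3) 1) * u_fun \<tau>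
              + 5 ^ (2 * \<beta> + 3) * of_int (a (4 * \<beta> + 3) 2) * u_fun \<tau> ^ 2
              + 5 ^ (2 * \<beta> + 2) * (\<Sum>i = 3..(5 ^ (4 * \<beta> + 4) - 1) div 3. 5 ^ (5 * i div 6) * of_int (a (4 * \<beta> + 3) i) * u_fun \<tau> ^ i)
              + 5 ^ (2 * \<beta> + 3) * of_int (b (4 * \<beta> + 3) 1) * u_fun \<tau> * t_fun \<tau>
              + 5 ^ (2 * \<beta> + 3) * of_int (b (4 * \<beta> + 3) 2) * u_fun \<tau> ^ 2 * t_fun \<tau>
              + 5 ^ (2 * \<beta> + 3) * of_int (b (4 * \<beta> + 3) 3) * u_fun \<tau> ^ 3 * t_fun \<tau>
              + 5 ^ (2 * \<beta> + 2) * (\<Sum>i = 4..(5 ^ (4 * \<beta> + 4) - 1) div 3. 5 ^ (5 * i div 6) * of_int (b (4 * \<beta> + 3) i) * u_fun \<tau> ^ i * t_fun \<tau>)) \<and>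
          (\<forall>\<tau>\<in>upper_half_plane.
            L_fun (4 * \<beta> + 4) \<tau> =
              5 ^ (2 * \<beta> + 2) * of_int (a (4 * \<beta> + 4) 0) * (u_fun \<tau> - u_fun \<tau> ^ 2 * t_fun \<tau>)
              + 5 ^ (2 * \<beta> + 3) * of_int (a (4 * \<beta> + 4) 1) * u_fun \<tau>
              + 5 ^ (2 * \<beta> + 3) * of_int (a (4 * \<beta> + 4) 2) * u_fun \<tau> ^ 2
              + 5 ^ (2 * \<beta> + 2) * (\<Sum>i = 3..(5 ^ (4 * \<beta> + 5) - 5) div 3. 5 ^ (5 * i div 6) * of_int (a (4 * \<beta> + 4) i) * u_fun \<tau> ^ i)
              + 5 ^ (2 * \<beta> + 3) * of_int (b (4 * \<beta> + 4) 1) * u_fun \<tau> * t_fun \<tau>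
              + 5 ^ (2 * \<beta> + 3) * of_int (b (4 * \<beta> + 4) 2) * u_fun \<tau> ^ 2 * t_fun \<tau>
              + 5 ^ (2 * \<beta> + 2) * (\<Sum>i = 3..(5 ^ (4 * \<beta> + 5) - 5) div 3. 5 ^ (5 * i div 6) * of_int (b (4 * \<beta> + 4) i) * u_fun \<tau> ^ i * t_fun \<tau>))"
proof -
  obtain k where k: "k \<ge> 8" "(5::nat) ^ (4 * \<beta> + 2) = 3 * k + 1" using power_5_mod_3 by blast
  \<comment> \<open>The four summation limits coincide with the degree bounds of
    \<open>L_fun_chain\<close>.\<close>
  have N: "(5 ^ (4 * \<beta> + 2) - 1) div 3 = k" "(5 ^ (4 * \<beta> + 3) - 5) div 3 = 5 * k"
    "(5 ^ (4 * \<beta> + 4) - 1) div 3 = 25 * k + 8" "(5 ^ (4 * \<beta> + 5) - 5) div 3 = 125 * k + (40::nat)"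
  proof -
    have "(5::nat) ^ (4 * \<beta> + 3) = 5 ^ (4 * \<beta> + 2) * 5" "(5::nat) ^ (4 * \<beta> + 4) = 5 ^ (4 * \<beta> + 2) * 25"
      "(5::nat) ^ (4 * \<beta> + 5) = 5 ^ (4 * \<beta> + 2) * 125" by (simp_all add: power_add)
    thus "(5 ^ (4 * \<beta> + 2) - 1) div 3 = k" "(5 ^ (4 * \<beta> + 3) - 5) div 3 = 5 * k"
      "(5 ^ (4 * \<beta> + 4) - 1) div 3 = 25 * k + 8" "(5 ^ (4 * \<beta> + 5) - 5) div 3 = 125 * k + (40::nat)"
      unfolding k(2) by simp_all
  qed
  have bounds: "k \<ge> 2" "5 * k \<ge> 2" "25 * k + 8 \<ge> 2" "125 * k + 40 \<ge> 2"
    "k \<ge> 3" "5 * k \<ge> 3" "25 * k + 8 \<ge> 3" "125 * k + 40 \<ge> 3" "25 * k + 8 \<ge> 4" using k(1) by simp_all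
  obtain P1 where P1: "ut_form form1 (weight 1) (weight 1) P1" "ut_degree_le k P1"
    "\<And>\<tau>. \<tau> \<in> upper_half_plane \<Longrightarrow> L_fun (4 * \<beta> + 1) \<tau> = 5 ^ (2 * \<beta>) * eval_ut (u_fun \<tau>) (t_fun \<tau>) P1"
    using L_fun_form1[OF k(2)] by blast
  obtain P2 P3 P4 where P2: "ut_form form2 (weight 1) (weight 1) P2" "ut_degree_le (5 * k) P2"
      "\<And>\<tau>. \<tau> \<in> upper_half_plane \<Longrightarrow> L_fun (4 * \<beta> + 2) \<tau> = 5 ^ (2 * \<beta>) * eval_ut (u_fun \<tau>) (t_fun \<tau>) P2"
    and P3: "ut_form form3 (weight 2) weight3 P3" "ut_degree_le (25 * k + 8) P3"
      "\<And>\<tau>. \<tau> \<in> upper_half_plane \<Longrightarrow> L_fun (4 * \<beta> + 3) \<tau> = 5 ^ (2 * \<beta>) * eval_ut (u_fun \<tau>) (t_fun \<tau>) P3"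
    and P4: "ut_form form4 (weight 2) (weight 2) P4" "ut_degree_le (125 * k + 40) P4"
      "\<And>\<tau>. \<tau> \<in> upper_half_plane \<Longrightarrow> L_fun (4 * \<beta> + 4) \<tau> = 5 ^ (2 * \<beta>) * eval_ut (u_fun \<tau>) (t_fun \<tau>) P4"
    by (rule L_fun_chain[OF P1(1) bounds(1) P1(2,3)]) blast+
  have forms: "ut_degree_le k form1" "ut_degree_le (5 * k) form2" "ut_degree_le (25 * k + 8) form3" "ut_degree_le (125 * k + 40) form4"
    using bounds by (auto simp: ut_degree_le_def form1_def form2_def form3_def form4_def)
  obtain r1 s1 where e1: "\<And>u t. eval_ut u t P1 = of_int (r1 0) * eval_ut u t form1
    + (\<Sum>i = 1..k. 5 ^ weight 1 i * of_int (r1 i) * u ^ i) + (\<Sum>i = 1..k. 5 ^ weight 1 i * of_int (s1 i) * u ^ i * t)"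
    by (rule ut_form_expand[OF P1(1,2) forms(1)]) blast
  obtain r2 s2 where e2: "\<And>u t. eval_ut u t P2 = of_int (r2 0) * eval_ut u t form2
    + (\<Sum>i = 1..5 * k. 5 ^ weight 1 i * of_int (r2 i) * u ^ i) + (\<Sum>i = 1..5 * k. 5 ^ weight 1 i * of_int (s2 i) * u ^ i * t)"
    by (rule ut_form_expand[OF P2(1,2) forms(2)]) blast
  obtain r3 s3 where e3: "\<And>u t. eval_ut u t P3 = of_int (r3 0) * eval_ut u t form3
    + (\<Sum>i = 1..25 * k + 8. 5 ^ weight 2 i * of_int (r3 i) * u ^ i) + (\<Sum>i = 1..25 * k + 8. 5 ^ weight3 i * of_int (s3 i) * u ^ i * t)"
    by (rule ut_form_expand[OF P3(1,2) forms(3)]) blast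
  obtain r4 s4 where e4: "\<And>u t. eval_ut u t P4 = of_int (r4 0) * eval_ut u t form4
    + (\<Sum>i = 1..125 * k + 40. 5 ^ weight 2 i * of_int (r4 i) * u ^ i) + (\<Sum>i = 1..125 * k + 40. 5 ^ weight 2 i * of_int (s4 i) * u ^ i * t)"
    by (rule ut_form_expand[OF P4(1,2) forms(4)]) blast
  \<comment> \<open>For a fixed beta only the rows 4 beta + 1 to 4 beta + 4 occur; the list index is
    the offset of the row.\<close>
  define a b where "a = (\<lambda>j. [r1, r2, r3, r4] ! (j - (4 * \<beta> + 1)))" and "b = (\<lambda>j. [s1, s2, s3, s4] ! (j - (4 * \<beta> + 1)))"
  have a: "a (4 * \<beta> + 1) = r1" "a (4 * \<beta> + 2) = r2" "a (4 * \<beta> + 3) = r3" "a (4 * \<beta> + 4) = r4"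
    and b: "b (4 * \<beta> + 1) = s1" "b (4 * \<beta> + 2) = s2" "b (4 * \<beta> + 3) = s3" "b (4 * \<beta> + 4) = s4"
    by (simp_all add: a_def b_def)
  \<comment> \<open>Setting t = 1 yields the version of the splitting for the pure powers of
    u.\<close>
  note r = sum_weight[where t = 1, unfolded mult_1_right]
  show ?thesis
    unfolding N
    by (intro exI[of _ a] exI[of _ b] conjI ballI; unfold a b)
      (simp_all only: P1(3) P2(3) P3(3) P4(3) e1 e2 e3 e4 eval_forms r[OF bounds(5)] r[OF bounds(6)] r[OF bounds(7)] r[OF bounds(8)]
        sum_weight[OF bounds(5)] sum_weight[OF bounds(6)] sum_weight3[OF bounds(9)] sum_weight[OF bounds(8)],
       simp_all add: power_add algebra_simps)
qed

end
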